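(* Let $b:\mathbb{D}\to\mathbb{D}$ be analytic and a non-extreme point of the unit ball of $\mathcal{H}^\infty$, let $a$ be its Pythagorean mate, and let $\phi=b/a$. The following three statements are equivalent: (i) $\mathcal{H}^\infty\subset\mathcal{H}(b)$; (ii) $\mathrm{BMOA}\subset\mathcal{H}(b)$; (iii) $\phi\in\mathcal{H}^2$.
   Context: $\mathbb{D}$ is the open unit disk, $\mathbb{T}$ the unit circle, $m$ the Lebesgue measure on $\mathbb{T}$ normalized by $m(\mathbb{T})=1$. $\mathcal{H}^p$ denotes the classical Hardy space on $\mathbb{D}$; $\mathcal{H}^\infty$ is the algebra of bounded analytic functions on $\mathbb{D}$. $\mathrm{BMOA}$ is the space of analytic functions on $\mathbb{D}$ of bounded mean oscillation on $\mathbb{T}$, i.e. the dual of $\mathcal{H}^1$; equivalently $f\in\mathrm{BMOA}$ iff $f=P_+u$ for some $u\in L^\infty(\mathbb{T})$, where $P_+:L^2(\mathbb{T})\to\mathcal{H}^2$ is the orthogonal projection. For analytic $b:\mathbb{D}\to\mathbb{D}$, the de Branges-Rovnyak space $\mathcal{H}(b)$ is the Hilbert space of analytic functions on $\mathbb{D}$ with reproducing kernel $k_b(\lambda,z)=\frac{1-\overline{b(\lambda)}b(z)}{1-\overline{\lambda}z}$. The function $b$ is a non-extreme point of the unit ball of $\mathcal{H}^\infty$ if and only if $\int_{\mathbb{T}}\log(1-|b|)\,dm>-\infty$. In that case its Pythagorean mate is the unique outer function $a$ on $\mathbb{D}$ with $a(0)>0$ and $|a|^2+|b|^2=1$ almost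 everywhere on $\mathbb{T}$ (in terms of boundary values). *)

theory Defs
  imports "HOL-Complex_Analysis.Complex_Analysis" "HOL-Probability.Probability"
begin

text \<open>
  Functions on the unit disk are represented by total functions on \<open>complex\<close> whose values
  outside \<open>ball 0 1\<close> are irrelevant.  Accordingly all function spaces on the disk below are closed
  under changing a function outside the disk, so inclusions between them have their usual meaning.
\<close>

abbreviation unit_disk :: "complex set" where
  "unit_disk \<equiv> ball 0 1"

text \<open>
  Normalized arc length.  The underlying space is the circle, not the whole plane: for \<open>r < 1\<close> the
  function \<open>\<zeta> \<mapsto> f (r * \<zeta>)\<close> is then measurable whatever the values of \<open>f\<close> outside the disk are.
\<close>

definition circle_measure :: "complex measure" where
  "circle_measure =
     distr (uniform_measure lborel {0..2 * pi}) (restrict_space borel (sphere 0 1)) cis"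

definition hardy :: "real \<Rightarrow> (complex \<Rightarrow> complex) set" where
  "hardy p = {f. f holomorphic_on unit_disk \<and>
     bdd_above ((\<lambda>r. LINT \<zeta>|circle_measure. norm (f (of_real r * \<zeta>)) powr p) ` {0..<1})}"

definition hardy_inf :: "(complex \<Rightarrow> complex) set" where
  "hardy_inf = {f. f holomorphic_on unit_disk \<and> bounded (f ` unit_disk)}"

definition hardy_inf_unit_ball :: "(complex \<Rightarrow> complex) set" where
  "hardy_inf_unit_ball = {f. f holomorphic_on unit_disk \<and> (\<forall>z\<in>unit_disk. norm (f z) \<le> 1)}"

text \<open>
  The notion \<^const>\<open>extreme_point_of\<close> is restricted to types of class \<^class>\<open>real_vector\<close>, which
  functions are not; this is its definition with equality of functions read on the disk.
\<close>

definition extreme_point_hardy_inf :: "(complex \<Rightarrow> complex) \<Rightarrow> bool" where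
  "extreme_point_hardy_inf b \<longleftrightarrow> b \<in> hardy_inf_unit_ball \<and>
     (\<forall>f\<in>hardy_inf_unit_ball. \<forall>g\<in>hardy_inf_unit_ball. \<forall>t\<in>{0<..<1::real}.
        (\<forall>z\<in>unit_disk. b z = of_real (1 - t) * f z + of_real t * g z) \<longrightarrow>
        (\<forall>z\<in>unit_disk. f z = g z))"

definition has_radial_limit :: "(complex \<Rightarrow> complex) \<Rightarrow> complex \<Rightarrow> complex \<Rightarrow> bool" where
  "has_radial_limit f l \<zeta> \<longleftrightarrow> ((\<lambda>r::real. f (of_real r * \<zeta>)) \<longlongrightarrow> l) (at_left 1)"

definition outer_function :: "(complex \<Rightarrow> complex) \<Rightarrow> bool" where
  "outer_function f \<longleftrightarrow> (\<exists>(c::complex) (\<psi>::complex \<Rightarrow> real).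
     norm c = 1 \<and> \<psi> \<in> borel_measurable circle_measure \<and> (\<forall>\<zeta>. \<psi> \<zeta> > 0) \<and>
     integrable circle_measure (\<lambda>\<zeta>. ln (\<psi> \<zeta>)) \<and>
     (\<forall>z\<in>unit_disk.
        f z = c * exp (LINT \<zeta>|circle_measure. (\<zeta> + z) / (\<zeta> - z) * of_real (ln (\<psi> \<zeta>)))))"

text \<open>
  Outer functions are zero-free, so \<open>a 0 \<in> \<real>\<close> and \<open>Re (a 0) > 0\<close> fix the unimodular constant, and
  \<open>a\<close> is determined on the disk.  Both radial limits exist almost everywhere by Fatou's theorem.
\<close>

definition pythagorean_mate :: "(complex \<Rightarrow> complex) \<Rightarrow> (complex \<Rightarrow> complex) \<Rightarrow> bool" where
  "pythagorean_mate b a \<longleftrightarrow> outer_function a \<and> a 0 \<in> \<real> \<and> Re (a 0) > 0 \<and>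
     (AE \<zeta> in circle_measure. \<exists>\<alpha> \<beta>. has_radial_limit a \<alpha> \<zeta> \<and> has_radial_limit b \<beta> \<zeta> \<and>
        (norm \<alpha>)\<^sup>2 + (norm \<beta>)\<^sup>2 = 1)"

text \<open>
  The inner product \<open>ip\<close> is linear in its first argument.  Since elements of \<open>V\<close> matter only on
  \<open>X\<close>, \<open>V\<close> is saturated under equality on \<open>X\<close> and definiteness is read on \<open>X\<close>.  With this
  convention the set \<open>V\<close> is uniquely determined by \<open>X\<close> and the kernel \<open>K\<close>.
\<close>

locale rkhs =
  fixes X :: "'x set"
    and V :: "('x \<Rightarrow> complex) set"
    and ip :: "('x \<Rightarrow> complex) \<Rightarrow> ('x \<Rightarrow> complex) \<Rightarrow> complex"
    and K :: "'x \<Rightarrow> 'x \<Rightarrow> complex"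
  assumes zero_mem: "(\<lambda>_. 0) \<in> V"
    and add_mem: "\<lbrakk>f \<in> V; g \<in> V\<rbrakk> \<Longrightarrow> (\<lambda>x. f x + g x) \<in> V"
    and scale_mem: "f \<in> V \<Longrightarrow> (\<lambda>x. c * f x) \<in> V"
    and saturated: "\<lbrakk>f \<in> V; \<And>x. x \<in> X \<Longrightarrow> g x = f x\<rbrakk> \<Longrightarrow> g \<in> V"
    and ip_add: "\<lbrakk>f \<in> V; g \<in> V; h \<in> V\<rbrakk> \<Longrightarrow> ip (\<lambda>x. f x + g x) h = ip f h + ip g h"
    and ip_scale: "\<lbrakk>f \<in> V; g \<in> V\<rbrakk> \<Longrightarrow> ip (\<lambda>x. c * f x) g = c * ip f g"
    and ip_cnj: "\<lbrakk>f \<in> V; g \<in> V\<rbrakk> \<Longrightarrow> ip g f = cnj (ip f g)"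
    and ip_nonneg: "f \<in> V \<Longrightarrow> 0 \<le> Re (ip f f)"
    and ip_eq_0_iff: "f \<in> V \<Longrightarrow> ip f f = 0 \<longleftrightarrow> (\<forall>x\<in>X. f x = 0)"
    and complete: "\<lbrakk>\<And>n::nat. F n \<in> V;
        \<And>e. e > 0 \<Longrightarrow> \<exists>N. \<forall>m\<ge>N. \<forall>n\<ge>N. Re (ip (\<lambda>x. F m x - F n x) (\<lambda>x. F m x - F n x)) < e\<rbrakk>
      \<Longrightarrow> \<exists>f\<in>V. (\<lambda>n. Re (ip (\<lambda>x. F n x - f x) (\<lambda>x. F n x - f x))) \<longlonglongrightarrow> 0"
    and kernel_mem: "x \<in> X \<Longrightarrow> K x \<in> V"
    and reproducing: "\<lbrakk>f \<in> V; x \<in> X\<rbrakk> \<Longrightarrow> ip f (K x) = f x"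

definition dBR_kernel :: "(complex \<Rightarrow> complex) \<Rightarrow> complex \<Rightarrow> complex \<Rightarrow> complex" where
  "dBR_kernel b w z = (1 - cnj (b w) * b z) / (1 - cnj w * z)"

definition dBR_space :: "(complex \<Rightarrow> complex) \<Rightarrow> (complex \<Rightarrow> complex) set" where
  "dBR_space b = (THE V. (\<forall>f\<in>V. f holomorphic_on unit_disk) \<and>
     (\<exists>ip. rkhs unit_disk V ip (dBR_kernel b)))"

definition L2_circle :: "(complex \<Rightarrow> complex) set" where
  "L2_circle = {u. u \<in> borel_measurable circle_measure \<and>
     integrable circle_measure (\<lambda>\<zeta>. (norm (u \<zeta>))\<^sup>2)}"

definition Linf_circle :: "(complex \<Rightarrow> complex) set" where
  "Linf_circle = {u. u \<in> borel_measurable circle_measure \<and>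
     (\<exists>C. AE \<zeta> in circle_measure. norm (u \<zeta>) \<le> C)}"

definition fourier_coeff :: "(complex \<Rightarrow> complex) \<Rightarrow> int \<Rightarrow> complex" where
  "fourier_coeff u n = (LINT \<zeta>|circle_measure. u \<zeta> * \<zeta> powi (- n))"

definition hardy2_circle :: "(complex \<Rightarrow> complex) set" where
  "hardy2_circle = {u \<in> L2_circle. \<forall>n<0. fourier_coeff u n = 0}"

text \<open>
  \<open>is_P_plus u f\<close> says that the function \<open>f\<close> on the disk is \<open>P\<^sub>+ u\<close>: the orthogonal projection
  \<open>v\<close> of \<open>u\<close> onto the Hardy subspace of \<open>L\<^sup>2\<close> is identified with its analytic extension to the disk.
\<close>

definition is_P_plus :: "(complex \<Rightarrow> complex) \<Rightarrow> (complex \<Rightarrow> complex) \<Rightarrow> bool" where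
  "is_P_plus u f \<longleftrightarrow> (\<exists>v\<in>hardy2_circle.
     (\<forall>g\<in>hardy2_circle. (LINT \<zeta>|circle_measure. (u \<zeta> - v \<zeta>) * cnj (g \<zeta>)) = 0) \<and>
     (\<forall>z\<in>unit_disk. (\<lambda>n. fourier_coeff v (int n) * z ^ n) sums f z))"

text \<open>
  Analytic functions of bounded mean oscillation, in the form \<open>BMOA = P\<^sub>+ L\<^sup>\<infinity>\<close>; this is the dual of
  \<open>hardy 1\<close> under the Cauchy pairing.  Since \<open>L\<^sup>\<infinity> \<subseteq> L\<^sup>2\<close>, the projection \<open>P\<^sub>+\<close> is defined on it.
\<close>

definition BMOA :: "(complex \<Rightarrow> complex) set" where
  "BMOA = {f. \<exists>u\<in>Linf_circle. is_P_plus u f}"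

end

theory Submission
  imports Defs
begin

text \<open>
  Everything takes place in terms of Taylor coefficients. Write \<open>H2\<close> for the Hardy space with inner
  product \<open>hip\<close>. Since \<open>\<bar>a\<bar>\<^sup>2 + \<bar>b\<bar>\<^sup>2 = 1\<close> on the circle, multiplication by \<open>a\<close> and by \<open>b\<close> together form
  an isometry, and this identifies the de Branges-Rovnyak space: it consists of those \<open>f\<close> in \<open>H2\<close>
  that have a \<^emph>\<open>partner\<close> \<open>g\<close> in \<open>H2\<close>, meaning \<open>hip f (b h) = hip g (a h)\<close> for all \<open>h\<close>, with
  inner product \<open>hip f f' + hip g g'\<close>. The partner of the kernel function at \<open>w\<close> is
  \<open>cnj (b w) * a\<close> times the Szego kernel. Because a reproducing kernel determines its Hilbert space
  (\<open>rkhs_subset\<close>), checking this one model suffices (\<open>dBR_space_eq\<close>).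

  Formally the partner of \<open>f\<close> is the projection of \<open>cnj \<phi> * f\<close> to \<open>H2\<close>, where \<open>\<phi> = b / a\<close>. If \<open>\<phi>\<close> is in
  \<open>H2\<close> and \<open>f\<close> is the projection of a bounded function \<open>u\<close>, that projection equals the one of \<open>cnj \<phi> * u\<close>,
  which is square integrable. Quantitatively, Bessel's inequality bounds the Hankel form of \<open>f\<close>
  (\<open>hankel_form_bound\<close>), and a bounded Hankel form yields a partner (\<open>dBR_if_hankel_bounded\<close>).
  Both bounded analytic functions and functions in BMOA have bounded Hankel forms.

  Conversely, the partner of \<open>z ^ N\<close> is the polynomial with the reversed conjugate coefficients of \<open>\<phi>\<close>
  up to degree \<open>N\<close>, so its squared norm is the \<open>N\<close>-th partial sum of \<open>\<Sum> \<bar>\<phi>\<^sub>j\<bar>\<^sup>2\<close>. The monomials have norm 1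
  in the space of absolutely convergent Taylor series, which lies in both function spaces in question. If
  that space is contained in the de Branges-Rovnyak space, uniform boundedness
  (\<open>l1_uniform_boundedness\<close>) bounds the partners of all monomials at once, hence \<open>\<phi>\<close> is in \<open>H2\<close>
  (\<open>quotient_in_H2_if_l1_subset\<close>).

  The remaining ingredient is that \<open>a\<close> is outer. This gives \<open>\<bar>a\<bar> \<le> 1\<close> in the disk from the bound on its
  radial limits, and norm density of the multiples of \<open>a\<close> in \<open>H2\<close>, so that partners are unique and
  their norms can be tested on multiples of \<open>a\<close>. Both rest on \<open>outer_exp_approximate_inverse\<close>.
  Apart from the radial limits of \<open>a\<close> and \<open>b\<close>, no boundary values of functions in the disk occur:
  integrals over the circle of radius \<open>r\<close> are taken first, and then \<open>r\<close> tends to 1.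
\<close>


section \<open>Integration on the circle\<close>

lemma cis_measurable_circle:
  "cis \<in> measurable (uniform_measure lborel {0..2 * pi}) (restrict_space borel (sphere 0 1))"
proof -
  have "cis \<in> borel_measurable borel"
    by (intro borel_measurable_continuous_onI continuous_intros)
  then have "cis \<in> measurable borel (restrict_space borel (sphere 0 1))"
    by (intro measurable_restrict_space2) auto
  then show ?thesis
    by (simp cong: measurable_cong_sets)
qed

interpretation circle: prob_space circle_measure
proof -
  have "prob_space (uniform_measure lborel {0..2 * pi})"
    by (rule prob_space_uniform_measure) (simp_all add: emeasure_lborel_Icc)
  then show "prob_space circle_measure"
    unfolding circle_measure_def by (rule prob_space.prob_space_distr[OF _ cis_measurable_circle])
qed

lemma space_circle [simp]: "space circle_measure = sphere 0 1"
  by (simp add: circle_measure_def space_restrict_space)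

lemma borel_measurable_circle_continuous:
  "continuous_on (sphere 0 1) f \<Longrightarrow> f \<in> borel_measurable circle_measure"
  unfolding circle_measure_def
  by (simp add: borel_measurable_continuous_on_restrict cong: measurable_cong_sets)

lemma integrable_circle_bounded:
  fixes f :: "complex \<Rightarrow> 'b::{banach, second_countable_topology}"
  assumes "f \<in> borel_measurable circle_measure" "AE \<zeta> in circle_measure. norm (f \<zeta>) \<le> B"
  shows "integrable circle_measure f"
  by (rule circle.integrable_const_bound[OF assms(2,1)])

lemma integrable_circle_continuous:
  fixes f :: "complex \<Rightarrow> 'b::{banach, second_countable_topology}"
  assumes "continuous_on (sphere 0 1) f"
  shows "integrable circle_measure f"
proof -
  have "compact (f ` sphere 0 1)" using assms by (intro compact_continuous_image) auto
  then obtain B where "\<forall>x\<in>f ` sphere 0 1. norm x \<le> B"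
    using compact_imp_bounded bounded_iff by metis
  then show ?thesis
    by (intro integrable_circle_bounded[where B=B] borel_measurable_circle_continuous assms AE_I2) auto
qed

lemma integrable_circle_continuous_mult:
  fixes k h :: "complex \<Rightarrow> complex"
  assumes "continuous_on (sphere 0 1) k" "integrable circle_measure h"
  shows "integrable circle_measure (\<lambda>\<zeta>. k \<zeta> * h \<zeta>)"
proof -
  have "compact (k ` sphere 0 1)" using assms(1) by (intro compact_continuous_image) auto
  then obtain B where B: "\<And>\<zeta>. \<zeta> \<in> sphere 0 1 \<Longrightarrow> norm (k \<zeta>) \<le> B"
    using compact_imp_bounded[of "k ` sphere 0 1"] unfolding bounded_iff by blast
  show ?thesis
  proof (rule Bochner_Integration.integrable_bound[where f = "\<lambda>\<zeta>. B * norm (h \<zeta>)"])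
    show "(\<lambda>\<zeta>. k \<zeta> * h \<zeta>) \<in> borel_measurable circle_measure"
      using assms(2) borel_measurable_circle_continuous[OF assms(1)] by measurable
    show "AE \<zeta> in circle_measure. norm (k \<zeta> * h \<zeta>) \<le> norm (B * norm (h \<zeta>))"
    proof (rule AE_I2)
      fix \<zeta> :: complex assume "\<zeta> \<in> space circle_measure"
      then have "norm (k \<zeta> * h \<zeta>) \<le> B * norm (h \<zeta>)"
        unfolding norm_mult using B by (intro mult_right_mono) auto
      then show "norm (k \<zeta> * h \<zeta>) \<le> norm (B * norm (h \<zeta>))" by simp
    qed
  qed (use assms(2) in auto)
qed

lemma integral_circle_cis:
  fixes f :: "complex \<Rightarrow> complex"
  assumes "f \<in> borel_measurable circle_measure"
  shows "integral\<^sup>L circle_measure f =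
     (1 / (2 * pi)) *\<^sub>R (LINT t|lborel. indicator {0..2 * pi} t *\<^sub>R f (cis t))"
proof -
  let ?g = "\<lambda>t::real. indicator {0..2 * pi} t / (2 * pi) :: real"
  have dens: "uniform_measure lborel {0..2 * pi} = density lborel ?g"
    unfolding uniform_measure_def
  proof (rule density_cong)
    show "AE x in lborel. indicator {0..2 * pi} x / emeasure lborel {0..2 * pi} = ennreal (?g x)"
      by (auto simp: divide_ennreal ennreal_indicator indicator_def simp flip: ennreal_1 split: if_splits)
  qed auto
  have m: "f \<in> borel_measurable (restrict_space borel (sphere 0 1))"
    using assms by (simp add: circle_measure_def cong: measurable_cong_sets)
  have m': "(\<lambda>t. f (cis t)) \<in> borel_measurable lborel"
    using measurable_compose[OF cis_measurable_circle m] by (simp cong: measurable_cong_sets)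
  have "integral\<^sup>L circle_measure f = integral\<^sup>L (density lborel ?g) (\<lambda>t. f (cis t))"
    unfolding circle_measure_def using integral_distr[OF cis_measurable_circle m] by (simp add: dens)
  also have "\<dots> = (LINT t|lborel. ?g t *\<^sub>R f (cis t))"
    by (rule integral_density) (use m' in auto)
  also have "\<dots> = (LINT t|lborel. (1 / (2 * pi)) *\<^sub>R (indicator {0..2 * pi} t *\<^sub>R f (cis t)))"
    by (intro Bochner_Integration.integral_cong) auto
  also have "\<dots> = (1 / (2 * pi)) *\<^sub>R (LINT t|lborel. indicator {0..2 * pi} t *\<^sub>R f (cis t))"
    by (rule integral_scaleR_right)
  finally show ?thesis .
qed

lemma integral_circle_powi:
  "(LINT \<zeta>|circle_measure. \<zeta> powi k) = (if k = 0 then 1 else 0)"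
proof (cases "k = 0")
  case True
  then show ?thesis using circle.prob_space by simp
next
  case False
  let ?F = "\<lambda>t. cis (real_of_int k * t) / (\<i> * of_int k)"
  have der: "(?F has_vector_derivative cis (real_of_int k * t)) (at t within S)" for t S
  proof -
    have "((\<lambda>z. exp (\<i> * of_int k * z) / (\<i> * of_int k)) has_field_derivative exp (\<i> * of_int k * of_real t)) (at (of_real t))"
      using False by (auto intro!: derivative_eq_intros)
    from has_vector_derivative_real_field[OF this, of S] show ?thesis
      by (simp add: cis_conv_exp mult.assoc)
  qed
  have "(LINT \<zeta>|circle_measure. \<zeta> powi k) =
     (1 / (2 * pi)) *\<^sub>R (LINT t|lborel. indicator {0..2 * pi} t *\<^sub>R cis t powi k)"
    by (intro integral_circle_cis borel_measurable_circle_continuous continuous_intros) auto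
  also have "(\<lambda>t. cis t powi k) = (\<lambda>t. cis (real_of_int k * t))"
    by (simp add: cis_power_int)
  also have "(LINT t|lborel. indicator {0..2 * pi} t *\<^sub>R cis (real_of_int k * t)) = ?F (2 * pi) - ?F 0"
    by (rule integral_FTC_Icc) (auto intro!: der continuous_intros)
  also have "cis (real_of_int k * (2 * pi)) = 1"
    by (metis cis_multiple_2pi Ints_of_int mult.commute)
  finally show ?thesis using False by simp
qed

lemma cnj_power_on_circle: "\<zeta> \<in> sphere 0 1 \<Longrightarrow> cnj \<zeta> ^ n = \<zeta> powi (- int n)"
proof -
  assume "\<zeta> \<in> sphere 0 1"
  then have "\<zeta> * cnj \<zeta> = 1" using complex_norm_square[of \<zeta>] by simp
  then have "inverse \<zeta> = cnj \<zeta>" by (rule inverse_unique)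
  then show ?thesis by (simp add: power_int_minus flip: power_inverse)
qed

lemma integral_circle_power_cnj_power:
  "(LINT \<zeta>|circle_measure. \<zeta> ^ n * cnj \<zeta> ^ m) = (if n = m then 1 else 0)"
proof -
  have "(LINT \<zeta>|circle_measure. \<zeta> ^ n * cnj \<zeta> ^ m) = (LINT \<zeta>|circle_measure. \<zeta> powi (int n - int m))"
  proof (rule Bochner_Integration.integral_cong[OF refl])
    fix \<zeta> :: complex assume "\<zeta> \<in> space circle_measure"
    then have \<zeta>: "\<zeta> \<in> sphere 0 1" "\<zeta> \<noteq> 0" by auto
    show "\<zeta> ^ n * cnj \<zeta> ^ m = \<zeta> powi (int n - int m)"
      unfolding cnj_power_on_circle[OF \<zeta>(1)] using power_int_add[of \<zeta> "int n" "- int m"] \<zeta>(2) by simp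
  qed
  then show ?thesis by (simp add: integral_circle_powi)
qed

lemma integral_circle_series:
  fixes h :: "complex \<Rightarrow> complex"
  assumes "integrable circle_measure h"
    and "\<And>n. continuous_on (sphere 0 1) (y n)"
    and "\<And>n \<zeta>. \<zeta> \<in> sphere 0 1 \<Longrightarrow> norm (y n \<zeta>) \<le> t n"
    and "summable t"
  shows "(\<lambda>n. LINT \<zeta>|circle_measure. h \<zeta> * y n \<zeta>) sums (LINT \<zeta>|circle_measure. h \<zeta> * (\<Sum>n. y n \<zeta>))"
proof -
  have bd: "norm (h \<zeta> * y n \<zeta>) \<le> t n * norm (h \<zeta>)" if "\<zeta> \<in> sphere 0 1" for \<zeta> n
    using mult_right_mono[OF assms(3)[OF that, of n] norm_ge_zero[of "h \<zeta>"]] by (simp add: norm_mult mult.commute)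
  have int: "integrable circle_measure (\<lambda>\<zeta>. h \<zeta> * y n \<zeta>)" for n
    using integrable_circle_continuous_mult[OF assms(2,1)] by (simp add: mult.commute)
  have sy: "summable (\<lambda>n. norm (y n \<zeta>))" if "\<zeta> \<in> sphere 0 1" for \<zeta>
    using assms(3,4) that by (intro summable_comparison_test'[OF assms(4), of 0]) auto
  have "(\<lambda>n. LINT \<zeta>|circle_measure. h \<zeta> * y n \<zeta>) sums (LINT \<zeta>|circle_measure. (\<Sum>n. h \<zeta> * y n \<zeta>))"
  proof (rule sums_integral[OF int])
    show "AE \<zeta> in circle_measure. summable (\<lambda>n. norm (h \<zeta> * y n \<zeta>))"
      using sy by (intro AE_I2) (auto simp: norm_mult intro: summable_mult)
    show "summable (\<lambda>n. LINT \<zeta>|circle_measure. norm (h \<zeta> * y n \<zeta>))"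
    proof (rule summable_comparison_test'[of "\<lambda>n. t n * (LINT \<zeta>|circle_measure. norm (h \<zeta>))" 0])
      fix n
      have "(LINT \<zeta>|circle_measure. norm (h \<zeta> * y n \<zeta>)) \<le> (LINT \<zeta>|circle_measure. t n * norm (h \<zeta>))"
        using bd int assms(1) by (intro integral_mono) auto
      then show "norm (LINT \<zeta>|circle_measure. norm (h \<zeta> * y n \<zeta>)) \<le> t n * (LINT \<zeta>|circle_measure. norm (h \<zeta>))"
        by simp
    qed (use assms(4) in \<open>auto intro: summable_mult2\<close>)
  qed
  also have "(LINT \<zeta>|circle_measure. (\<Sum>n. h \<zeta> * y n \<zeta>)) = (LINT \<zeta>|circle_measure. h \<zeta> * (\<Sum>n. y n \<zeta>))"
    using sy by (intro Bochner_Integration.integral_cong) (simp_all add: suminf_mult summable_norm_cancel)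
  finally show ?thesis .
qed

section \<open>Taylor coefficients\<close>

definition taylor_coeff :: "(complex \<Rightarrow> complex) \<Rightarrow> nat \<Rightarrow> complex" where
  "taylor_coeff f n = (deriv ^^ n) f 0 / fact n"

lemma taylor_sums:
  assumes "f holomorphic_on unit_disk" "z \<in> unit_disk"
  shows "(\<lambda>n. taylor_coeff f n * z ^ n) sums f z"
  using holomorphic_power_series[OF assms] by (simp add: taylor_coeff_def)

lemma power_series_on_disk:
  assumes "\<And>z. z \<in> unit_disk \<Longrightarrow> (\<lambda>n. x n * z ^ n) sums f z"
  shows holomorphic_power_series_on_disk: "f holomorphic_on unit_disk"
    and taylor_coeff_eqI: "taylor_coeff f n = x n"
proof -
  show holo: "f holomorphic_on unit_disk"
    by (rule power_series_holomorphic[of 0 1 x]) (use assms in auto)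
  have "f has_fps_expansion fps_expansion f 0"
    using holo by (intro has_fps_expansion_fps_expansion[of unit_disk]) auto
  moreover have "f has_fps_expansion Abs_fps x"
  proof -
    have "summable (\<lambda>n. x n * of_real (1/2) ^ n)"
      using assms[of "1/2"] by (auto simp: sums_iff)
    from conv_radius_geI[OF this] have "ereal (1/2) \<le> fps_conv_radius (Abs_fps x)"
      unfolding fps_conv_radius_def by simp
    then have "0 < fps_conv_radius (Abs_fps x)"
      by (rule less_le_trans[rotated]) simp
    moreover have "eventually (\<lambda>z. eval_fps (Abs_fps x) z = f z) (nhds 0)"
      by (rule eventually_mono[OF eventually_nhds_in_open[of unit_disk 0]])
         (use assms in \<open>auto simp: eval_fps_def sums_iff\<close>)
    ultimately show ?thesis by (simp add: has_fps_expansion_def)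
  qed
  ultimately have "fps_expansion f 0 = Abs_fps x" by (rule fps_expansion_unique_complex)
  then have "fps_nth (fps_expansion f 0) n = x n" by simp
  then show "taylor_coeff f n = x n" by (simp add: fps_expansion_def taylor_coeff_def)
qed

lemma taylor_coeff_cong:
  assumes "f holomorphic_on unit_disk" "\<And>z. z \<in> unit_disk \<Longrightarrow> f z = g z"
  shows "taylor_coeff f = taylor_coeff g"
proof
  fix n show "taylor_coeff f n = taylor_coeff g n"
    by (rule taylor_coeff_eqI[symmetric]) (use taylor_sums[OF assms(1)] assms(2) in auto)
qed

lemma taylor_coeff_add:
  assumes "f holomorphic_on unit_disk" "g holomorphic_on unit_disk"
  shows "taylor_coeff (\<lambda>z. f z + g z) n = taylor_coeff f n + taylor_coeff g n"
  by (rule taylor_coeff_eqI) (use assms in \<open>auto simp: ring_distribs intro!: sums_add taylor_sums\<close>)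

lemma taylor_coeff_diff:
  assumes "f holomorphic_on unit_disk" "g holomorphic_on unit_disk"
  shows "taylor_coeff (\<lambda>z. f z - g z) n = taylor_coeff f n - taylor_coeff g n"
  by (rule taylor_coeff_eqI) (use assms in \<open>auto simp: ring_distribs intro!: sums_diff taylor_sums\<close>)

lemma taylor_coeff_cmult:
  assumes "f holomorphic_on unit_disk"
  shows "taylor_coeff (\<lambda>z. c * f z) n = c * taylor_coeff f n"
  by (rule taylor_coeff_eqI) (use assms in \<open>auto simp: mult.assoc intro!: sums_mult taylor_sums\<close>)

lemma taylor_coeff_polynomial:
  "taylor_coeff (\<lambda>z. \<Sum>k\<in>A. x k * z ^ k) n = (if n \<in> A then x n else 0)" if "finite A"
  by (rule taylor_coeff_eqI)
     (use sums_If_finite_set[OF that, of "\<lambda>k. x k * _ ^ k"] in \<open>simp add: if_distrib[of "\<lambda>u. u * _"] cong: if_cong\<close>)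

lemma taylor_coeff_power: "taylor_coeff (\<lambda>z. z ^ k) n = (if n = k then 1 else 0)"
  using taylor_coeff_polynomial[of "{k}" "\<lambda>_. 1" n] by simp

lemma taylor_summable:
  assumes "f holomorphic_on unit_disk" "0 \<le> r" "r < 1"
  shows "summable (\<lambda>n. norm (taylor_coeff f n) * r ^ n)"
proof -
  obtain s where s: "r < s" "s < 1" using dense assms(3) by blast
  have "summable (\<lambda>n. taylor_coeff f n * of_real s ^ n)"
    using taylor_sums[OF assms(1), of "of_real s"] s assms(2) by (auto simp: sums_iff)
  from powser_insidea[OF this, of "of_real r"] show ?thesis
    using s assms(2) by (simp add: norm_mult norm_power)
qed

lemma taylor_coeff_mult:
  assumes "f holomorphic_on unit_disk" "g holomorphic_on unit_disk"
  shows "taylor_coeff (\<lambda>z. f z * g z) n = (\<Sum>k\<le>n. taylor_coeff f k * taylor_coeff g (n - k))"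
proof (rule taylor_coeff_eqI)
  fix z :: complex assume z: "z \<in> unit_disk"
  have s: "summable (\<lambda>n. norm (taylor_coeff h n * z ^ n))" if "h holomorphic_on unit_disk" for h
    using taylor_summable[OF that, of "norm z"] z by (simp add: norm_mult norm_power)
  have "(\<lambda>k. \<Sum>i\<le>k. (taylor_coeff f i * z ^ i) * (taylor_coeff g (k - i) * z ^ (k - i))) sums (f z * g z)"
    using Cauchy_product_sums[OF s[OF assms(1)] s[OF assms(2)]]
      taylor_sums[OF assms(1) z] taylor_sums[OF assms(2) z] by (simp add: sums_iff)
  moreover have "(\<Sum>i\<le>k. (taylor_coeff f i * z ^ i) * (taylor_coeff g (k - i) * z ^ (k - i)))
      = (\<Sum>i\<le>k. taylor_coeff f i * taylor_coeff g (k - i)) * z ^ k" for k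
    unfolding sum_distrib_right
    by (intro sum.cong refl) (simp add: mult_ac flip: power_add)
  ultimately show "(\<lambda>n. (\<Sum>k\<le>n. taylor_coeff f k * taylor_coeff g (n - k)) * z ^ n) sums (f z * g z)"
    by simp
qed

lemma continuous_on_circle_dilate:
  assumes "f holomorphic_on unit_disk" "0 \<le> r" "r < 1"
  shows "continuous_on (sphere 0 1) (\<lambda>\<zeta>. f (of_real r * \<zeta>))"
proof (rule continuous_on_compose2[OF holomorphic_on_imp_continuous_on[OF assms(1)]])
  show "(\<lambda>\<zeta>. of_real r * \<zeta>) ` sphere 0 1 \<subseteq> unit_disk"
    using assms by (auto simp: norm_mult)
qed (intro continuous_intros)

lemma taylor_coeff_integral:
  assumes "f holomorphic_on unit_disk" "0 \<le> r" "r < 1"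
  shows "(LINT \<zeta>|circle_measure. f (of_real r * \<zeta>) * cnj \<zeta> ^ m) = taylor_coeff f m * of_real r ^ m"
proof -
  have "(\<lambda>n. LINT \<zeta>|circle_measure. cnj \<zeta> ^ m * (taylor_coeff f n * (of_real r * \<zeta>) ^ n)) sums
      (LINT \<zeta>|circle_measure. cnj \<zeta> ^ m * (\<Sum>n. taylor_coeff f n * (of_real r * \<zeta>) ^ n))"
    using assms
    by (intro integral_circle_series[OF _ _ _ taylor_summable[OF assms]] integrable_circle_continuous continuous_intros)
       (auto simp: norm_mult norm_power)
  also have "(\<lambda>n. LINT \<zeta>|circle_measure. cnj \<zeta> ^ m * (taylor_coeff f n * (of_real r * \<zeta>) ^ n))
      = (\<lambda>n. taylor_coeff f n * of_real r ^ n * (LINT \<zeta>|circle_measure. \<zeta> ^ n * cnj \<zeta> ^ m))"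
    by (subst integral_mult_right_zero[symmetric]) (simp add: power_mult_distrib mult_ac)
  also have "\<dots> = (\<lambda>n. if n = m then taylor_coeff f n * of_real r ^ n else 0)"
    by (auto simp: integral_circle_power_cnj_power)
  also have "(LINT \<zeta>|circle_measure. cnj \<zeta> ^ m * (\<Sum>n. taylor_coeff f n * (of_real r * \<zeta>) ^ n))
     = (LINT \<zeta>|circle_measure. f (of_real r * \<zeta>) * cnj \<zeta> ^ m)"
  proof (rule Bochner_Integration.integral_cong[OF refl])
    fix \<zeta> :: complex assume "\<zeta> \<in> space circle_measure"
    then have "of_real r * \<zeta> \<in> unit_disk" using assms by (simp add: norm_mult)
    from taylor_sums[OF assms(1) this]
    show "cnj \<zeta> ^ m * (\<Sum>n. taylor_coeff f n * (of_real r * \<zeta>) ^ n) = f (of_real r * \<zeta>) * cnj \<zeta> ^ m"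
      by (simp add: sums_iff)
  qed
  finally show ?thesis
    using sums_unique2[OF _ sums_single[of m "\<lambda>n. taylor_coeff f n * of_real r ^ n"]] by fastforce
qed

lemma parseval_circle:
  assumes "f holomorphic_on unit_disk" "g holomorphic_on unit_disk" "0 \<le> r" "r < 1"
  shows "(\<lambda>n. taylor_coeff f n * cnj (taylor_coeff g n) * of_real (r ^ (2 * n))) sums
     (LINT \<zeta>|circle_measure. f (of_real r * \<zeta>) * cnj (g (of_real r * \<zeta>)))"
proof -
  have "(\<lambda>n. LINT \<zeta>|circle_measure. f (of_real r * \<zeta>) * cnj (taylor_coeff g n * (of_real r * \<zeta>) ^ n)) sums
     (LINT \<zeta>|circle_measure. f (of_real r * \<zeta>) * (\<Sum>n. cnj (taylor_coeff g n * (of_real r * \<zeta>) ^ n)))"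
    using assms
    by (intro integral_circle_series[OF _ _ _ taylor_summable[OF assms(2-4)]] integrable_circle_continuous
         continuous_intros continuous_on_circle_dilate)
       (auto simp: norm_mult norm_power)
  also have "(\<lambda>n. LINT \<zeta>|circle_measure. f (of_real r * \<zeta>) * cnj (taylor_coeff g n * (of_real r * \<zeta>) ^ n))
     = (\<lambda>n. cnj (taylor_coeff g n) * of_real r ^ n * (LINT \<zeta>|circle_measure. f (of_real r * \<zeta>) * cnj \<zeta> ^ n))"
    by (subst integral_mult_right_zero[symmetric]) (simp add: power_mult_distrib mult_ac)
  also have "\<dots> = (\<lambda>n. taylor_coeff f n * cnj (taylor_coeff g n) * of_real (r ^ (2 * n)))"
    unfolding taylor_coeff_integral[OF assms(1,3,4)] by (simp add: mult_2 mult_2_right power_add mult_ac)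
  also have "(LINT \<zeta>|circle_measure. f (of_real r * \<zeta>) * (\<Sum>n. cnj (taylor_coeff g n * (of_real r * \<zeta>) ^ n)))
     = (LINT \<zeta>|circle_measure. f (of_real r * \<zeta>) * cnj (g (of_real r * \<zeta>)))"
  proof (rule Bochner_Integration.integral_cong[OF refl])
    fix \<zeta> :: complex assume "\<zeta> \<in> space circle_measure"
    then have "of_real r * \<zeta> \<in> unit_disk" using assms by (simp add: norm_mult)
    from taylor_sums[OF assms(2) this]
    have "(\<lambda>n. cnj (taylor_coeff g n * (of_real r * \<zeta>) ^ n)) sums cnj (g (of_real r * \<zeta>))"
      by (simp only: sums_cnj)
    then show "f (of_real r * \<zeta>) * (\<Sum>n. cnj (taylor_coeff g n * (of_real r * \<zeta>) ^ n))
        = f (of_real r * \<zeta>) * cnj (g (of_real r * \<zeta>))"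
      by (simp only: sums_iff)
  qed
  finally show ?thesis .
qed


section \<open>Reproducing kernel Hilbert spaces\<close>

context rkhs
begin

lemma ip_zero_left: "f \<in> V \<Longrightarrow> ip (\<lambda>_. 0) f = 0"
  using ip_scale[of f f 0] by simp

lemma diff_mem: "f \<in> V \<Longrightarrow> g \<in> V \<Longrightarrow> (\<lambda>x. f x - g x) \<in> V"
  using add_mem[OF _ scale_mem[of g "-1"]] by simp

lemma ip_diff: "f \<in> V \<Longrightarrow> g \<in> V \<Longrightarrow> h \<in> V \<Longrightarrow> ip (\<lambda>x. f x - g x) h = ip f h - ip g h"
  using ip_add[OF _ scale_mem[of g "-1"], of f h] ip_scale[of g h "-1"] by simp

lemma ip_add_right: "f \<in> V \<Longrightarrow> g \<in> V \<Longrightarrow> h \<in> V \<Longrightarrow> ip h (\<lambda>x. f x + g x) = ip h f + ip h g"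
  using ip_cnj[of "\<lambda>x. f x + g x" h] ip_cnj[of f h] ip_cnj[of g h] by (simp add: add_mem ip_add)

lemma ip_diff_right: "f \<in> V \<Longrightarrow> g \<in> V \<Longrightarrow> h \<in> V \<Longrightarrow> ip h (\<lambda>x. f x - g x) = ip h f - ip h g"
  using ip_cnj[of "\<lambda>x. f x - g x" h] ip_cnj[of f h] ip_cnj[of g h] by (simp add: diff_mem ip_diff)

lemma ip_scale_right: "f \<in> V \<Longrightarrow> h \<in> V \<Longrightarrow> ip h (\<lambda>x. c * f x) = cnj c * ip h f"
  using ip_cnj[of "\<lambda>x. c * f x" h] ip_cnj[of f h] by (simp add: scale_mem ip_scale)

abbreviation nsq :: "('x \<Rightarrow> complex) \<Rightarrow> real" where
  "nsq f \<equiv> Re (ip f f)"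

lemma ip_self: "f \<in> V \<Longrightarrow> ip f f = of_real (nsq f)"
  using ip_cnj[of f f] by (simp add: complex_eq_iff)

lemma nsq_scale:
  assumes "f \<in> V"
  shows "nsq (\<lambda>x. c * f x) = (cmod c)\<^sup>2 * nsq f"
proof -
  have "ip (\<lambda>x. c * f x) (\<lambda>x. c * f x) = (c * cnj c) * ip f f"
    using assms by (simp add: ip_scale ip_scale_right scale_mem)
  also have "\<dots> = of_real ((cmod c)\<^sup>2 * nsq f)"
    unfolding of_real_mult complex_norm_square by (subst ip_self[OF assms]) (rule refl)
  finally show ?thesis by simp
qed

lemma parallelogram:
  assumes "f \<in> V" "g \<in> V"
  shows "nsq (\<lambda>x. f x - g x) = 2 * nsq f + 2 * nsq g - nsq (\<lambda>x. f x + g x)"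
  using assms by (simp add: ip_add ip_add_right ip_diff ip_diff_right add_mem diff_mem)

text \<open>
  The one-variable quadratic polynomial behind both the Cauchy-Schwarz inequality and the
  near-orthogonality of the remainder of a nearly best approximation.
\<close>

lemma nsq_diff_along:
  assumes "f \<in> V" "g \<in> V"
  shows "nsq (\<lambda>x. f x - (of_real t * ip f g) * g x)
    = nsq f - 2 * t * (cmod (ip f g))\<^sup>2 + t\<^sup>2 * (cmod (ip f g))\<^sup>2 * nsq g"
proof -
  let ?c = "ip f g" and ?d = "of_real t * ip f g"
  have "ip (\<lambda>x. f x - d * g x) (\<lambda>x. f x - d * g x) = ip f f - cnj d * ?c - d * cnj ?c + d * cnj d * ip g g" for d
    using assms
    by (simp add: ip_diff ip_diff_right ip_scale ip_scale_right diff_mem scale_mem ip_cnj[of f g] algebra_simps)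
  then have "ip (\<lambda>x. f x - ?d * g x) (\<lambda>x. f x - ?d * g x) = ip f f - cnj ?d * ?c - ?d * cnj ?c + ?d * cnj ?d * ip g g" .
  also have "cnj ?d * ?c = of_real (t * (cmod ?c)\<^sup>2)"
    using complex_norm_square[of ?c] by (simp add: mult_ac)
  also have "?d * cnj ?c = of_real (t * (cmod ?c)\<^sup>2)"
    using complex_norm_square[of ?c] by (simp add: mult_ac)
  also have "?d * cnj ?d * ip g g = of_real (t\<^sup>2 * (cmod ?c)\<^sup>2 * nsq g)"
    using complex_norm_square[of ?c] by (subst ip_self[OF assms(2)]) (simp add: power2_eq_square mult_ac)
  finally show ?thesis by simp
qed

lemma Cauchy_Schwarz:
  assumes "f \<in> V" "g \<in> V"
  shows "(cmod (ip f g))\<^sup>2 \<le> nsq f * nsq g"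
proof (cases "nsq g = 0")
  case True
  have "2 * t * (cmod (ip f g))\<^sup>2 \<le> nsq f" for t
    using nsq_diff_along[OF assms, of t] ip_nonneg[OF diff_mem[OF assms(1) scale_mem[OF assms(2)]], of "of_real t * ip f g"] True
    by simp
  note large = this[of "(nsq f + 1) / (2 * (cmod (ip f g))\<^sup>2)"]
  have "ip f g = 0"
  proof (rule ccontr)
    assume "ip f g \<noteq> 0"
    then have "2 * ((nsq f + 1) / (2 * (cmod (ip f g))\<^sup>2)) * (cmod (ip f g))\<^sup>2 = nsq f + 1" by simp
    with large show False by linarith
  qed
  then show ?thesis using True by simp
next
  case False
  then have pos: "nsq g > 0" using ip_nonneg[OF assms(2)] by simp
  have "0 \<le> nsq f - 2 * (1 / nsq g) * (cmod (ip f g))\<^sup>2 + (1 / nsq g)\<^sup>2 * (cmod (ip f g))\<^sup>2 * nsq g"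
    using nsq_diff_along[OF assms, of "1 / nsq g"]
      ip_nonneg[OF diff_mem[OF assms(1) scale_mem[OF assms(2)]], of "of_real (1 / nsq g) * ip f g"] by simp
  also have "\<dots> = nsq f - (cmod (ip f g))\<^sup>2 / nsq g"
    using pos by (simp add: field_simps power2_eq_square)
  finally show ?thesis using pos by (simp add: field_simps)
qed

lemma nsq_kernel: "x \<in> X \<Longrightarrow> nsq (K x) = Re (K x x)"
  using reproducing kernel_mem by simp

lemma evaluation_bound: "f \<in> V \<Longrightarrow> x \<in> X \<Longrightarrow> (cmod (f x))\<^sup>2 \<le> nsq f * Re (K x x)"
  using Cauchy_Schwarz[OF _ kernel_mem, of f x] by (simp add: reproducing nsq_kernel)

lemma ip_tendsto:
  assumes "\<And>n. F n \<in> V" "f \<in> V" "g \<in> V" "((\<lambda>n. nsq (\<lambda>x. F n x - f x)) \<longlongrightarrow> 0) net"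
  shows "((\<lambda>n. ip (F n) g) \<longlongrightarrow> ip f g) net"
proof (rule Lim_null[THEN iffD2], rule Lim_null_comparison)
  show "\<forall>\<^sub>F n in net. norm (ip (F n) g - ip f g) \<le> sqrt (nsq (\<lambda>x. F n x - f x) * nsq g)"
    using Cauchy_Schwarz[OF diff_mem[OF assms(1,2)] assms(3)] assms
    by (intro always_eventually allI real_le_rsqrt) (simp add: ip_diff)
  show "((\<lambda>n. sqrt (nsq (\<lambda>x. F n x - f x) * nsq g)) \<longlongrightarrow> 0) net"
    using tendsto_real_sqrt[OF tendsto_mult_left_zero[OF assms(4), of "nsq g"]] by simp
qed

lemma ip_tendsto_right:
  assumes "\<And>n. F n \<in> V" "f \<in> V" "g \<in> V" "((\<lambda>n. nsq (\<lambda>x. F n x - f x)) \<longlongrightarrow> 0) net"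
  shows "((\<lambda>n. ip g (F n)) \<longlongrightarrow> ip g f) net"
proof -
  have "ip g f = cnj (ip f g)" "\<And>n. ip g (F n) = cnj (ip (F n) g)"
    using assms by (auto intro: ip_cnj)
  with tendsto_cnj[OF ip_tendsto[OF assms]] show ?thesis by simp
qed

lemma evaluation_tendsto:
  assumes "\<And>n. F n \<in> V" "f \<in> V" "((\<lambda>n. nsq (\<lambda>x. F n x - f x)) \<longlongrightarrow> 0) net" "x \<in> X"
  shows "((\<lambda>n. F n x) \<longlongrightarrow> f x) net"
  using ip_tendsto[OF assms(1,2) kernel_mem[OF assms(4)] assms(3)] assms by (simp add: reproducing)

end

inductive_set kernel_span :: "'x set \<Rightarrow> ('x \<Rightarrow> 'x \<Rightarrow> complex) \<Rightarrow> ('x \<Rightarrow> complex) set"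
  for X K where
  zero: "(\<lambda>_. 0) \<in> kernel_span X K"
| kernel: "x \<in> X \<Longrightarrow> K x \<in> kernel_span X K"
| add: "f \<in> kernel_span X K \<Longrightarrow> g \<in> kernel_span X K \<Longrightarrow> (\<lambda>x. f x + g x) \<in> kernel_span X K"
| scale: "f \<in> kernel_span X K \<Longrightarrow> (\<lambda>x. c * f x) \<in> kernel_span X K"

lemma kernel_span_diff:
  "f \<in> kernel_span X K \<Longrightarrow> g \<in> kernel_span X K \<Longrightarrow> (\<lambda>x. f x - g x) \<in> kernel_span X K"
  using kernel_span.add[OF _ kernel_span.scale[of g X K "-1"]] by simp

lemma (in rkhs) kernel_span_subset: "kernel_span X K \<subseteq> V"
proof
  fix f assume "f \<in> kernel_span X K"
  then show "f \<in> V" by induct (auto intro: zero_mem kernel_mem add_mem scale_mem)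
qed

lemma ip_unique_on_kernel_span:
  assumes "rkhs X V ip K" "rkhs X V' ip' K" "f \<in> kernel_span X K" "g \<in> kernel_span X K"
  shows "ip f g = ip' f g"
proof -
  interpret A: rkhs X V ip K by fact
  interpret B: rkhs X V' ip' K by fact
  note mem = subsetD[OF A.kernel_span_subset] subsetD[OF B.kernel_span_subset]
  from assms(3,4) show ?thesis
  proof induct
    case (kernel x)
    then show ?case
      using A.ip_cnj[of g "K x"] B.ip_cnj[of g "K x"] mem[OF kernel(2)] A.kernel_mem B.kernel_mem
      by (simp add: A.reproducing B.reproducing)
  qed (simp_all add: mem A.ip_zero_left B.ip_zero_left A.ip_add B.ip_add A.ip_scale B.ip_scale)
qed

text \<open>
  A minimizing sequence for the distance from \<open>f\<close> to the kernel span is Cauchy by the parallelogram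
  law, and its remainders become orthogonal to every kernel function.  By the reproducing property
  this means convergence to \<open>f\<close> at every point.
\<close>

lemma (in rkhs) kernel_span_approximation:
  assumes f: "f \<in> V"
  shows "\<exists>s. (\<forall>n::nat. s n \<in> kernel_span X K) \<and>
    (\<forall>e>0. \<exists>N. \<forall>m\<ge>N. \<forall>n\<ge>N. nsq (\<lambda>x. s m x - s n x) < e) \<and>
    (\<forall>x\<in>X. (\<lambda>n. s n x) \<longlonglongrightarrow> f x)"
proof -
  let ?S = "kernel_span X K"
  note mem = subsetD[OF kernel_span_subset]
  define d where "d = (INF s\<in>?S. nsq (\<lambda>x. f x - s x))"
  have bdd: "bdd_below ((\<lambda>s. nsq (\<lambda>x. f x - s x)) ` ?S)"
    by (rule bdd_belowI[where m=0]) (auto intro!: ip_nonneg diff_mem[OF f mem])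
  have d_le: "d \<le> nsq (\<lambda>x. f x - s x)" if "s \<in> ?S" for s
    unfolding d_def by (rule cINF_lower[OF bdd that])
  have "\<exists>s\<in>?S. nsq (\<lambda>x. f x - s x) < d + 1 / (real n + 1)" for n
  proof (rule ccontr)
    assume "\<not> ?thesis"
    then have "d + 1 / (real n + 1) \<le> d"
      unfolding d_def by (intro cINF_greatest) (use kernel_span.zero in \<open>auto simp: not_less\<close>)
    then show False by (simp add: field_simps)
  qed
  then obtain s where s: "\<And>n. s n \<in> ?S" and near: "\<And>n. nsq (\<lambda>x. f x - s n x) < d + 1 / (real n + 1)"
    by metis
  have dist: "nsq (\<lambda>x. s m x - s n x) \<le> 2 / (real m + 1) + 2 / (real n + 1)" for m n
  proof -
    have half: "(\<lambda>x. (1/2) * (s n x + s m x)) \<in> ?S"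
      by (intro kernel_span.scale kernel_span.add s)
    have "nsq (\<lambda>x. (f x - s n x) + (f x - s m x)) = nsq (\<lambda>x. 2 * (f x - (1/2) * (s n x + s m x)))"
      by (rule arg_cong[where f = "\<lambda>g. nsq g"]) (auto simp: algebra_simps)
    also have "\<dots> = 4 * nsq (\<lambda>x. f x - (1/2) * (s n x + s m x))"
      using nsq_scale[OF diff_mem[OF f mem[OF half]], of 2] by simp
    finally have "4 * d \<le> nsq (\<lambda>x. (f x - s n x) + (f x - s m x))"
      using d_le[OF half] by simp
    moreover have "nsq (\<lambda>x. s m x - s n x) = nsq (\<lambda>x. (f x - s n x) - (f x - s m x))"
      by simp
    ultimately show ?thesis
      using parallelogram[OF diff_mem[OF f mem[OF s[of n]]] diff_mem[OF f mem[OF s[of m]]]] near[of m] near[of n]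
      by simp
  qed
  have small: "\<exists>N. \<forall>n\<ge>N. C / (real n + 1) < e" if "e > 0" for C e :: real
  proof -
    have "(\<lambda>n. C / (real n + 1)) \<longlonglongrightarrow> 0" by real_asymp
    from order_tendstoD(2)[OF this that] show ?thesis by (simp add: eventually_sequentially)
  qed
  show ?thesis
  proof (intro exI[of _ s] conjI allI ballI impI)
    show "s n \<in> ?S" for n by (rule s)
    show "\<exists>N. \<forall>m\<ge>N. \<forall>n\<ge>N. nsq (\<lambda>x. s m x - s n x) < e" if e: "e > 0" for e
    proof -
      obtain N where N: "\<And>n. n \<ge> N \<Longrightarrow> 2 / (real n + 1) < e / 2" using small[of "e/2" 2] e by auto
      show ?thesis
      proof (intro exI[of _ N] allI impI)
        fix m n assume "N \<le> m" "N \<le> n"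
        then show "nsq (\<lambda>x. s m x - s n x) < e" using dist[of m n] N[of m] N[of n] by linarith
      qed
    qed
    show "(\<lambda>n. s n x) \<longlonglongrightarrow> f x" if x: "x \<in> X" for x
    proof -
      let ?N = "nsq (K x)"
      (* Any t > 0 with t * ?N \<le> 1 serves; adding 1 covers the case that the kernel vanishes. *)
      define t where "t = 1 / (?N + 1)"
      have N0: "?N \<ge> 0" using ip_nonneg[OF kernel_mem[OF x]] .
      have t: "t > 0" "t * ?N \<le> 1" using N0 by (auto simp: t_def field_simps)
      have bound: "(cmod (f x - s n x))\<^sup>2 \<le> (?N + 1) / (real n + 1)" for n
      proof -
        let ?r = "\<lambda>y. f y - s n y"
        have r: "?r \<in> V" by (intro diff_mem f mem s)
        have c: "ip ?r (K x) = f x - s n x" using reproducing[OF r x] .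
        have "(\<lambda>y. s n y + (of_real t * ip ?r (K x)) * K x y) \<in> ?S"
          by (intro kernel_span.intros s x)
        from d_le[OF this]
        have "d \<le> nsq (\<lambda>y. ?r y - (of_real t * ip ?r (K x)) * K x y)"
          by (simp add: algebra_simps)
        also have "\<dots> = nsq ?r - 2 * t * (cmod (f x - s n x))\<^sup>2 + t\<^sup>2 * (cmod (f x - s n x))\<^sup>2 * ?N"
          using nsq_diff_along[OF r kernel_mem[OF x], of t] unfolding c .
        also have "t\<^sup>2 * (cmod (f x - s n x))\<^sup>2 * ?N = (t * ?N) * (t * (cmod (f x - s n x))\<^sup>2)"
          by (simp add: power2_eq_square mult_ac)
        also have "\<dots> \<le> 1 * (t * (cmod (f x - s n x))\<^sup>2)"
          using t by (intro mult_right_mono) auto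
        finally have "t * (cmod (f x - s n x))\<^sup>2 \<le> 1 / (real n + 1)"
          using near[of n] by simp
        then show ?thesis using N0 by (simp add: t_def field_simps)
      qed
      have "(\<lambda>n. f x - s n x) \<longlonglongrightarrow> 0"
      proof (rule Lim_null_comparison)
        show "\<forall>\<^sub>F n in sequentially. norm (f x - s n x) \<le> sqrt ((?N + 1) / (real n + 1))"
          using bound by (intro always_eventually allI real_le_rsqrt) simp
        have "(\<lambda>n. C / (real n + 1)) \<longlonglongrightarrow> 0" for C by real_asymp
        from tendsto_real_sqrt[OF this[of "?N + 1"]]
        show "(\<lambda>n. sqrt ((?N + 1) / (real n + 1))) \<longlonglongrightarrow> 0" by simp
      qed
      from tendsto_diff[OF tendsto_const[of "f x"] this] show ?thesis by simp
    qed
  qed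
qed

text \<open>
  The two inner products agree on the kernel span, so a sequence there that is Cauchy for one is
  Cauchy for the other. Norm limits are pointwise limits, hence both spaces contain the same limits.
\<close>

theorem rkhs_subset:
  assumes "rkhs X V ip K" "rkhs X V' ip' K"
  shows "V \<subseteq> V'"
proof
  interpret A: rkhs X V ip K by fact
  interpret B: rkhs X V' ip' K by fact
  fix f assume f: "f \<in> V"
  obtain s where s: "\<forall>n::nat. s n \<in> kernel_span X K"
    and cauchy: "\<forall>e>0. \<exists>N. \<forall>m\<ge>N. \<forall>n\<ge>N. A.nsq (\<lambda>x. s m x - s n x) < e"
    and lim: "\<forall>x\<in>X. (\<lambda>n. s n x) \<longlonglongrightarrow> f x"
    using A.kernel_span_approximation[OF f] by blast
  note s = s[rule_format] and cauchy = cauchy[rule_format] and lim = lim[rule_format]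
  have sV: "s n \<in> V'" for n using s B.kernel_span_subset by auto
  have eq: "A.nsq (\<lambda>x. s m x - s n x) = B.nsq (\<lambda>x. s m x - s n x)" for m n
    using ip_unique_on_kernel_span[OF assms kernel_span_diff[OF s s] kernel_span_diff[OF s s]] by simp
  obtain g where g: "g \<in> V'" "(\<lambda>n. B.nsq (\<lambda>x. s n x - g x)) \<longlonglongrightarrow> 0"
    using B.complete[OF sV cauchy[unfolded eq]] by blast
  have "f x = g x" if "x \<in> X" for x
    using LIMSEQ_unique[OF lim[OF that] B.evaluation_tendsto[OF sV g that]] .
  then show "f \<in> V'" by (rule B.saturated[OF g(1)])
qed

corollary dBR_space_eqI:
  assumes "rkhs unit_disk V ip (dBR_kernel b)" "\<And>f. f \<in> V \<Longrightarrow> f holomorphic_on unit_disk"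
  shows "dBR_space b = V"
  unfolding dBR_space_def
proof (rule the_equality)
  fix W assume "(\<forall>f\<in>W. f holomorphic_on unit_disk) \<and> (\<exists>ip. rkhs unit_disk W ip (dBR_kernel b))"
  then obtain ip' where "rkhs unit_disk W ip' (dBR_kernel b)" by blast
  then show "W = V" using rkhs_subset assms(1) by blast
qed (use assms in blast)


section \<open>The Hardy space as a space of square-summable Taylor series\<close>

text \<open>
  Membership and inner product depend on the Taylor coefficients at 0 only, and hence only on
  the values in the disk. Functions that agree there need not be identified.
\<close>

definition H2 :: "(complex \<Rightarrow> complex) set" where
  "H2 = {f. f holomorphic_on unit_disk \<and> summable (\<lambda>n. (cmod (taylor_coeff f n))\<^sup>2)}"

definition hip :: "(complex \<Rightarrow> complex) \<Rightarrow> (complex \<Rightarrow> complex) \<Rightarrow> complex" where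
  "hip f g = (\<Sum>n. taylor_coeff f n * cnj (taylor_coeff g n))"

abbreviation hnsq :: "(complex \<Rightarrow> complex) \<Rightarrow> real" where
  "hnsq f \<equiv> Re (hip f f)"

lemma H2_holomorphic: "f \<in> H2 \<Longrightarrow> f holomorphic_on unit_disk"
  by (simp add: H2_def)

lemma hip_abs_summable:
  assumes "f \<in> H2" "g \<in> H2"
  shows "summable (\<lambda>n. norm (taylor_coeff f n * cnj (taylor_coeff g n)))"
proof (rule summable_comparison_test'[of "\<lambda>n. (cmod (taylor_coeff f n))\<^sup>2 + (cmod (taylor_coeff g n))\<^sup>2" 0])
  show "summable (\<lambda>n. (cmod (taylor_coeff f n))\<^sup>2 + (cmod (taylor_coeff g n))\<^sup>2)"
    using assms by (intro summable_add) (simp_all add: H2_def)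
  fix n
  show "norm (norm (taylor_coeff f n * cnj (taylor_coeff g n))) \<le> (cmod (taylor_coeff f n))\<^sup>2 + (cmod (taylor_coeff g n))\<^sup>2"
    using sum_squares_bound[of "cmod (taylor_coeff f n)" "cmod (taylor_coeff g n)"]
      mult_nonneg_nonneg[OF norm_ge_zero norm_ge_zero, of "taylor_coeff f n" "taylor_coeff g n"]
    by (simp add: norm_mult del: mult_nonneg_nonneg zero_le_mult_iff)
qed

lemma hip_sums:
  "f \<in> H2 \<Longrightarrow> g \<in> H2 \<Longrightarrow> (\<lambda>n. taylor_coeff f n * cnj (taylor_coeff g n)) sums hip f g"
  unfolding hip_def by (rule summable_sums, rule summable_norm_cancel, rule hip_abs_summable)

lemma hnsq_sums:
  assumes "f \<in> H2"
  shows "(\<lambda>n. (cmod (taylor_coeff f n))\<^sup>2) sums hnsq f"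
proof -
  have "Re (z * cnj z) = (cmod z)\<^sup>2" for z
    unfolding cmod_power2 by (simp add: power2_eq_square)
  with sums_Re[OF hip_sums[OF assms assms]] show ?thesis by (simp only:)
qed

lemma hip_cong:
  assumes "f holomorphic_on unit_disk" "g holomorphic_on unit_disk"
    "\<And>z. z \<in> unit_disk \<Longrightarrow> f z = f' z" "\<And>z. z \<in> unit_disk \<Longrightarrow> g z = g' z"
  shows "hip f g = hip f' g'"
  using taylor_coeff_cong[OF assms(1,3)] taylor_coeff_cong[OF assms(2,4)] by (simp add: hip_def)

lemma H2_boundI:
  assumes "f holomorphic_on unit_disk" "\<And>N. (\<Sum>n<N. (cmod (taylor_coeff f n))\<^sup>2) \<le> C"
  shows "f \<in> H2" and "hnsq f \<le> C"
proof -
  have "summable (\<lambda>n. (cmod (taylor_coeff f n))\<^sup>2)"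
    by (rule summableI_nonneg_bounded[OF _ assms(2)]) simp
  then show f: "f \<in> H2" using assms(1) by (simp add: H2_def)
  from suminf_le_const[OF sums_summable[OF hnsq_sums[OF f]] assms(2)] sums_unique[OF hnsq_sums[OF f]]
  show "hnsq f \<le> C" by simp
qed

lemma H2_add: assumes "f \<in> H2" "g \<in> H2" shows "(\<lambda>z. f z + g z) \<in> H2"
proof -
  have "summable (\<lambda>n. (cmod (taylor_coeff f n + taylor_coeff g n))\<^sup>2)"
  proof (rule summable_comparison_test'[of "\<lambda>n. 2 * (cmod (taylor_coeff f n))\<^sup>2 + 2 * (cmod (taylor_coeff g n))\<^sup>2" 0])
    show "summable (\<lambda>n. 2 * (cmod (taylor_coeff f n))\<^sup>2 + 2 * (cmod (taylor_coeff g n))\<^sup>2)"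
      using assms by (intro summable_add summable_mult) (simp_all add: H2_def)
    fix n
    have "(cmod (taylor_coeff f n + taylor_coeff g n))\<^sup>2 \<le> (cmod (taylor_coeff f n) + cmod (taylor_coeff g n))\<^sup>2"
      by (intro power_mono norm_triangle_ineq) auto
    also have "\<dots> \<le> 2 * (cmod (taylor_coeff f n))\<^sup>2 + 2 * (cmod (taylor_coeff g n))\<^sup>2"
      using sum_squares_bound[of "cmod (taylor_coeff f n)" "cmod (taylor_coeff g n)"] by (simp add: power2_sum)
    finally show "norm ((cmod (taylor_coeff f n + taylor_coeff g n))\<^sup>2) \<le> 2 * (cmod (taylor_coeff f n))\<^sup>2 + 2 * (cmod (taylor_coeff g n))\<^sup>2"
      by simp
  qed
  then show ?thesis using assms by (auto simp: H2_def taylor_coeff_add intro: holomorphic_on_add)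
qed

lemma H2_scale: assumes "f \<in> H2" shows "(\<lambda>z. c * f z) \<in> H2"
  using assms unfolding H2_def
  by (auto simp: taylor_coeff_cmult norm_mult power_mult_distrib intro: holomorphic_intros summable_mult)

lemma H2_diff: assumes "f \<in> H2" "g \<in> H2" shows "(\<lambda>z. f z - g z) \<in> H2"
  using H2_add[OF assms(1) H2_scale[OF assms(2), of "-1"]] by simp

lemma H2_eqI:
  assumes "f \<in> H2" "\<And>z. z \<in> unit_disk \<Longrightarrow> g z = f z"
  shows "g \<in> H2"
proof -
  have "g holomorphic_on unit_disk"
    by (rule holomorphic_transform[OF H2_holomorphic[OF assms(1)]]) (simp add: assms(2))
  moreover have "taylor_coeff f = taylor_coeff g"
    by (rule taylor_coeff_cong[OF H2_holomorphic[OF assms(1)]]) (simp add: assms(2))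
  ultimately show ?thesis using assms(1) by (simp add: H2_def)
qed

lemma bounded_power_series:
  fixes x :: "nat \<Rightarrow> complex"
  assumes "\<And>n. norm (x n) \<le> B" "z \<in> unit_disk"
  shows "(\<lambda>n. x n * z ^ n) sums (\<Sum>n. x n * z ^ n)"
proof (intro summable_sums summable_norm_cancel[of "\<lambda>n. x n * z ^ n"], rule summable_comparison_test'[of "\<lambda>n. B * norm z ^ n" 0])
  show "summable (\<lambda>n. B * norm z ^ n)" using assms(2) by (intro summable_mult summable_geometric) auto
  show "norm (norm (x n * z ^ n)) \<le> B * norm z ^ n" for n
    using assms(1)[of n] by (simp add: norm_mult norm_power mult_right_mono)
qed

definition szego :: "complex \<Rightarrow> complex \<Rightarrow> complex" where
  "szego w z = 1 / (1 - cnj w * z)"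

lemma szego_sums:
  assumes "w \<in> unit_disk" "z \<in> unit_disk"
  shows "(\<lambda>n. cnj w ^ n * z ^ n) sums szego w z"
proof -
  have "norm (cnj w * z) < 1"
    using assms mult_strict_mono'[of "norm w" 1 "norm z" 1] by (simp add: norm_mult)
  from geometric_sums[OF this] show ?thesis by (simp add: szego_def power_mult_distrib)
qed

lemma taylor_coeff_szego: "w \<in> unit_disk \<Longrightarrow> taylor_coeff (szego w) n = cnj w ^ n"
  by (rule taylor_coeff_eqI) (rule szego_sums)

lemma szego_in_H2: assumes "w \<in> unit_disk" shows "szego w \<in> H2"
proof -
  have "szego w holomorphic_on unit_disk"
    by (rule holomorphic_power_series_on_disk) (rule szego_sums[OF assms])
  moreover have "summable (\<lambda>n. ((norm w)\<^sup>2) ^ n)"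
    using assms by (intro summable_geometric) (auto simp: power_less_one_iff)
  ultimately show ?thesis using assms
    by (simp add: H2_def taylor_coeff_szego norm_power flip: power_mult) (simp add: mult.commute)
qed

lemma H2_complete:
  assumes F: "\<And>n::nat. F n \<in> H2"
    and cauchy: "\<And>e. e > 0 \<Longrightarrow> \<exists>N. \<forall>m\<ge>N. \<forall>n\<ge>N. hnsq (\<lambda>x. F m x - F n x) < e"
  shows "\<exists>f\<in>H2. (\<lambda>n. hnsq (\<lambda>x. F n x - f x)) \<longlonglongrightarrow> 0"
proof -
  let ?x = "\<lambda>m. taylor_coeff (F m)"
  have part: "(\<Sum>k<K. (cmod (?x m k - ?x n k))\<^sup>2) \<le> hnsq (\<lambda>x. F m x - F n x)" for K m n
  proof -
    have "(\<lambda>k. (cmod (?x m k - ?x n k))\<^sup>2) sums hnsq (\<lambda>x. F m x - F n x)"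
      using hnsq_sums[OF H2_diff[OF F[of m] F[of n]]] by (simp add: taylor_coeff_diff H2_holomorphic F)
    from sum_le_suminf[OF sums_summable[OF this], of "{..<K}"] sums_unique[OF this] show ?thesis by simp
  qed
  have "Cauchy (\<lambda>m. ?x m k)" for k
  proof (rule metric_CauchyI)
    fix e :: real assume e: "e > 0"
    obtain N where N: "\<forall>m\<ge>N. \<forall>n\<ge>N. hnsq (\<lambda>x. F m x - F n x) < e\<^sup>2"
      using cauchy[of "e\<^sup>2"] e by auto
    show "\<exists>M. \<forall>m\<ge>M. \<forall>n\<ge>M. dist (?x m k) (?x n k) < e"
    proof (intro exI[of _ N] allI impI)
      fix m n assume mn: "m \<ge> N" "n \<ge> N"
      have "(cmod (?x m k - ?x n k))\<^sup>2 \<le> (\<Sum>j<Suc k. (cmod (?x m j - ?x n j))\<^sup>2)"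
        by (simp add: sum_nonneg)
      also have "\<dots> < e\<^sup>2" using part[where K="Suc k" and m=m and n=n] N mn by (meson le_less_trans)
      finally show "dist (?x m k) (?x n k) < e" using e by (simp add: dist_norm power2_less_imp_less)
    qed
  qed
  then have "\<forall>k. \<exists>l. (\<lambda>m. ?x m k) \<longlonglongrightarrow> l"
    using Cauchy_convergent unfolding convergent_def by blast
  from choice[OF this] obtain x where "\<forall>k. (\<lambda>m. ?x m k) \<longlonglongrightarrow> x k" by (rule exE)
  then have x: "\<And>k. (\<lambda>m. ?x m k) \<longlonglongrightarrow> x k" by (rule spec)
  have lim: "\<exists>N. \<forall>m\<ge>N. \<forall>K. (\<Sum>k<K. (cmod (?x m k - x k))\<^sup>2) \<le> e" if e: "e > 0" for e
  proof -
    obtain N where N: "\<forall>m\<ge>N. \<forall>n\<ge>N. hnsq (\<lambda>x. F m x - F n x) < e"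
      using cauchy[OF e] by auto
    have "(\<Sum>k<K. (cmod (?x m k - x k))\<^sup>2) \<le> e" if "m \<ge> N" for m K
    proof (rule LIMSEQ_le_const2)
      show "(\<lambda>n. \<Sum>k<K. (cmod (?x m k - ?x n k))\<^sup>2) \<longlonglongrightarrow> (\<Sum>k<K. (cmod (?x m k - x k))\<^sup>2)"
        by (intro tendsto_intros x)
      show "\<exists>N. \<forall>n\<ge>N. (\<Sum>k<K. (cmod (?x m k - ?x n k))\<^sup>2) \<le> e"
        using part N that by (meson less_imp_le order_trans)
    qed
    then show ?thesis by blast
  qed
  obtain M where M: "\<And>K. (\<Sum>k<K. (cmod (?x M k - x k))\<^sup>2) \<le> 1" using lim[of 1] by auto
  have "cmod (x k) \<le> 1 + sqrt (hnsq (F M))" for k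
  proof -
    have "(cmod (?x M k - x k))\<^sup>2 \<le> (\<Sum>j<Suc k. (cmod (?x M j - x j))\<^sup>2)" by (simp add: sum_nonneg)
    with M[of "Suc k"] have "(cmod (?x M k - x k))\<^sup>2 \<le> 1" by linarith
    then have 1: "cmod (?x M k - x k) \<le> 1" by (simp add: abs_square_le_1)
    have "(cmod (?x M k))\<^sup>2 \<le> hnsq (F M)"
      using sum_le_suminf[OF sums_summable[OF hnsq_sums[OF F[of M]]], of "{k}"] sums_unique[OF hnsq_sums[OF F[of M]]] by simp
    then have "cmod (?x M k) \<le> sqrt (hnsq (F M))" by (rule real_le_rsqrt)
    with 1 show ?thesis using norm_triangle_ineq4[of "?x M k" "?x M k - x k"] by simp
  qed
  note ps = bounded_power_series[OF this]
  define f where "f = (\<lambda>z. \<Sum>k. x k * z ^ k)"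
  have f: "f holomorphic_on unit_disk" "\<And>k. taylor_coeff f k = x k"
    unfolding f_def using holomorphic_power_series_on_disk[OF ps] taylor_coeff_eqI[OF ps] by auto
  have bd: "(\<lambda>z. F m z - f z) \<in> H2 \<and> hnsq (\<lambda>z. F m z - f z) \<le> e"
    if "\<forall>K. (\<Sum>k<K. (cmod (?x m k - x k))\<^sup>2) \<le> e" for m e
    using that H2_holomorphic[OF F[of m]] f
    by (intro conjI H2_boundI) (auto simp: taylor_coeff_diff intro: holomorphic_intros)
  have "(\<lambda>z. F M z - (F M z - f z)) \<in> H2" using H2_diff[OF F[of M]] bd M by blast
  then have fH: "f \<in> H2" by simp
  have "(\<lambda>n. hnsq (\<lambda>x. F n x - f x)) \<longlonglongrightarrow> 0"
  proof (rule LIMSEQ_I)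
    fix e :: real assume e: "e > 0"
    obtain N where "\<forall>m\<ge>N. \<forall>K. (\<Sum>k<K. (cmod (?x m k - x k))\<^sup>2) \<le> e / 2" using lim[of "e/2"] e by auto
    then have "hnsq (\<lambda>x. F m x - f x) \<le> e / 2" if "m \<ge> N" for m using bd that by blast
    moreover have "0 \<le> hnsq (\<lambda>x. F m x - f x)" for m
      by (rule sums_le[OF _ sums_zero hnsq_sums[OF H2_diff[OF F fH]]]) simp
    ultimately have "\<forall>m\<ge>N. norm (hnsq (\<lambda>x. F m x - f x) - 0) < e"
      using e by (force simp: abs_of_nonneg)
    then show "\<exists>N. \<forall>m\<ge>N. norm (hnsq (\<lambda>x. F m x - f x) - 0) < e" by blast
  qed
  with fH show ?thesis by blast
qed

interpretation hardy: rkhs unit_disk H2 hip szego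
proof
  show "(\<lambda>_. 0) \<in> H2"
    using taylor_coeff_polynomial[of "{}"] by (simp add: H2_def)
  fix f g assume fg: "f \<in> H2" "g \<in> H2"
  show "(\<lambda>x. f x + g x) \<in> H2" by (rule H2_add[OF fg])
  show "hip (\<lambda>x. c * f x) g = c * hip f g" for c
    using sums_unique[OF sums_mult[OF hip_sums[OF fg], of c]]
    by (simp add: hip_def taylor_coeff_cmult H2_holomorphic[OF fg(1)] mult.assoc)
  show "hip g f = cnj (hip f g)"
    using sums_unique[OF sums_cnj[THEN iffD2, OF hip_sums[OF fg]]] by (simp add: hip_def mult.commute)
  show "hip (\<lambda>x. f x + g x) h = hip f h + hip g h" if h: "h \<in> H2" for h
    using sums_unique[OF sums_add[OF hip_sums[OF fg(1) h] hip_sums[OF fg(2) h]]]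
    by (simp add: hip_def taylor_coeff_add H2_holomorphic[OF fg(1)] H2_holomorphic[OF fg(2)] ring_distribs)
next
  fix f assume f: "f \<in> H2"
  show "(\<lambda>x. c * f x) \<in> H2" for c by (rule H2_scale[OF f])
  show "g \<in> H2" if "\<And>x. x \<in> unit_disk \<Longrightarrow> g x = f x" for g by (rule H2_eqI[OF f that])
  show nn: "0 \<le> hnsq f" by (rule sums_le[OF _ sums_zero hnsq_sums[OF f]]) simp
  show "(hip f f = 0) = (\<forall>x\<in>unit_disk. f x = 0)"
  proof
    assume "hip f f = 0"
    then have "(\<lambda>n. (cmod (taylor_coeff f n))\<^sup>2) sums 0" using hnsq_sums[OF f] by simp
    then have "(cmod (taylor_coeff f n))\<^sup>2 = 0" for n
      using suminf_eq_zero_iff[of "\<lambda>n. (cmod (taylor_coeff f n))\<^sup>2"] by (auto simp: sums_iff)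
    then show "\<forall>x\<in>unit_disk. f x = 0"
      using taylor_sums[OF H2_holomorphic[OF f]] by (auto simp: sums_iff)
  next
    assume "\<forall>x\<in>unit_disk. f x = 0"
    then have "taylor_coeff f n = 0" for n by (intro taylor_coeff_eqI) auto
    then show "hip f f = 0" by (simp add: hip_def)
  qed
  fix w :: complex assume w: "w \<in> unit_disk"
  show "hip f (szego w) = f w"
    using taylor_sums[OF H2_holomorphic[OF f] w] by (simp add: hip_def taylor_coeff_szego[OF w] sums_iff)
qed (use H2_complete szego_in_H2 in blast)+

lemma sums_integral_norm_square:
  assumes "f holomorphic_on unit_disk" "0 \<le> r" "r < 1"
  shows "(\<lambda>n. (cmod (taylor_coeff f n))\<^sup>2 * r ^ (2 * n)) sums
     (LINT \<zeta>|circle_measure. (cmod (f (of_real r * \<zeta>)))\<^sup>2)"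
proof -
  have "(\<lambda>n. complex_of_real ((cmod (taylor_coeff f n))\<^sup>2 * r ^ (2 * n))) sums
     (LINT \<zeta>|circle_measure. complex_of_real ((cmod (f (of_real r * \<zeta>)))\<^sup>2))"
    using parseval_circle[OF assms(1) assms] by (simp only: of_real_mult complex_norm_square)
  then show ?thesis unfolding integral_complex_of_real sums_of_real_iff .
qed

lemma integral_norm_square_le:
  assumes "f \<in> H2" "0 \<le> r" "r < 1"
  shows "(LINT \<zeta>|circle_measure. (cmod (f (of_real r * \<zeta>)))\<^sup>2) \<le> hnsq f"
  by (rule sums_le[OF _ sums_integral_norm_square[OF H2_holomorphic[OF assms(1)] assms(2,3)] hnsq_sums[OF assms(1)]])
     (use assms in \<open>simp add: mult_left_le power_le_one\<close>)

definition radius :: "nat \<Rightarrow> real" where "radius k = 1 - 1 / (real k + 2)"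

lemma radius: "0 \<le> radius k" "radius k < 1" "radius \<longlonglongrightarrow> 1"
proof -
  show "radius \<longlonglongrightarrow> 1" unfolding radius_def by real_asymp
qed (auto simp: radius_def field_simps)

text \<open>
  For fixed \<open>N\<close> the partial sum of the first \<open>N\<close> squared coefficients is the limit of its dilates,
  so only a bound in the limit of the radii is required.
\<close>

lemma H2_integral_boundI:
  assumes f: "f holomorphic_on unit_disk"
    and le: "\<And>k. (LINT \<zeta>|circle_measure. (cmod (f (of_real (radius k) * \<zeta>)))\<^sup>2) \<le> C k"
    and C: "C \<longlonglongrightarrow> c"
  shows "f \<in> H2" and "hnsq f \<le> c"
proof -
  have "(\<Sum>n<N. (cmod (taylor_coeff f n))\<^sup>2) \<le> c" for N
  proof (rule LIMSEQ_le[OF _ C])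
    have "(\<lambda>k. \<Sum>n<N. (cmod (taylor_coeff f n))\<^sup>2 * radius k ^ (2 * n)) \<longlonglongrightarrow> (\<Sum>n<N. (cmod (taylor_coeff f n))\<^sup>2 * 1 ^ (2 * n))"
      by (intro tendsto_intros radius)
    then show "(\<lambda>k. \<Sum>n<N. (cmod (taylor_coeff f n))\<^sup>2 * radius k ^ (2 * n)) \<longlonglongrightarrow> (\<Sum>n<N. (cmod (taylor_coeff f n))\<^sup>2)" by simp
    have "(\<Sum>n<N. (cmod (taylor_coeff f n))\<^sup>2 * radius k ^ (2 * n)) \<le> C k" for k
    proof -
      note s = sums_integral_norm_square[OF f radius(1,2)[of k]]
      have "(\<Sum>n<N. (cmod (taylor_coeff f n))\<^sup>2 * radius k ^ (2 * n)) \<le> (LINT \<zeta>|circle_measure. (cmod (f (of_real (radius k) * \<zeta>)))\<^sup>2)"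
        using sum_le_suminf[OF sums_summable[OF s], of "{..<N}"] sums_unique[OF s] radius(1)[of k] by simp
      then show ?thesis using le[of k] by linarith
    qed
    then show "\<exists>M. \<forall>k\<ge>M. (\<Sum>n<N. (cmod (taylor_coeff f n))\<^sup>2 * radius k ^ (2 * n)) \<le> C k" by blast
  qed
  from H2_boundI[OF f this] show "f \<in> H2" "hnsq f \<le> c" by auto
qed

lemma hardy_2_eq_H2: "hardy 2 = H2"
proof (intro equalityI subsetI)
  fix f assume "f \<in> hardy 2"
  then obtain C where f: "f holomorphic_on unit_disk"
    and C: "\<And>r. r \<in> {0..<1} \<Longrightarrow> (LINT \<zeta>|circle_measure. norm (f (of_real r * \<zeta>)) powr 2) \<le> C"
    unfolding hardy_def bdd_above_def by blast
  from H2_integral_boundI(1)[OF f _ tendsto_const[of C]] C radius show "f \<in> H2"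
    by (simp add: powr_numeral)
next
  fix f assume f: "f \<in> H2"
  then show "f \<in> hardy 2"
    using integral_norm_square_le[OF f] unfolding hardy_def bdd_above_def
    by (auto simp: H2_holomorphic powr_numeral intro!: exI[of _ "hnsq f"])
qed

lemma H2_multiplier:
  assumes m: "m holomorphic_on unit_disk" "\<And>z. z \<in> unit_disk \<Longrightarrow> cmod (m z) \<le> M" and f: "f \<in> H2"
  shows "(\<lambda>z. m z * f z) \<in> H2" and "hnsq (\<lambda>z. m z * f z) \<le> M\<^sup>2 * hnsq f"
proof -
  have mf: "(\<lambda>z. m z * f z) holomorphic_on unit_disk" using m H2_holomorphic[OF f] by (intro holomorphic_intros)
  have "(LINT \<zeta>|circle_measure. (cmod (m (of_real (radius k) * \<zeta>) * f (of_real (radius k) * \<zeta>)))\<^sup>2) \<le> M\<^sup>2 * hnsq f" for k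
  proof -
    let ?z = "\<lambda>\<zeta>. of_real (radius k) * \<zeta>"
    have "(LINT \<zeta>|circle_measure. (cmod (m (?z \<zeta>) * f (?z \<zeta>)))\<^sup>2) \<le> (LINT \<zeta>|circle_measure. M\<^sup>2 * (cmod (f (?z \<zeta>)))\<^sup>2)"
    proof (rule integral_mono)
      fix \<zeta> :: complex assume "\<zeta> \<in> space circle_measure"
      then have "?z \<zeta> \<in> unit_disk" using radius(1,2)[of k] by (simp add: norm_mult)
      from m(2)[OF this] show "(cmod (m (?z \<zeta>) * f (?z \<zeta>)))\<^sup>2 \<le> M\<^sup>2 * (cmod (f (?z \<zeta>)))\<^sup>2"
        by (simp add: norm_mult power_mult_distrib mult_right_mono power_mono)
    qed (use continuous_on_circle_dilate[OF m(1) radius(1,2)] continuous_on_circle_dilate[OF H2_holomorphic[OF f] radius(1,2)]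
         in \<open>auto intro!: integrable_circle_continuous continuous_intros\<close>)
    also have "\<dots> \<le> M\<^sup>2 * hnsq f"
      using integral_norm_square_le[OF f radius(1,2)[of k]] by (simp add: mult_left_mono)
    finally show ?thesis .
  qed
  from H2_integral_boundI[OF mf this tendsto_const]
  show "(\<lambda>z. m z * f z) \<in> H2" "hnsq (\<lambda>z. m z * f z) \<le> M\<^sup>2 * hnsq f" by auto
qed

lemma one_in_H2: "(\<lambda>_. 1) \<in> H2" and hnsq_one: "hnsq (\<lambda>_. 1) = 1"
proof -
  have c: "taylor_coeff (\<lambda>_. 1) n = (if n = 0 then 1 else 0)" for n
    using taylor_coeff_power[of 0 n] by simp
  have s: "(\<lambda>n. (cmod (taylor_coeff (\<lambda>_. 1) n))\<^sup>2) sums 1"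
    using sums_single[of 0 "\<lambda>_. 1::real"] unfolding c
    by (rule sums_cong[THEN iffD1, rotated]) simp
  then show H: "(\<lambda>_. 1) \<in> H2" by (simp add: H2_def sums_iff)
  from sums_unique2[OF hnsq_sums[OF H] s] show "hnsq (\<lambda>_. 1) = 1" .
qed

lemma bounded_holomorphic_in_H2:
  assumes "m holomorphic_on unit_disk" "\<And>z. z \<in> unit_disk \<Longrightarrow> cmod (m z) \<le> M"
  shows "m \<in> H2" and "hnsq m \<le> M\<^sup>2"
  using H2_multiplier[OF assms one_in_H2] by (simp_all add: hnsq_one)

lemma power_mult_in_H2: "f \<in> H2 \<Longrightarrow> (\<lambda>z. z ^ k * f z) \<in> H2"
  by (rule H2_multiplier(1)[where M=1]) (auto intro!: holomorphic_intros simp: norm_power power_le_one)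

lemma power_in_H2: "(\<lambda>z. z ^ k) \<in> H2"
  using power_mult_in_H2[OF one_in_H2] by simp

lemma hip_power: "hip f (\<lambda>z. z ^ k) = taylor_coeff f k"
proof -
  have "(\<lambda>n. taylor_coeff f n * cnj (taylor_coeff (\<lambda>z. z ^ k) n)) = (\<lambda>n. if n = k then taylor_coeff f n else 0)"
    by (auto simp: taylor_coeff_power)
  with sums_single[of k "taylor_coeff f"] show ?thesis by (simp add: hip_def sums_iff)
qed

text \<open>
  Abel summation for two exponents of interest: \<open>2 * n\<close> when both factors are dilated, as in the
  Parseval identity, and \<open>n\<close> when one of them lives on the circle itself.
\<close>

lemma hip_abel_limit:
  assumes "f \<in> H2" "g \<in> H2"
  shows "(\<lambda>k. \<Sum>n. taylor_coeff f n * cnj (taylor_coeff g n) * of_real (radius k ^ e n)) \<longlonglongrightarrow> hip f g"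
  unfolding hip_def
proof (rule tannerys_theorem[THEN conjunct2, THEN conjunct2])
  let ?c = "\<lambda>n. taylor_coeff f n * cnj (taylor_coeff g n)"
  fix n
  have "(\<lambda>k. ?c n * of_real (radius k ^ e n)) \<longlonglongrightarrow> ?c n * of_real (1 ^ e n)"
    by (intro tendsto_intros radius)
  then show "(\<lambda>k. ?c n * of_real (radius k ^ e n)) \<longlonglongrightarrow> ?c n" by simp
next
  let ?c = "\<lambda>n. taylor_coeff f n * cnj (taylor_coeff g n)"
  show "summable (\<lambda>n. norm (?c n))" by (rule hip_abs_summable[OF assms])
  have "norm (?c n * of_real (radius k ^ e n)) \<le> norm (?c n)" for n k
    using radius(1,2)[of k] by (simp add: norm_mult mult_left_le power_le_one norm_power)
  then show "\<forall>\<^sub>F (n, k) in sequentially \<times>\<^sub>F sequentially. norm (?c n * of_real (radius k ^ e n)) \<le> norm (?c n)"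
    by (intro always_eventually) auto
qed simp

lemma hip_eq_lim_integral:
  assumes "f \<in> H2" "g \<in> H2"
  shows "(\<lambda>k. LINT \<zeta>|circle_measure. f (of_real (radius k) * \<zeta>) * cnj (g (of_real (radius k) * \<zeta>))) \<longlonglongrightarrow> hip f g"
  using hip_abel_limit[OF assms, of "\<lambda>n. 2 * n"]
    parseval_circle[OF assms[THEN H2_holomorphic] radius(1,2)] by (simp add: sums_iff)

definition taylor_poly :: "nat \<Rightarrow> (complex \<Rightarrow> complex) \<Rightarrow> complex \<Rightarrow> complex" where
  "taylor_poly N f z = (\<Sum>n<N. taylor_coeff f n * z ^ n)"

lemma taylor_coeff_taylor_poly:
  "taylor_coeff (taylor_poly N f) n = (if n < N then taylor_coeff f n else 0)"
  unfolding taylor_poly_def[abs_def] by (simp add: taylor_coeff_polynomial)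

lemma polynomial_in_H2: "finite A \<Longrightarrow> (\<lambda>z. \<Sum>k\<in>A. x k * z ^ k) \<in> H2"
proof -
  assume "finite A"
  then show ?thesis
    unfolding H2_def by (auto intro!: holomorphic_intros summable_finite[of A] simp: taylor_coeff_polynomial)
qed

lemma taylor_poly_in_H2: "taylor_poly N f \<in> H2"
  unfolding taylor_poly_def[abs_def] by (rule polynomial_in_H2) simp

lemma taylor_poly_tendsto:
  assumes f: "f \<in> H2"
  shows "(\<lambda>N. hnsq (\<lambda>z. taylor_poly N f z - f z)) \<longlonglongrightarrow> 0"
proof -
  let ?c = "\<lambda>n. (cmod (taylor_coeff f n))\<^sup>2"
  have "hnsq (\<lambda>z. taylor_poly N f z - f z) = hnsq f - (\<Sum>n<N. ?c n)" for N
  proof -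
    have "(\<lambda>n. ?c n - (if n \<in> {..<N} then ?c n else 0)) sums (hnsq f - (\<Sum>n<N. ?c n))"
      by (intro sums_diff hnsq_sums f sums_If_finite_set) simp
    moreover have "(\<lambda>n. ?c n - (if n \<in> {..<N} then ?c n else 0))
       = (\<lambda>n. (cmod (taylor_coeff (\<lambda>z. taylor_poly N f z - f z) n))\<^sup>2)"
      using H2_holomorphic[OF taylor_poly_in_H2] H2_holomorphic[OF f]
      by (auto simp: taylor_coeff_diff taylor_coeff_taylor_poly)
    ultimately show ?thesis
      using sums_unique2[OF hnsq_sums[OF H2_diff[OF taylor_poly_in_H2 f]]] by simp
  qed
  moreover have "(\<lambda>N. hnsq f - (\<Sum>n<N. ?c n)) \<longlonglongrightarrow> hnsq f - hnsq f"
    using hnsq_sums[OF f] by (intro tendsto_intros) (simp add: sums_def)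
  ultimately show ?thesis by simp
qed

lemma multiplier_tendsto:
  assumes m: "m holomorphic_on unit_disk" "\<And>z. z \<in> unit_disk \<Longrightarrow> cmod (m z) \<le> M"
    and F: "\<And>n. F n \<in> H2" and f: "f \<in> H2" and lim: "(\<lambda>n. hnsq (\<lambda>z. F n z - f z)) \<longlonglongrightarrow> 0"
  shows "(\<lambda>n. hnsq (\<lambda>z. m z * F n z - m z * f z)) \<longlonglongrightarrow> 0"
proof (rule tendsto_sandwich[OF _ _ tendsto_const tendsto_mult_right_zero[OF lim, of "M\<^sup>2"]])
  have "(\<lambda>z. m z * (F n z - f z)) \<in> H2" "hnsq (\<lambda>z. m z * (F n z - f z)) \<le> M\<^sup>2 * hnsq (\<lambda>z. F n z - f z)" for n
    using H2_multiplier[OF m H2_diff[OF F f]] by auto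
  then show "\<forall>\<^sub>F n in sequentially. 0 \<le> hnsq (\<lambda>z. m z * F n z - m z * f z)"
    "\<forall>\<^sub>F n in sequentially. hnsq (\<lambda>z. m z * F n z - m z * f z) \<le> M\<^sup>2 * hnsq (\<lambda>z. F n z - f z)"
    using hardy.ip_nonneg by (auto simp: right_diff_distrib intro!: always_eventually)
qed

text \<open>
  Polynomials are dense. This is the common form of several extension arguments, where \<open>L\<close> is the
  difference of two conjugate-linear functionals that agree on monomials.
\<close>

lemma H2_functional_eq_0:
  assumes add: "\<And>f g. f \<in> H2 \<Longrightarrow> g \<in> H2 \<Longrightarrow> L (\<lambda>z. f z + g z) = L f + L g"
    and scale: "\<And>c f. f \<in> H2 \<Longrightarrow> L (\<lambda>z. c * f z) = cnj c * L f"
    and cont: "\<And>F f. (\<And>n::nat. F n \<in> H2) \<Longrightarrow> f \<in> H2 \<Longrightarrow> (\<lambda>n. hnsq (\<lambda>z. F n z - f z)) \<longlonglongrightarrow> 0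
      \<Longrightarrow> (\<lambda>n. L (F n)) \<longlonglongrightarrow> L f"
    and pow: "\<And>k. L (\<lambda>z. z ^ k) = (0::complex)"
    and f: "f \<in> H2"
  shows "L f = 0"
proof -
  have "L (taylor_poly N f) = 0" for N
  proof (induction N)
    case 0
    have "L (\<lambda>z. 0 * (1::complex)) = 0" using scale[OF one_in_H2, of 0] by simp
    then show ?case by (simp add: taylor_poly_def[abs_def])
  next
    case (Suc N)
    have "taylor_poly (Suc N) f = (\<lambda>z. taylor_poly N f z + taylor_coeff f N * z ^ N)"
      by (auto simp: taylor_poly_def)
    then show ?case
      using add[OF taylor_poly_in_H2 H2_scale[OF power_in_H2], of N f "taylor_coeff f N" N]
        scale[OF power_in_H2, of "taylor_coeff f N" N] Suc pow by simp
  qed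
  with cont[OF taylor_poly_in_H2 f taylor_poly_tendsto[OF f]] show ?thesis
    by (simp add: LIMSEQ_const_iff)
qed


section \<open>Outer functions\<close>

definition herglotz :: "(complex \<Rightarrow> real) \<Rightarrow> complex \<Rightarrow> complex" where
  "herglotz h z = (LINT \<zeta>|circle_measure. (\<zeta> + z) / (\<zeta> - z) * of_real (h \<zeta>))"

lemma herglotz_kernel_sums:
  assumes "\<zeta> \<in> sphere 0 1" "z \<in> unit_disk"
  shows "(\<lambda>n. (if n = 0 then 1 else 2) * (z ^ n * cnj \<zeta> ^ n)) sums ((\<zeta> + z) / (\<zeta> - z))"
proof -
  let ?q = "z * cnj \<zeta>"
  have z1: "\<zeta> * cnj \<zeta> = 1" using complex_norm_square[of \<zeta>] assms by simp
  have q: "norm ?q < 1" using assms by (simp add: norm_mult)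
  then have q1: "1 - ?q \<noteq> 0" by auto
  have "(\<lambda>n. 2 * ?q ^ n - (if n = 0 then 1 else 0)) sums (2 * (1 / (1 - ?q)) - 1)"
    by (intro sums_diff sums_mult geometric_sums q sums_single)
  also have "(\<lambda>n. 2 * ?q ^ n - (if n = 0 then 1 else 0)) = (\<lambda>n. (if n = 0 then 1 else 2) * (z ^ n * cnj \<zeta> ^ n))"
    by (auto simp: power_mult_distrib)
  also have "2 * (1 / (1 - ?q)) - 1 = (1 + ?q) / (1 - ?q)"
    using q1 by (simp add: field_simps)
  also have "\<dots> = (\<zeta> * (1 + ?q)) / (\<zeta> * (1 - ?q))"
    using assms by (intro mult_divide_mult_cancel_left[symmetric]) auto
  also have "\<zeta> * (1 + ?q) = \<zeta> + z" using z1 by (simp add: algebra_simps)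
  also have "\<zeta> * (1 - ?q) = \<zeta> - z" using z1 by (simp add: algebra_simps)
  finally show ?thesis .
qed

lemma continuous_on_herglotz_kernel:
  "z \<in> unit_disk \<Longrightarrow> continuous_on (sphere 0 1) (\<lambda>\<zeta>. (\<zeta> + z) / (\<zeta> - z))"
  by (intro continuous_intros) auto

lemma integrable_herglotz:
  assumes "integrable circle_measure h" "z \<in> unit_disk"
  shows "integrable circle_measure (\<lambda>\<zeta>. (\<zeta> + z) / (\<zeta> - z) * of_real (h \<zeta>))"
  using assms by (intro integrable_circle_continuous_mult continuous_on_herglotz_kernel) auto

lemma herglotz_sums:
  assumes "integrable circle_measure h" "z \<in> unit_disk"
  shows "(\<lambda>n. ((if n = 0 then 1 else 2) * (LINT \<zeta>|circle_measure. of_real (h \<zeta>) * cnj \<zeta> ^ n)) * z ^ n) sums herglotz h z"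
proof -
  let ?y = "\<lambda>n \<zeta>. (if n = 0 then 1 else 2) * (z ^ n * cnj \<zeta> ^ n)"
  have "(\<lambda>n. LINT \<zeta>|circle_measure. of_real (h \<zeta>) * ?y n \<zeta>) sums
     (LINT \<zeta>|circle_measure. of_real (h \<zeta>) * (\<Sum>n. ?y n \<zeta>))"
  proof (rule integral_circle_series[where t = "\<lambda>n. 2 * norm z ^ n"])
    show "summable (\<lambda>n. 2 * norm z ^ n)" using assms(2) by (intro summable_mult summable_geometric) auto
    show "continuous_on (sphere 0 1) (?y n)" for n by (intro continuous_intros)
  qed (use assms in \<open>auto simp: norm_mult norm_power\<close>)
  also have "(LINT \<zeta>|circle_measure. of_real (h \<zeta>) * (\<Sum>n. ?y n \<zeta>)) = herglotz h z"
    unfolding herglotz_def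
    by (intro Bochner_Integration.integral_cong refl)
       (use herglotz_kernel_sums[OF _ assms(2)] in \<open>simp add: sums_iff mult.commute\<close>)
  also have "(\<lambda>n. LINT \<zeta>|circle_measure. of_real (h \<zeta>) * ?y n \<zeta>)
     = (\<lambda>n. ((if n = 0 then 1 else 2) * (LINT \<zeta>|circle_measure. of_real (h \<zeta>) * cnj \<zeta> ^ n)) * z ^ n)"
  proof
    fix n
    have "(LINT \<zeta>|circle_measure. of_real (h \<zeta>) * ?y n \<zeta>)
       = (LINT \<zeta>|circle_measure. ((if n = 0 then 1 else 2) * z ^ n) * (of_real (h \<zeta>) * cnj \<zeta> ^ n))"
      by (intro Bochner_Integration.integral_cong) (auto simp: mult_ac)
    then show "(LINT \<zeta>|circle_measure. of_real (h \<zeta>) * ?y n \<zeta>)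
       = ((if n = 0 then 1 else 2) * (LINT \<zeta>|circle_measure. of_real (h \<zeta>) * cnj \<zeta> ^ n)) * z ^ n"
      by (simp add: mult_ac)
  qed
  finally show ?thesis .
qed

lemma herglotz_holomorphic: "integrable circle_measure h \<Longrightarrow> herglotz h holomorphic_on unit_disk"
  by (rule holomorphic_power_series_on_disk) (rule herglotz_sums)

lemma herglotz_add:
  assumes "integrable circle_measure h" "integrable circle_measure g" "z \<in> unit_disk"
  shows "herglotz (\<lambda>\<zeta>. h \<zeta> + g \<zeta>) z = herglotz h z + herglotz g z"
  using integrable_herglotz[OF assms(1,3)] integrable_herglotz[OF assms(2,3)]
  by (simp add: herglotz_def ring_distribs)

lemma herglotz_at_0: "herglotz h 0 = of_real (LINT \<zeta>|circle_measure. h \<zeta>)"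
proof -
  have "herglotz h 0 = (LINT \<zeta>|circle_measure. of_real (h \<zeta>))"
    unfolding herglotz_def by (intro Bochner_Integration.integral_cong) auto
  then show ?thesis by simp
qed

lemma herglotz_const:
  assumes "z \<in> unit_disk" shows "herglotz (\<lambda>_. c) z = of_real c"
proof -
  have i: "(LINT \<zeta>|circle_measure. of_real c * cnj \<zeta> ^ n) = (if n = 0 then of_real c else 0)" for n
    using integral_circle_power_cnj_power[of 0 n] by simp
  have "(\<lambda>n. if n = 0 then of_real c else 0) sums herglotz (\<lambda>_. c) z"
  proof -
    have "(\<lambda>n. ((if n = 0 then 1 else 2) * (if n = 0 then of_real c else 0)) * z ^ n) sums herglotz (\<lambda>_. c) z"
      using herglotz_sums[of "\<lambda>_. c", OF _ assms] unfolding i by simp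
    then show ?thesis by (rule sums_cong[THEN iffD1, rotated]) simp
  qed
  from sums_unique2[OF this sums_single[of 0 "\<lambda>_. of_real c"]] show ?thesis .
qed

lemma Re_herglotz_kernel_nonneg:
  assumes "\<zeta> \<in> sphere 0 1" "z \<in> unit_disk"
  shows "0 \<le> Re ((\<zeta> + z) / (\<zeta> - z))"
proof -
  have "Re ((\<zeta> + z) * cnj (\<zeta> - z)) = (norm \<zeta>)\<^sup>2 - (norm z)\<^sup>2"
    unfolding cmod_power2 by (simp add: power2_eq_square algebra_simps)
  also have "\<dots> \<ge> 0" using assms by (simp add: power_le_one)
  finally show ?thesis
    by (simp add: Re_complex_div_ge_0)
qed

lemma Re_herglotz_mono:
  assumes "integrable circle_measure h" "integrable circle_measure g" "z \<in> unit_disk"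
    and le: "\<And>\<zeta>. h \<zeta> \<le> g \<zeta>"
  shows "Re (herglotz h z) \<le> Re (herglotz g z)"
proof -
  have R: "Re (herglotz f z) = (LINT \<zeta>|circle_measure. Re ((\<zeta> + z) / (\<zeta> - z)) * f \<zeta>)"
    if "integrable circle_measure f" for f
    unfolding herglotz_def integral_Re[OF integrable_herglotz[OF that assms(3)], symmetric]
    by (intro Bochner_Integration.integral_cong refl) (simp only: times_complex.simps complex_of_real_def complex.sel mult_zero_right diff_zero)
  have I: "integrable circle_measure (\<lambda>\<zeta>. Re ((\<zeta> + z) / (\<zeta> - z)) * f \<zeta>)"
    if "integrable circle_measure f" for f
    using integrable_Re[OF integrable_herglotz[OF that assms(3)]]
    by (simp only: times_complex.simps complex_of_real_def complex.sel mult_zero_right diff_zero)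
  show ?thesis unfolding R[OF assms(1)] R[OF assms(2)]
    by (rule integral_mono[OF I[OF assms(1)] I[OF assms(2)]])
       (use Re_herglotz_kernel_nonneg[OF _ assms(3)] le in \<open>auto intro!: mult_left_mono\<close>)
qed

text \<open>The outer function whose boundary values have modulus \<open>exp h\<close>.\<close>

definition outer_exp :: "(complex \<Rightarrow> real) \<Rightarrow> complex \<Rightarrow> complex" where
  "outer_exp h z = exp (herglotz h z)"

lemma outer_exp_holomorphic: "integrable circle_measure h \<Longrightarrow> outer_exp h holomorphic_on unit_disk"
  unfolding outer_exp_def[abs_def] by (intro holomorphic_intros herglotz_holomorphic)

lemma outer_exp_mult:
  assumes "integrable circle_measure h" "integrable circle_measure g" "z \<in> unit_disk"
  shows "outer_exp h z * outer_exp g z = outer_exp (\<lambda>\<zeta>. h \<zeta> + g \<zeta>) z"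
  by (simp add: outer_exp_def herglotz_add[OF assms] exp_add)

lemma norm_outer_exp_le:
  assumes "integrable circle_measure h" "z \<in> unit_disk" "\<And>\<zeta>. h \<zeta> \<le> c"
  shows "norm (outer_exp h z) \<le> exp c"
  using Re_herglotz_mono[OF assms(1) _ assms(2), of "\<lambda>_. c"] assms(3) herglotz_const[OF assms(2), of c]
  by (simp add: outer_exp_def)

lemma hnsq_diff_one:
  assumes "f \<in> H2" "hnsq f \<le> 1"
  shows "hnsq (\<lambda>z. f z - 1) \<le> 2 - 2 * Re (f 0)"
proof -
  have f0: "hip f (\<lambda>_. 1) = f 0"
    using hip_power[of f 0] by (simp add: taylor_coeff_def)
  moreover have "hip (\<lambda>_. 1) f = cnj (f 0)"
    using hardy.ip_cnj[OF assms(1) one_in_H2] f0 by simp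
  ultimately have "hnsq (\<lambda>z. f z - 1) = hnsq f - 2 * Re (f 0) + 1"
    using assms(1) one_in_H2 hnsq_one by (simp add: hardy.ip_diff hardy.ip_diff_right hardy.diff_mem)
  then show ?thesis using assms(2) by simp
qed

text \<open>
  Truncating \<open>-h\<close> from above at height \<open>n\<close> gives a bounded multiplier \<open>q n\<close> for which
  \<open>q n * outer_exp h = outer_exp (min 0 (h + n))\<close> is in the unit ball.  Convergence of these products
  at the origin alone already forces convergence in norm, since the norms do not exceed the norm of the
  limit.
\<close>

lemma outer_exp_approximate_inverse:
  assumes h: "integrable circle_measure h"
  shows "\<exists>q. (\<forall>n::nat. q n holomorphic_on unit_disk \<and> (\<exists>B. \<forall>z\<in>unit_disk. norm (q n z) \<le> B)) \<and>
    (\<forall>n. \<forall>z\<in>unit_disk. norm (q n z * outer_exp h z) \<le> 1) \<and>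
    (\<lambda>n. hnsq (\<lambda>z. q n z * outer_exp h z - 1)) \<longlonglongrightarrow> 0"
proof -
  define q where "q = (\<lambda>n::nat. outer_exp (\<lambda>\<zeta>. min (- h \<zeta>) (real n)))"
  have int: "integrable circle_measure (\<lambda>\<zeta>. min (- h \<zeta>) (real n))" for n
    using h by (intro Bochner_Integration.integrable_min) auto
  have qh: "q n holomorphic_on unit_disk" for n unfolding q_def by (rule outer_exp_holomorphic[OF int])
  have qb: "norm (q n z) \<le> exp (real n)" if "z \<in> unit_disk" for n z
    unfolding q_def by (rule norm_outer_exp_le[OF int that]) simp
  have prod: "q n z * outer_exp h z = outer_exp (\<lambda>\<zeta>. min 0 (h \<zeta> + real n)) z" if "z \<in> unit_disk" for n z
  proof -
    have "(\<lambda>\<zeta>. min (- h \<zeta>) (real n) + h \<zeta>) = (\<lambda>\<zeta>. min 0 (h \<zeta> + real n))" by (auto simp: min_def)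
    then show ?thesis unfolding q_def outer_exp_mult[OF int h that] by simp
  qed
  have int': "integrable circle_measure (\<lambda>\<zeta>. min 0 (h \<zeta> + real n))" for n
    using h by (intro Bochner_Integration.integrable_min) auto
  have le1: "norm (q n z * outer_exp h z) \<le> 1" if "z \<in> unit_disk" for n z
    unfolding prod[OF that] using norm_outer_exp_le[OF int' that, of n 0] by simp
  have "(\<lambda>n. LINT \<zeta>|circle_measure. min 0 (h \<zeta> + real n)) \<longlonglongrightarrow> (LINT \<zeta>|circle_measure. 0)"
  proof (rule integral_dominated_convergence[where w = "\<lambda>\<zeta>. \<bar>h \<zeta>\<bar>"])
    show "AE \<zeta> in circle_measure. (\<lambda>n. min 0 (h \<zeta> + real n)) \<longlonglongrightarrow> 0"
    proof (rule AE_I2)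
      fix \<zeta>
      obtain N where N: "- h \<zeta> \<le> real N" using real_arch_simple by blast
      have "\<forall>\<^sub>F n in sequentially. min 0 (h \<zeta> + real n) = 0"
        by (rule eventually_mono[OF eventually_ge_at_top[of N]]) (use N in auto)
      then show "(\<lambda>n. min 0 (h \<zeta> + real n)) \<longlonglongrightarrow> 0" by (rule tendsto_eventually)
    qed
  qed (use h int' in auto)
  then have "(\<lambda>n. exp (LINT \<zeta>|circle_measure. min 0 (h \<zeta> + real n))) \<longlonglongrightarrow> 1"
    using tendsto_exp[of _ "0::real"] by simp
  moreover have "Re (q n 0 * outer_exp h 0) = exp (LINT \<zeta>|circle_measure. min 0 (h \<zeta> + real n))" for n
    by (subst prod) (simp_all add: outer_exp_def herglotz_at_0 exp_of_real)
  ultimately have lim: "(\<lambda>n. 2 - 2 * Re (q n 0 * outer_exp h 0)) \<longlonglongrightarrow> 2 - 2 * 1"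
    by (intro tendsto_intros) simp
  have holo: "(\<lambda>z. q n z * outer_exp h z) holomorphic_on unit_disk" for n
    by (intro holomorphic_intros qh outer_exp_holomorphic h)
  note bH = bounded_holomorphic_in_H2[OF holo le1]
  have "(\<lambda>n. hnsq (\<lambda>z. q n z * outer_exp h z - 1)) \<longlonglongrightarrow> 0"
  proof (rule tendsto_sandwich[OF _ _ tendsto_const])
    show "\<forall>\<^sub>F n in sequentially. 0 \<le> hnsq (\<lambda>z. q n z * outer_exp h z - 1)"
      using bH(1) one_in_H2 by (intro always_eventually allI hardy.ip_nonneg H2_diff)
    show "\<forall>\<^sub>F n in sequentially. hnsq (\<lambda>z. q n z * outer_exp h z - 1) \<le> 2 - 2 * Re (q n 0 * outer_exp h 0)"
      using hnsq_diff_one[OF bH(1)] bH(2) by (intro always_eventually allI) simp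
    show "(\<lambda>n. 2 - 2 * Re (q n 0 * outer_exp h 0)) \<longlonglongrightarrow> 0" using lim by simp
  qed
  with qh qb le1 show ?thesis by (intro exI[of _ q]) blast
qed

text \<open>
  The mean-square bound on the boundary applied to all powers \<open>f ^ m\<close> turns a bound on the limits
  along radii into one on the disk: point evaluation costs a factor that does not depend on \<open>m\<close>.
\<close>

lemma bounded_by_radial_limits:
  assumes f: "f holomorphic_on unit_disk" and B: "\<And>z. z \<in> unit_disk \<Longrightarrow> norm (f z) \<le> B"
    and lim: "AE \<zeta> in circle_measure. (\<lambda>k. max 1 (norm (f (of_real (radius k) * \<zeta>)))) \<longlonglongrightarrow> 1"
    and z: "z \<in> unit_disk"
  shows "norm (f z) \<le> 1"
proof (rule ccontr)
  assume "\<not> ?thesis"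
  then have gt: "1 < (norm (f z))\<^sup>2" by (simp add: one_less_power)
  let ?g = "\<lambda>k \<zeta>. max 1 (norm (f (of_real (radius k) * \<zeta>)))"
  have cont: "continuous_on (sphere 0 1) (\<lambda>\<zeta>. f (of_real (radius k) * \<zeta>))" for k
    by (rule continuous_on_circle_dilate[OF f radius(1,2)])
  have bound: "((norm (f z))\<^sup>2) ^ m \<le> Re (szego z z)" for m
  proof -
    have gB: "?g k \<zeta> \<le> max 1 B" if "\<zeta> \<in> sphere 0 1" for k \<zeta>
      using B[of "of_real (radius k) * \<zeta>"] that radius(1,2)[of k] by (auto simp: norm_mult)
    have "(\<lambda>k. LINT \<zeta>|circle_measure. ?g k \<zeta> ^ (2 * m)) \<longlonglongrightarrow> (LINT \<zeta>|circle_measure. 1)"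
    proof (rule integral_dominated_convergence[where w = "\<lambda>_. max 1 B ^ (2 * m)"])
      show "AE \<zeta> in circle_measure. (\<lambda>k. ?g k \<zeta> ^ (2 * m)) \<longlonglongrightarrow> 1"
        using lim
      proof eventually_elim
        case (elim \<zeta>)
        from tendsto_power[OF this, of "2 * m"] show ?case by simp
      qed
      show "AE \<zeta> in circle_measure. norm (?g k \<zeta> ^ (2 * m)) \<le> max 1 B ^ (2 * m)" for k
        by (rule AE_I2) (use gB in \<open>auto simp: norm_power intro!: power_mono\<close>)
      show "(\<lambda>\<zeta>. ?g k \<zeta> ^ (2 * m)) \<in> borel_measurable circle_measure" for k
        by (intro borel_measurable_circle_continuous continuous_intros cont)
    qed auto
    then have C: "(\<lambda>k. LINT \<zeta>|circle_measure. ?g k \<zeta> ^ (2 * m)) \<longlonglongrightarrow> 1"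
      using circle.prob_space by simp
    have fm: "(\<lambda>z. f z ^ m) holomorphic_on unit_disk" using f by (intro holomorphic_intros)
    have "(LINT \<zeta>|circle_measure. (cmod (f (of_real (radius k) * \<zeta>) ^ m))\<^sup>2) \<le> (LINT \<zeta>|circle_measure. ?g k \<zeta> ^ (2 * m))" for k
      by (intro integral_mono integrable_circle_continuous continuous_intros cont)
         (auto simp: norm_power power_mult[symmetric] mult.commute[of m] intro!: power_mono)
    note H = H2_integral_boundI[OF fm this C]
    have K: "0 \<le> Re (szego z z)"
      using hardy.ip_nonneg[OF szego_in_H2[OF z]] hardy.nsq_kernel[OF z] by simp
    have "((norm (f z))\<^sup>2) ^ m = (norm (f z ^ m))\<^sup>2" by (simp add: norm_power mult.commute flip: power_mult)
    also have "\<dots> \<le> hnsq (\<lambda>z. f z ^ m) * Re (szego z z)" by (rule hardy.evaluation_bound[OF H(1) z])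
    also have "\<dots> \<le> 1 * Re (szego z z)" by (rule mult_right_mono[OF H(2) K])
    finally show ?thesis by simp
  qed
  obtain m where "Re (szego z z) < ((norm (f z))\<^sup>2) ^ m" using real_arch_pow[OF gt] by blast
  with bound[of m] show False by simp
qed

lemma has_radial_limit_radius:
  assumes "has_radial_limit f l \<zeta>"
  shows "(\<lambda>k. f (of_real (radius k) * \<zeta>)) \<longlonglongrightarrow> l"
proof -
  have "filterlim radius (at_left 1) sequentially"
    using radius by (auto simp: filterlim_at intro!: always_eventually less_imp_neq)
  from filterlim_compose[OF assms[unfolded has_radial_limit_def] this] show ?thesis .
qed

text \<open>
  What is needed of a pair of Pythagorean mates. The last property says that \<open>a\<close> is cyclic: the
  products of \<open>a\<close> with suitable bounded functions tend in norm to a unimodular constant, and these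
  products are themselves bounded by 1.
\<close>

locale mates =
  fixes a b :: "complex \<Rightarrow> complex"
  assumes a_holomorphic: "a holomorphic_on unit_disk"
    and b_holomorphic: "b holomorphic_on unit_disk"
    and a_nonzero: "z \<in> unit_disk \<Longrightarrow> a z \<noteq> 0"
    and a_le_1: "z \<in> unit_disk \<Longrightarrow> norm (a z) \<le> 1"
    and b_le_1: "z \<in> unit_disk \<Longrightarrow> norm (b z) \<le> 1"
    and radial: "AE \<zeta> in circle_measure.
      (\<lambda>k. (norm (a (of_real (radius k) * \<zeta>)))\<^sup>2 + (norm (b (of_real (radius k) * \<zeta>)))\<^sup>2) \<longlonglongrightarrow> 1"
    and cyclic: "\<exists>c q. norm c = 1 \<and>
      (\<forall>n::nat. q n holomorphic_on unit_disk \<and> (\<exists>B. \<forall>z\<in>unit_disk. norm (q n z) \<le> B)) \<and>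
      (\<forall>n. \<forall>z\<in>unit_disk. norm (a z * q n z) \<le> 1) \<and>
      (\<lambda>n. hnsq (\<lambda>z. a z * q n z - c)) \<longlonglongrightarrow> 0"

text \<open>
  The delicate point is \<open>norm (a z) \<le> 1\<close>.  The radial limits of an outer function bound it
  only after it has been written as a quotient of bounded functions whose denominator \<open>?G\<close> is outer:
  the approximate inverses of \<open>?G\<close> reduce the claim to the bounded case.
\<close>

lemma mates_if_pythagorean_mate:
  assumes b: "b holomorphic_on unit_disk" "b ` unit_disk \<subseteq> unit_disk" and mate: "pythagorean_mate b a"
  shows "mates a b"
proof -
  obtain c \<psi> where c: "norm c = 1" and int: "integrable circle_measure (\<lambda>\<zeta>. ln (\<psi> \<zeta>))"
    and a_eq: "\<And>z. z \<in> unit_disk \<Longrightarrow> a z = c * outer_exp (\<lambda>\<zeta>. ln (\<psi> \<zeta>)) z"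
    using mate unfolding pythagorean_mate_def outer_function_def outer_exp_def herglotz_def by blast
  define h where "h = (\<lambda>\<zeta>. ln (\<psi> \<zeta> :: real))"
  note int = int[folded h_def] and a_eq = a_eq[folded h_def]
  have a_holo: "a holomorphic_on unit_disk"
  proof (rule holomorphic_transform)
    show "(\<lambda>z. c * outer_exp h z) holomorphic_on unit_disk"
      by (intro holomorphic_intros outer_exp_holomorphic int)
  qed (simp add: a_eq)
  have rad: "AE \<zeta> in circle_measure. \<exists>\<alpha> \<beta>. (\<lambda>k. a (of_real (radius k) * \<zeta>)) \<longlonglongrightarrow> \<alpha> \<and>
      (\<lambda>k. b (of_real (radius k) * \<zeta>)) \<longlonglongrightarrow> \<beta> \<and> (norm \<alpha>)\<^sup>2 + (norm \<beta>)\<^sup>2 = 1"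
    using mate unfolding pythagorean_mate_def by (auto elim!: eventually_mono dest!: has_radial_limit_radius)
  (* With this exponent both ?G and a * ?G, whose exponent is min 0 h, are bounded by 1. *)
  let ?g = "\<lambda>\<zeta>. - max 0 (h \<zeta>)"
  let ?G = "outer_exp ?g"
  have intg: "integrable circle_measure ?g"
    using int by (intro Bochner_Integration.integrable_minus Bochner_Integration.integrable_max) auto
  obtain q where q: "\<And>n::nat. q n holomorphic_on unit_disk" "\<And>n. \<exists>B. \<forall>z\<in>unit_disk. norm (q n z) \<le> B"
    "\<And>n z. z \<in> unit_disk \<Longrightarrow> norm (q n z * ?G z) \<le> 1"
    "(\<lambda>n. hnsq (\<lambda>z. q n z * ?G z - 1)) \<longlonglongrightarrow> 0"
    using outer_exp_approximate_inverse[OF intg] by blast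
  have aG: "norm (a z * ?G z) \<le> 1" if z: "z \<in> unit_disk" for z
  proof -
    have "a z * ?G z = c * outer_exp (\<lambda>\<zeta>. h \<zeta> + ?g \<zeta>) z"
      using outer_exp_mult[OF int intg z] by (simp add: a_eq[OF z])
    moreover have "norm (outer_exp (\<lambda>\<zeta>. h \<zeta> + ?g \<zeta>) z) \<le> exp 0"
      using int intg by (intro norm_outer_exp_le z) auto
    ultimately show ?thesis using c by (simp add: norm_mult)
  qed
  have qGa: "norm (q n z * ?G z * a z) \<le> 1" if z: "z \<in> unit_disk" for n z
  proof -
    obtain B where B: "\<And>z. z \<in> unit_disk \<Longrightarrow> norm (q n z) \<le> B" using q(2) by blast
    show ?thesis
    proof (rule bounded_by_radial_limits[OF _ _ _ z])
      show "(\<lambda>z. q n z * ?G z * a z) holomorphic_on unit_disk"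
        by (intro holomorphic_intros q a_holo outer_exp_holomorphic intg)
      show "norm (q n w * ?G w * a w) \<le> B" if "w \<in> unit_disk" for w
      proof -
        have "norm (q n w * ?G w * a w) = norm (q n w) * norm (a w * ?G w)"
          by (simp add: norm_mult)
        also have "\<dots> \<le> B * 1"
          using B[OF that] aG[OF that] by (intro mult_mono) (auto intro: order_trans[OF norm_ge_zero])
        finally show ?thesis by simp
      qed
      show "AE \<zeta> in circle_measure. (\<lambda>k. max 1 (norm (q n (of_real (radius k) * \<zeta>) * ?G (of_real (radius k) * \<zeta>) * a (of_real (radius k) * \<zeta>)))) \<longlonglongrightarrow> 1"
        using rad AE_space
      proof eventually_elim
        case (elim \<zeta>)
        then obtain \<alpha> \<beta> :: complex where \<alpha>: "(\<lambda>k. a (of_real (radius k) * \<zeta>)) \<longlonglongrightarrow> \<alpha>" and "(norm \<alpha>)\<^sup>2 + (norm \<beta>)\<^sup>2 = 1"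
          by blast
        then have "(norm \<alpha>)\<^sup>2 \<le> 1" using zero_le_power2[of "norm \<beta>"] by linarith
        then have \<alpha>1: "norm \<alpha> \<le> 1" by (simp add: abs_square_le_1)
        have zd: "of_real (radius k) * \<zeta> \<in> unit_disk" for k
          using elim(2) radius(1,2)[of k] by (simp add: norm_mult)
        show ?case
        proof (rule tendsto_sandwich[OF _ _ tendsto_const])
          have "(\<lambda>k. max 1 (norm (a (of_real (radius k) * \<zeta>)))) \<longlonglongrightarrow> max 1 (norm \<alpha>)"
            by (intro tendsto_intros \<alpha>)
          then show "(\<lambda>k. max 1 (norm (a (of_real (radius k) * \<zeta>)))) \<longlonglongrightarrow> 1" using \<alpha>1 by (simp add: max_absorb1)
          have shrink: "norm (q n w * ?G w * a w) \<le> norm (a w)" if "w \<in> unit_disk" for w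
            using mult_right_mono[OF q(3)[OF that, of n] norm_ge_zero[of "a w"]] by (simp add: norm_mult)
          then show "\<forall>\<^sub>F k in sequentially. max 1 (norm (q n (of_real (radius k) * \<zeta>) * ?G (of_real (radius k) * \<zeta>) * a (of_real (radius k) * \<zeta>)))
             \<le> max 1 (norm (a (of_real (radius k) * \<zeta>)))"
            by (intro always_eventually allI max.mono order_refl shrink zd)
        qed simp
      qed
    qed
  qed
  show "mates a b"
  proof
    show "a holomorphic_on unit_disk" by (rule a_holo)
    show "b holomorphic_on unit_disk" by (rule b)
    show "a z \<noteq> 0" if "z \<in> unit_disk" for z
      using a_eq[OF that] c by (auto simp: outer_exp_def)
    show "norm (b z) \<le> 1" if "z \<in> unit_disk" for z
      using b(2) that by (force intro: less_imp_le)
    show "norm (a z) \<le> 1" if z: "z \<in> unit_disk" for z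
    proof (rule LIMSEQ_le_const2)
      have "(\<lambda>z. q n z * ?G z) \<in> H2" for n
        by (rule bounded_holomorphic_in_H2(1)[OF _ q(3)]) (intro holomorphic_intros q outer_exp_holomorphic intg)
      from hardy.evaluation_tendsto[OF this one_in_H2 q(4) z]
      have "(\<lambda>n. norm (q n z * ?G z * a z)) \<longlonglongrightarrow> norm (1 * a z)" by (intro tendsto_intros)
      then show "(\<lambda>n. norm (q n z * ?G z * a z)) \<longlonglongrightarrow> norm (a z)" by simp
      show "\<exists>N. \<forall>n\<ge>N. norm (q n z * ?G z * a z) \<le> 1" using qGa[OF z] by blast
    qed
    show "AE \<zeta> in circle_measure. (\<lambda>k. (norm (a (of_real (radius k) * \<zeta>)))\<^sup>2 + (norm (b (of_real (radius k) * \<zeta>)))\<^sup>2) \<longlonglongrightarrow> 1"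
      using rad
    proof eventually_elim
      case (elim \<zeta>)
      then obtain \<alpha> \<beta> where "(\<lambda>k. a (of_real (radius k) * \<zeta>)) \<longlonglongrightarrow> \<alpha>" "(\<lambda>k. b (of_real (radius k) * \<zeta>)) \<longlonglongrightarrow> \<beta>"
        and 1: "(norm \<alpha>)\<^sup>2 + (norm \<beta>)\<^sup>2 = 1" by blast
      then have "(\<lambda>k. (norm (a (of_real (radius k) * \<zeta>)))\<^sup>2 + (norm (b (of_real (radius k) * \<zeta>)))\<^sup>2) \<longlonglongrightarrow> (norm \<alpha>)\<^sup>2 + (norm \<beta>)\<^sup>2"
        by (intro tendsto_intros)
      then show ?case unfolding 1 .
    qed
    obtain p where p: "\<And>n::nat. p n holomorphic_on unit_disk" "\<And>n. \<exists>B. \<forall>z\<in>unit_disk. norm (p n z) \<le> B"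
      "\<And>n z. z \<in> unit_disk \<Longrightarrow> norm (p n z * outer_exp h z) \<le> 1"
      "(\<lambda>n. hnsq (\<lambda>z. p n z * outer_exp h z - 1)) \<longlonglongrightarrow> 0"
      using outer_exp_approximate_inverse[OF int] by blast
    have pH: "(\<lambda>z. p n z * outer_exp h z) \<in> H2" for n
      by (rule bounded_holomorphic_in_H2(1)[OF _ p(3)]) (intro holomorphic_intros p outer_exp_holomorphic int)
    have eq: "c * (p n z * outer_exp h z) = a z * p n z" if "z \<in> unit_disk" for n z
      using a_eq[OF that] by simp
    have "hnsq (\<lambda>z. a z * p n z - c) = hnsq (\<lambda>z. c * (p n z * outer_exp h z - 1))" for n
    proof -
      have "hip (\<lambda>z. c * (p n z * outer_exp h z - 1)) (\<lambda>z. c * (p n z * outer_exp h z - 1))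
          = hip (\<lambda>z. a z * p n z - c) (\<lambda>z. a z * p n z - c)"
        by (rule hip_cong) (auto simp: right_diff_distrib eq intro!: holomorphic_intros p outer_exp_holomorphic int)
      then show ?thesis by simp
    qed
    moreover have "hnsq (\<lambda>z. c * (p n z * outer_exp h z - 1)) = hnsq (\<lambda>z. p n z * outer_exp h z - 1)" for n
      using hardy.nsq_scale[OF H2_diff[OF pH one_in_H2], of c n] c by simp
    ultimately have "(\<lambda>n. hnsq (\<lambda>z. a z * p n z - c)) \<longlonglongrightarrow> 0" using p(4) by simp
    moreover have "norm (a z * p n z) \<le> 1" if "z \<in> unit_disk" for n z
      using p(3)[OF that, of n] c unfolding eq[OF that, symmetric] by (simp add: norm_mult)
    ultimately show "\<exists>c q. norm c = 1 \<and>
      (\<forall>n::nat. q n holomorphic_on unit_disk \<and> (\<exists>B. \<forall>z\<in>unit_disk. norm (q n z) \<le> B)) \<and>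
      (\<forall>n. \<forall>z\<in>unit_disk. norm (a z * q n z) \<le> 1) \<and>
      (\<lambda>n. hnsq (\<lambda>z. a z * q n z - c)) \<longlonglongrightarrow> 0"
      using p(1,2) c by (intro exI[of _ c] exI[of _ p]) blast
  qed
qed


section \<open>The de Branges-Rovnyak space of a pair of mates\<close>

context mates
begin

lemma a_mult_in_H2: "h \<in> H2 \<Longrightarrow> (\<lambda>z. a z * h z) \<in> H2"
  by (rule H2_multiplier(1)[OF a_holomorphic a_le_1])

lemma b_mult_in_H2: "h \<in> H2 \<Longrightarrow> (\<lambda>z. b z * h z) \<in> H2"
  by (rule H2_multiplier(1)[OF b_holomorphic b_le_1])

text \<open>
  Cyclicity multiplied by a bounded function \<open>p\<close>. The bound by \<open>hnsq p\<close> is what later allows a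
  functional to be estimated on multiples of \<open>a\<close> alone.
\<close>

lemma bounded_multiple_approximation:
  assumes p: "p holomorphic_on unit_disk" "\<And>z. z \<in> unit_disk \<Longrightarrow> norm (p z) \<le> M"
  shows "\<exists>c F. norm c = 1 \<and> (\<forall>n::nat. F n \<in> H2 \<and> hnsq (\<lambda>z. a z * F n z) \<le> hnsq p) \<and>
    (\<lambda>n. hnsq (\<lambda>z. a z * F n z - c * p z)) \<longlonglongrightarrow> 0"
proof -
  obtain c q where c: "norm c = 1"
    and q: "\<And>n::nat. q n holomorphic_on unit_disk" "\<And>n. \<exists>B. \<forall>z\<in>unit_disk. norm (q n z) \<le> B"
    and aq: "\<And>n z. z \<in> unit_disk \<Longrightarrow> norm (a z * q n z) \<le> 1"
    and lim: "(\<lambda>n. hnsq (\<lambda>z. a z * q n z - c)) \<longlonglongrightarrow> 0"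
    using cyclic by blast
  have aqh: "(\<lambda>z. a z * q n z) holomorphic_on unit_disk" for n
    by (intro holomorphic_intros a_holomorphic q)
  have pH: "p \<in> H2" by (rule bounded_holomorphic_in_H2(1)[OF p])
  have cH: "(\<lambda>_. c) \<in> H2" using H2_scale[OF one_in_H2, of c] by simp
  have "(\<lambda>z. q n z * p z) \<in> H2" for n
    using q(2)[of n] H2_multiplier(1)[OF q(1) _ pH] by blast
  moreover have "hnsq (\<lambda>z. a z * (q n z * p z)) \<le> hnsq p" for n
    using H2_multiplier(2)[OF aqh aq pH, of n] by (simp add: mult.assoc)
  moreover have "(\<lambda>n. hnsq (\<lambda>z. a z * (q n z * p z) - c * p z)) \<longlonglongrightarrow> 0"
    using multiplier_tendsto[OF p bounded_holomorphic_in_H2(1)[OF aqh aq] cH lim]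
    by (simp add: mult_ac)
  ultimately show ?thesis using c by (intro exI[of _ c] exI[of _ "\<lambda>n z. q n z * p z"]) blast
qed

lemma orthogonal_to_a_multiples:
  assumes g: "g \<in> H2" and orth: "\<And>h. h \<in> H2 \<Longrightarrow> hip g (\<lambda>z. a z * h z) = 0" and z: "z \<in> unit_disk"
  shows "g z = 0"
proof -
  have "taylor_coeff g k = 0" for k
  proof -
    have zk: "(\<lambda>z::complex. z ^ k) holomorphic_on unit_disk" "\<And>z::complex. z \<in> unit_disk \<Longrightarrow> norm (z ^ k) \<le> 1"
      by (auto intro!: holomorphic_intros simp: norm_power power_le_one)
    obtain c F where c: "norm c = 1" and F: "\<And>n::nat. F n \<in> H2"
      and lim: "(\<lambda>n. hnsq (\<lambda>z. a z * F n z - c * z ^ k)) \<longlonglongrightarrow> 0"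
      using bounded_multiple_approximation[OF zk] by blast
    have "(\<lambda>n. hip g (\<lambda>z. a z * F n z)) \<longlonglongrightarrow> hip g (\<lambda>z. c * z ^ k)"
      by (rule hardy.ip_tendsto_right[OF a_mult_in_H2[OF F] H2_scale[OF power_in_H2] g lim])
    then have "hip g (\<lambda>z. c * z ^ k) = 0" using orth[OF F] by (simp add: LIMSEQ_const_iff)
    then show ?thesis using c by (auto simp: hardy.ip_scale_right[OF power_in_H2 g] hip_power)
  qed
  then show ?thesis using taylor_sums[OF H2_holomorphic[OF g] z] by (simp add: sums_iff)
qed

text \<open>
  In terms of Toeplitz operators, \<open>partner f g\<close> says that the co-analytic Toeplitz operator of \<open>b\<close>
  takes the same value at \<open>f\<close> as that of \<open>a\<close> at \<open>g\<close>.  Both adjoints are multiplication operators,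
  which is how the equation is expressed here.
\<close>

definition partner :: "(complex \<Rightarrow> complex) \<Rightarrow> (complex \<Rightarrow> complex) \<Rightarrow> bool" where
  "partner f g \<longleftrightarrow> f \<in> H2 \<and> g \<in> H2 \<and> (\<forall>h\<in>H2. hip f (\<lambda>z. b z * h z) = hip g (\<lambda>z. a z * h z))"

definition partner_of :: "(complex \<Rightarrow> complex) \<Rightarrow> (complex \<Rightarrow> complex)" where
  "partner_of f = (SOME g. partner f g)"

definition dBR :: "(complex \<Rightarrow> complex) set" where
  "dBR = {f. \<exists>g. partner f g}"

text \<open>
  The choice in \<open>partner_of\<close> does not affect the inner product, because partners are unique on the disk
  (\<open>partner_unique\<close>).
\<close>

definition dBR_ip :: "(complex \<Rightarrow> complex) \<Rightarrow> (complex \<Rightarrow> complex) \<Rightarrow> complex" where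
  "dBR_ip f h = hip f h + hip (partner_of f) (partner_of h)"

lemma partner_of: "f \<in> dBR \<Longrightarrow> partner f (partner_of f)"
  using someI_ex[of "partner f"] by (simp add: dBR_def partner_of_def)

lemma partner_add: "partner f g \<Longrightarrow> partner f' g' \<Longrightarrow> partner (\<lambda>z. f z + f' z) (\<lambda>z. g z + g' z)"
  by (simp add: partner_def H2_add hardy.ip_add a_mult_in_H2 b_mult_in_H2)

lemma partner_scale: "partner f g \<Longrightarrow> partner (\<lambda>z. c * f z) (\<lambda>z. c * g z)"
  by (simp add: partner_def H2_scale hardy.ip_scale a_mult_in_H2 b_mult_in_H2)

lemma partner_diff: "partner f g \<Longrightarrow> partner f' g' \<Longrightarrow> partner (\<lambda>z. f z - f' z) (\<lambda>z. g z - g' z)"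
  by (simp add: partner_def H2_diff hardy.ip_diff a_mult_in_H2 b_mult_in_H2)

lemma partner_cong:
  assumes "partner f g" "\<And>z. z \<in> unit_disk \<Longrightarrow> f' z = f z"
  shows "partner f' g"
proof -
  have "f' \<in> H2" using assms by (auto simp: partner_def intro: H2_eqI)
  moreover have "hip f' (\<lambda>z. b z * h z) = hip f (\<lambda>z. b z * h z)" if "h \<in> H2" for h
    using assms that calculation b_mult_in_H2[OF that] by (intro hip_cong H2_holomorphic) auto
  ultimately show ?thesis using assms(1) by (simp add: partner_def)
qed

lemma partner_unique:
  assumes "partner f g" "partner f g'" "z \<in> unit_disk"
  shows "g z = g' z"
proof -
  have "g z - g' z = 0"
    by (rule orthogonal_to_a_multiples[OF _ _ assms(3), of "\<lambda>z. g z - g' z"])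
       (use assms(1,2) in \<open>auto simp: partner_def H2_diff hardy.ip_diff a_mult_in_H2\<close>)
  then show ?thesis by simp
qed

lemma dBR_ip_eq:
  assumes "partner f g" "partner f' g'"
  shows "dBR_ip f f' = hip f f' + hip g g'"
proof -
  have p: "partner f (partner_of f)" "partner f' (partner_of f')"
    using assms by (auto intro!: partner_of simp: dBR_def)
  have "hip (partner_of f) (partner_of f') = hip g g'"
    using p partner_unique[OF p(1) assms(1)] partner_unique[OF p(2) assms(2)]
    by (intro hip_cong) (auto simp: partner_def H2_holomorphic)
  then show ?thesis by (simp add: dBR_ip_def)
qed

lemma partnerI_powers:
  assumes f: "f \<in> H2" and g: "g \<in> H2"
    and eq: "\<And>k. hip f (\<lambda>z. b z * z ^ k) = hip g (\<lambda>z. a z * z ^ k)"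
  shows "partner f g"
  unfolding partner_def
proof (intro conjI ballI f g)
  let ?L = "\<lambda>h. hip f (\<lambda>z. b z * h z) - hip g (\<lambda>z. a z * h z)"
  fix h assume h: "h \<in> H2"
  have "?L h = 0"
  proof (rule H2_functional_eq_0[OF _ _ _ _ h, of ?L])
    fix h h' assume "h \<in> H2" "h' \<in> H2"
    note mem = this[THEN a_mult_in_H2] this[THEN b_mult_in_H2]
    show "?L (\<lambda>z. h z + h' z) = ?L h + ?L h'"
      unfolding ring_distribs hardy.ip_add_right[OF mem(3,4) f] hardy.ip_add_right[OF mem(1,2) g] by simp
  next
    fix c h assume "h \<in> H2"
    note mem = this[THEN a_mult_in_H2] this[THEN b_mult_in_H2]
    show "?L (\<lambda>z. c * h z) = cnj c * ?L h"
      unfolding mult.left_commute[of _ c] hardy.ip_scale_right[OF mem(2) f] hardy.ip_scale_right[OF mem(1) g]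
      by (simp add: right_diff_distrib)
  next
    fix F h assume Fh: "\<And>n::nat. F n \<in> H2" "h \<in> H2" "(\<lambda>n. hnsq (\<lambda>z. F n z - h z)) \<longlonglongrightarrow> 0"
    show "(\<lambda>n. ?L (F n)) \<longlonglongrightarrow> ?L h"
      by (intro tendsto_diff hardy.ip_tendsto_right f g a_mult_in_H2 b_mult_in_H2 Fh(1,2)
          multiplier_tendsto[OF a_holomorphic a_le_1 Fh] multiplier_tendsto[OF b_holomorphic b_le_1 Fh])
  next
    show "?L (\<lambda>z. z ^ k) = 0" for k using eq by simp
  qed
  then show "hip f (\<lambda>z. b z * h z) = hip g (\<lambda>z. a z * h z)" by simp
qed

text \<open>
  The identity \<open>norm a ^ 2 + norm b ^ 2 = 1\<close> on the circle, tested against a Szego kernel and a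
  monomial.  Both are bounded, so dominated convergence applies.
\<close>

lemma mate_isometry:
  assumes w: "w \<in> unit_disk"
  shows "hip (\<lambda>z. b z * szego w z) (\<lambda>z. b z * z ^ k) + hip (\<lambda>z. a z * szego w z) (\<lambda>z. a z * z ^ k)
    = hip (szego w) (\<lambda>z. z ^ k)"
proof -
  let ?z = "\<lambda>n \<zeta>. of_real (radius n) * \<zeta> :: complex"
  let ?I = "\<lambda>f g n. LINT \<zeta>|circle_measure. f (?z n \<zeta>) * cnj (g (?z n \<zeta>))"
  let ?u = "\<lambda>n \<zeta>. (norm (a (?z n \<zeta>)))\<^sup>2 + (norm (b (?z n \<zeta>)))\<^sup>2"
  let ?s = "\<lambda>n \<zeta>. complex_of_real (?u n \<zeta> - 1) * (szego w (?z n \<zeta>) * cnj (?z n \<zeta> ^ k))"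
  let ?B = "1 / (1 - norm w)"
  note mem = szego_in_H2[OF w] power_in_H2[of k]
  have sz: "norm (szego w z * cnj (z ^ k)) \<le> ?B" if "z \<in> unit_disk" for z
  proof -
    have "1 - norm w \<le> 1 - norm (cnj w * z)"
      using that mult_left_mono[of "norm z" 1 "norm w"] by (simp add: norm_mult)
    also have "\<dots> \<le> norm (1 - cnj w * z)" using norm_triangle_ineq2[of 1 "cnj w * z"] by simp
    finally have "norm (szego w z) \<le> ?B"
      using w by (simp add: szego_def norm_divide frac_le)
    moreover have "norm (z ^ k) \<le> 1" using that by (simp add: norm_power power_le_one)
    ultimately have "norm (szego w z) * norm (z ^ k) \<le> ?B * 1"
      using w by (intro mult_mono) auto
    then show ?thesis by (simp only: norm_mult complex_mod_cnj)
  qed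
  have zd: "?z n \<zeta> \<in> unit_disk" if "\<zeta> \<in> sphere 0 1" for n \<zeta>
    using that radius(1,2)[of n] by (simp add: norm_mult)
  have cont: "continuous_on (sphere 0 1) (\<lambda>\<zeta>. f (?z n \<zeta>))" if "f \<in> H2" for f n
    by (rule continuous_on_circle_dilate[OF H2_holomorphic[OF that] radius(1,2)])
  have int: "integrable circle_measure (\<lambda>\<zeta>. f (?z n \<zeta>) * cnj (g (?z n \<zeta>)))" if "f \<in> H2" "g \<in> H2" for f g n
    by (intro integrable_circle_continuous continuous_intros cont that)
  have "(\<lambda>n. ?I (\<lambda>z. b z * szego w z) (\<lambda>z. b z * z ^ k) n + ?I (\<lambda>z. a z * szego w z) (\<lambda>z. a z * z ^ k) n
       - ?I (szego w) (\<lambda>z. z ^ k) n)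
     \<longlonglongrightarrow> hip (\<lambda>z. b z * szego w z) (\<lambda>z. b z * z ^ k) + hip (\<lambda>z. a z * szego w z) (\<lambda>z. a z * z ^ k)
        - hip (szego w) (\<lambda>z. z ^ k)"
    by (intro tendsto_add tendsto_diff hip_eq_lim_integral a_mult_in_H2 b_mult_in_H2 mem)
  also have "(\<lambda>n. ?I (\<lambda>z. b z * szego w z) (\<lambda>z. b z * z ^ k) n + ?I (\<lambda>z. a z * szego w z) (\<lambda>z. a z * z ^ k) n
       - ?I (szego w) (\<lambda>z. z ^ k) n) = (\<lambda>n. LINT \<zeta>|circle_measure. ?s n \<zeta>)"
  proof
    fix n
    have pt: "?s n \<zeta> = b (?z n \<zeta>) * szego w (?z n \<zeta>) * cnj (b (?z n \<zeta>) * ?z n \<zeta> ^ k)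
       + a (?z n \<zeta>) * szego w (?z n \<zeta>) * cnj (a (?z n \<zeta>) * ?z n \<zeta> ^ k) - szego w (?z n \<zeta>) * cnj (?z n \<zeta> ^ k)" for \<zeta>
      unfolding of_real_diff of_real_add complex_norm_square complex_cnj_mult of_real_1 by (simp only: ring_distribs mult_ac add_ac mult_1_left)
    show "?I (\<lambda>z. b z * szego w z) (\<lambda>z. b z * z ^ k) n + ?I (\<lambda>z. a z * szego w z) (\<lambda>z. a z * z ^ k) n
       - ?I (szego w) (\<lambda>z. z ^ k) n = (LINT \<zeta>|circle_measure. ?s n \<zeta>)"
      unfolding pt
      using int[OF b_mult_in_H2 b_mult_in_H2, OF mem, of n] int[OF a_mult_in_H2 a_mult_in_H2, OF mem, of n] int[OF mem, of n]
      by simp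
  qed
  finally have lim: "(\<lambda>n. LINT \<zeta>|circle_measure. ?s n \<zeta>) \<longlonglongrightarrow>
     hip (\<lambda>z. b z * szego w z) (\<lambda>z. b z * z ^ k) + hip (\<lambda>z. a z * szego w z) (\<lambda>z. a z * z ^ k)
        - hip (szego w) (\<lambda>z. z ^ k)" .
  have "(\<lambda>n. LINT \<zeta>|circle_measure. ?s n \<zeta>) \<longlonglongrightarrow> (LINT \<zeta>|circle_measure. 0)"
  proof (rule integral_dominated_convergence[where w = "\<lambda>_. 3 * ?B"])
    show "AE \<zeta> in circle_measure. (\<lambda>n. ?s n \<zeta>) \<longlonglongrightarrow> 0"
      using radial AE_space
    proof eventually_elim
      case (elim \<zeta>)
      have z: "?z n \<zeta> \<in> unit_disk" for n using zd elim(2) by simp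
      show ?case
      proof (rule Lim_null_comparison)
        have "norm (?s n \<zeta>) = \<bar>?u n \<zeta> - 1\<bar> * norm (szego w (?z n \<zeta>) * cnj (?z n \<zeta> ^ k))" for n
          by (simp only: norm_mult norm_of_real)
        also have "\<dots> n \<le> \<bar>?u n \<zeta> - 1\<bar> * ?B" for n by (rule mult_left_mono[OF sz[OF z]]) simp
        finally show "\<forall>\<^sub>F n in sequentially. norm (?s n \<zeta>) \<le> \<bar>?u n \<zeta> - 1\<bar> * ?B"
          by (intro always_eventually allI)
        have "(\<lambda>n. \<bar>?u n \<zeta> - 1\<bar> * ?B) \<longlonglongrightarrow> \<bar>1 - 1\<bar> * ?B" by (intro tendsto_intros elim(1))
        then show "(\<lambda>n. \<bar>?u n \<zeta> - 1\<bar> * ?B) \<longlonglongrightarrow> 0" by simp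
      qed
    qed
    show "AE \<zeta> in circle_measure. norm (?s n \<zeta>) \<le> 3 * ?B" for n
    proof (rule AE_I2)
      fix \<zeta> :: complex assume "\<zeta> \<in> space circle_measure"
      then have z: "?z n \<zeta> \<in> unit_disk" using zd by simp
      have "(norm (a (?z n \<zeta>)))\<^sup>2 \<le> 1" "(norm (b (?z n \<zeta>)))\<^sup>2 \<le> 1"
        using a_le_1[OF z] b_le_1[OF z] by (simp_all add: power_le_one)
      moreover have "0 \<le> (norm (a (?z n \<zeta>)))\<^sup>2" "0 \<le> (norm (b (?z n \<zeta>)))\<^sup>2" by simp_all
      ultimately have "\<bar>?u n \<zeta> - 1\<bar> \<le> 3" by linarith
      then have "\<bar>?u n \<zeta> - 1\<bar> * norm (szego w (?z n \<zeta>) * cnj (?z n \<zeta> ^ k)) \<le> 3 * ?B"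
        by (intro mult_mono sz z) auto
      then show "norm (?s n \<zeta>) \<le> 3 * ?B" by (simp only: norm_mult norm_of_real)
    qed
    show "?s n \<in> borel_measurable circle_measure" for n
    proof -
      have "continuous_on (sphere 0 1) (\<lambda>\<zeta>. a (?z n \<zeta>))" "continuous_on (sphere 0 1) (\<lambda>\<zeta>. b (?z n \<zeta>))"
        by (rule continuous_on_circle_dilate[OF a_holomorphic radius(1,2)] continuous_on_circle_dilate[OF b_holomorphic radius(1,2)])+
      with cont[OF szego_in_H2[OF w]] show ?thesis
        by (intro borel_measurable_circle_continuous continuous_intros) auto
    qed
  qed auto
  with lim have "hip (\<lambda>z. b z * szego w z) (\<lambda>z. b z * z ^ k) + hip (\<lambda>z. a z * szego w z) (\<lambda>z. a z * z ^ k)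
        - hip (szego w) (\<lambda>z. z ^ k) = 0"
    using LIMSEQ_unique by fastforce
  then show ?thesis by simp
qed

lemma dBR_kernel_eq: "dBR_kernel b w = (\<lambda>z. szego w z - cnj (b w) * (b z * szego w z))"
  by (auto simp: dBR_kernel_def szego_def diff_divide_distrib)

lemma hip_szego_left: "f \<in> H2 \<Longrightarrow> w \<in> unit_disk \<Longrightarrow> hip (szego w) f = cnj (f w)"
  using hardy.ip_cnj[of f "szego w"] by (simp add: szego_in_H2 hardy.reproducing)

text \<open>
  Test the kernel on \<open>b * z ^ k\<close>. By \<open>mate_isometry\<close> its second summand \<open>cnj (b w) * (b * szego w)\<close> cancels
  the contribution of \<open>szego w\<close> up to an inner product of two multiples of \<open>a\<close>.
\<close>

lemma partner_kernel:
  assumes w: "w \<in> unit_disk"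
  shows "partner (dBR_kernel b w) (\<lambda>z. cnj (b w) * (a z * szego w z))"
proof (rule partnerI_powers)
  note s = szego_in_H2[OF w]
  note as = a_mult_in_H2[OF s] and bs = b_mult_in_H2[OF s]
  show "dBR_kernel b w \<in> H2" unfolding dBR_kernel_eq by (intro H2_diff H2_scale s bs)
  show "(\<lambda>z. cnj (b w) * (a z * szego w z)) \<in> H2" by (intro H2_scale as)
  fix k
  note ak = a_mult_in_H2[OF power_in_H2[of k]] and bk = b_mult_in_H2[OF power_in_H2[of k]]
  have "hip (dBR_kernel b w) (\<lambda>z. b z * z ^ k)
     = hip (szego w) (\<lambda>z. b z * z ^ k) - cnj (b w) * hip (\<lambda>z. b z * szego w z) (\<lambda>z. b z * z ^ k)"
    unfolding dBR_kernel_eq using s bs bk by (simp add: hardy.ip_diff hardy.ip_scale H2_scale)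
  also have "hip (\<lambda>z. b z * szego w z) (\<lambda>z. b z * z ^ k)
     = cnj (w ^ k) - hip (\<lambda>z. a z * szego w z) (\<lambda>z. a z * z ^ k)"
    using mate_isometry[OF w, of k] hip_szego_left[OF power_in_H2 w] by (simp add: algebra_simps)
  also have "hip (szego w) (\<lambda>z. b z * z ^ k) = cnj (b w * w ^ k)"
    by (rule hip_szego_left[OF bk w])
  finally show "hip (dBR_kernel b w) (\<lambda>z. b z * z ^ k) = hip (\<lambda>z. cnj (b w) * (a z * szego w z)) (\<lambda>z. a z * z ^ k)"
    unfolding hardy.ip_scale[OF as ak] by (simp add: algebra_simps)
qed

lemma partner_limit:
  assumes "\<And>n::nat. partner (F n) (G n)" "f \<in> H2" "g \<in> H2"
    and "(\<lambda>n. hnsq (\<lambda>z. F n z - f z)) \<longlonglongrightarrow> 0" "(\<lambda>n. hnsq (\<lambda>z. G n z - g z)) \<longlonglongrightarrow> 0"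
  shows "partner f g"
  unfolding partner_def
proof (intro conjI ballI assms(2,3))
  fix h assume h: "h \<in> H2"
  have F: "F n \<in> H2" and G: "G n \<in> H2" and eq: "hip (F n) (\<lambda>z. b z * h z) = hip (G n) (\<lambda>z. a z * h z)" for n
    using assms(1) h by (auto simp: partner_def)
  show "hip f (\<lambda>z. b z * h z) = hip g (\<lambda>z. a z * h z)"
    using hardy.ip_tendsto[OF F assms(2) b_mult_in_H2[OF h] assms(4)]
      hardy.ip_tendsto[OF G assms(3) a_mult_in_H2[OF h] assms(5)]
    unfolding eq by (rule LIMSEQ_unique)
qed

lemma dBR_complete:
  assumes F: "\<And>n::nat. F n \<in> dBR"
    and cauchy: "\<And>e. e > 0 \<Longrightarrow> \<exists>N. \<forall>m\<ge>N. \<forall>n\<ge>N. Re (dBR_ip (\<lambda>x. F m x - F n x) (\<lambda>x. F m x - F n x)) < e"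
  shows "\<exists>f\<in>dBR. (\<lambda>n. Re (dBR_ip (\<lambda>x. F n x - f x) (\<lambda>x. F n x - f x))) \<longlonglongrightarrow> 0"
proof -
  let ?G = "\<lambda>n. partner_of (F n)"
  note P = partner_of[OF F]
  have mem: "F n \<in> H2" "?G n \<in> H2" for n using P by (auto simp: partner_def)
  have ip: "Re (dBR_ip (\<lambda>x. F m x - F n x) (\<lambda>x. F m x - F n x))
     = hnsq (\<lambda>x. F m x - F n x) + hnsq (\<lambda>x. ?G m x - ?G n x)" for m n
    using dBR_ip_eq[OF partner_diff[OF P P] partner_diff[OF P P]] by simp
  have nn: "0 \<le> hnsq (\<lambda>x. F m x - F n x)" "0 \<le> hnsq (\<lambda>x. ?G m x - ?G n x)" for m n
    by (intro hardy.ip_nonneg H2_diff mem)+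
  have "\<exists>N. \<forall>m\<ge>N. \<forall>n\<ge>N. hnsq (\<lambda>x. F m x - F n x) < e \<and> hnsq (\<lambda>x. ?G m x - ?G n x) < e" if e: "e > 0" for e
  proof -
    obtain N where N: "\<forall>m\<ge>N. \<forall>n\<ge>N. hnsq (\<lambda>x. F m x - F n x) + hnsq (\<lambda>x. ?G m x - ?G n x) < e"
      using cauchy[OF e] unfolding ip by blast
    show ?thesis
    proof (intro exI[of _ N] allI impI)
      fix m n assume "N \<le> m" "N \<le> n"
      then show "hnsq (\<lambda>x. F m x - F n x) < e \<and> hnsq (\<lambda>x. ?G m x - ?G n x) < e"
        using N[rule_format, of m n] nn[of m n] by linarith
    qed
  qed
  then have c1: "\<And>e. e > 0 \<Longrightarrow> \<exists>N. \<forall>m\<ge>N. \<forall>n\<ge>N. hnsq (\<lambda>x. F m x - F n x) < e"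
    and c2: "\<And>e. e > 0 \<Longrightarrow> \<exists>N. \<forall>m\<ge>N. \<forall>n\<ge>N. hnsq (\<lambda>x. ?G m x - ?G n x) < e"
    by meson+
  obtain f where f: "f \<in> H2" "(\<lambda>n. hnsq (\<lambda>x. F n x - f x)) \<longlonglongrightarrow> 0"
    using H2_complete[OF mem(1) c1] by blast
  obtain g where g: "g \<in> H2" "(\<lambda>n. hnsq (\<lambda>x. ?G n x - g x)) \<longlonglongrightarrow> 0"
    using H2_complete[OF mem(2) c2] by blast
  have fg: "partner f g" by (rule partner_limit[OF P f(1) g(1) f(2) g(2)])
  have "Re (dBR_ip (\<lambda>x. F n x - f x) (\<lambda>x. F n x - f x)) = hnsq (\<lambda>x. F n x - f x) + hnsq (\<lambda>x. ?G n x - g x)" for n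
    using dBR_ip_eq[OF partner_diff[OF P fg] partner_diff[OF P fg]] by simp
  then have "(\<lambda>n. Re (dBR_ip (\<lambda>x. F n x - f x) (\<lambda>x. F n x - f x))) \<longlonglongrightarrow> 0"
    using tendsto_add[OF f(2) g(2)] by simp
  then show ?thesis using fg by (auto simp: dBR_def)
qed

lemma partner_zero: "partner (\<lambda>_. 0) (\<lambda>_. 0)"
  using partner_scale[OF partner_kernel[of 0], of 0] by simp

lemma dBR_rkhs: "rkhs unit_disk dBR dBR_ip (dBR_kernel b)"
proof
  show "(\<lambda>_. 0) \<in> dBR" using partner_zero by (auto simp: dBR_def)
  fix f g assume fg: "f \<in> dBR" "g \<in> dBR"
  note P = partner_of[OF fg(1)] and Q = partner_of[OF fg(2)]
  have mem: "f \<in> H2" "partner_of f \<in> H2" "g \<in> H2" "partner_of g \<in> H2" using P Q by (auto simp: partner_def)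
  show "(\<lambda>x. f x + g x) \<in> dBR" using partner_add[OF P Q] by (auto simp: dBR_def)
  show "dBR_ip (\<lambda>x. c * f x) g = c * dBR_ip f g" for c
    unfolding dBR_ip_eq[OF partner_scale[OF P] Q] dBR_ip_eq[OF P Q]
    using mem by (simp add: hardy.ip_scale ring_distribs)
  show "dBR_ip g f = cnj (dBR_ip f g)"
    unfolding dBR_ip_eq[OF Q P] dBR_ip_eq[OF P Q]
    using hardy.ip_cnj[OF mem(1,3)] hardy.ip_cnj[OF mem(2,4)] by simp
  show "dBR_ip (\<lambda>x. f x + g x) h = dBR_ip f h + dBR_ip g h" if h: "h \<in> dBR" for h
  proof -
    note R = partner_of[OF h]
    have "h \<in> H2" "partner_of h \<in> H2" using R by (auto simp: partner_def)
    then show ?thesis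
      unfolding dBR_ip_eq[OF partner_add[OF P Q] R] dBR_ip_eq[OF P R] dBR_ip_eq[OF Q R]
      using mem by (simp add: hardy.ip_add)
  qed
next
  fix f assume f: "f \<in> dBR"
  note P = partner_of[OF f]
  have mem: "f \<in> H2" "partner_of f \<in> H2" using P by (auto simp: partner_def)
  show "(\<lambda>x. c * f x) \<in> dBR" for c using partner_scale[OF P] by (auto simp: dBR_def)
  show "g \<in> dBR" if "\<And>x. x \<in> unit_disk \<Longrightarrow> g x = f x" for g
    using partner_cong[OF P that] by (auto simp: dBR_def)
  have nn: "0 \<le> hnsq f" "0 \<le> hnsq (partner_of f)" using mem hardy.ip_nonneg by auto
  show "0 \<le> Re (dBR_ip f f)" unfolding dBR_ip_eq[OF P P] using nn by simp
  show "(dBR_ip f f = 0) = (\<forall>x\<in>unit_disk. f x = 0)"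
  proof
    assume "dBR_ip f f = 0"
    then have "hnsq f + hnsq (partner_of f) = 0"
      unfolding dBR_ip_eq[OF P P] by (simp flip: plus_complex.sel)
    then have "hnsq f = 0" using nn by linarith
    then have "hip f f = 0" using hardy.ip_self[OF mem(1)] by simp
    then show "\<forall>x\<in>unit_disk. f x = 0" using hardy.ip_eq_0_iff[OF mem(1)] by simp
  next
    assume z: "\<forall>x\<in>unit_disk. f x = 0"
    then have "partner f (\<lambda>_. 0)" using partner_cong[OF partner_zero, of f] by simp
    from dBR_ip_eq[OF this this] have "dBR_ip f f = hip f f + hip (\<lambda>_. 0) (\<lambda>_. 0)" .
    moreover have "hip f f = 0" using hardy.ip_eq_0_iff[OF mem(1)] z by simp
    ultimately show "dBR_ip f f = 0" using hardy.ip_zero_left[OF hardy.zero_mem] by simp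
  qed
  fix w :: complex assume w: "w \<in> unit_disk"
  note s = szego_in_H2[OF w]
  note K = partner_kernel[OF w]
  have "dBR_ip f (dBR_kernel b w) = hip f (dBR_kernel b w) + hip (partner_of f) (\<lambda>z. cnj (b w) * (a z * szego w z))"
    by (rule dBR_ip_eq[OF P K])
  also have "hip f (dBR_kernel b w) = f w - b w * hip f (\<lambda>z. b z * szego w z)"
    unfolding dBR_kernel_eq using mem s b_mult_in_H2[OF s] hardy.reproducing[OF mem(1) w]
    by (simp add: hardy.ip_diff_right hardy.ip_scale_right H2_scale)
  also have "hip (partner_of f) (\<lambda>z. cnj (b w) * (a z * szego w z)) = b w * hip (partner_of f) (\<lambda>z. a z * szego w z)"
    using mem a_mult_in_H2[OF s] by (simp add: hardy.ip_scale_right)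
  also have "hip (partner_of f) (\<lambda>z. a z * szego w z) = hip f (\<lambda>z. b z * szego w z)"
    using P s by (simp add: partner_def)
  finally show "dBR_ip f (dBR_kernel b w) = f w" by simp
next
  fix w :: complex assume "w \<in> unit_disk"
  from partner_kernel[OF this] show "dBR_kernel b w \<in> dBR" by (auto simp: dBR_def)
qed (use dBR_complete in blast)

theorem dBR_space_eq: "dBR_space b = dBR"
  by (rule dBR_space_eqI[OF dBR_rkhs]) (auto simp: dBR_def partner_def H2_holomorphic)

end


section \<open>Bessel's inequality and bounded Hankel forms\<close>

lemma bessel_circle:
  assumes v: "v \<in> borel_measurable circle_measure" and B: "AE \<zeta> in circle_measure. norm (v \<zeta>) \<le> B"
  shows "(\<Sum>k<K. (norm (LINT \<zeta>|circle_measure. v \<zeta> * cnj \<zeta> ^ k))\<^sup>2) \<le> (LINT \<zeta>|circle_measure. (norm (v \<zeta>))\<^sup>2)"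
proof -
  let ?c = "\<lambda>k. LINT \<zeta>|circle_measure. v \<zeta> * cnj \<zeta> ^ k"
  let ?S = "\<Sum>k<K. (norm (?c k))\<^sup>2"
  define s where "s = (\<lambda>\<zeta>. \<Sum>k<K. ?c k * \<zeta> ^ k)"
  have cs: "continuous_on (sphere 0 1) s" unfolding s_def by (intro continuous_intros)
  have int: "integrable circle_measure (\<lambda>\<zeta>. g \<zeta> * k \<zeta>)" if "integrable circle_measure g" "continuous_on (sphere 0 1) k" for g k :: "complex \<Rightarrow> complex"
    using integrable_circle_continuous_mult[OF that(2,1)] by (simp add: mult.commute)
  have iv: "integrable circle_measure v" by (rule integrable_circle_bounded[OF v B])
  have int_s: "integrable circle_measure s" by (rule integrable_circle_continuous[OF cs])
  have pair: "(LINT \<zeta>|circle_measure. g \<zeta> * cnj (s \<zeta>)) = of_real ?S"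
    if g: "integrable circle_measure g" and gc: "\<And>k. k < K \<Longrightarrow> (LINT \<zeta>|circle_measure. g \<zeta> * cnj \<zeta> ^ k) = ?c k" for g
  proof -
    have ik: "integrable circle_measure (\<lambda>\<zeta>. g \<zeta> * cnj \<zeta> ^ k)" for k
      by (intro int g continuous_intros)
    have "(LINT \<zeta>|circle_measure. g \<zeta> * cnj (s \<zeta>)) = (LINT \<zeta>|circle_measure. (\<Sum>k<K. cnj (?c k) * (g \<zeta> * cnj \<zeta> ^ k)))"
      by (simp add: s_def sum_distrib_left mult_ac)
    also have "\<dots> = (\<Sum>k<K. cnj (?c k) * (LINT \<zeta>|circle_measure. g \<zeta> * cnj \<zeta> ^ k))"
      using ik by simp
    also have "\<dots> = (\<Sum>k<K. of_real ((norm (?c k))\<^sup>2))"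
      by (intro sum.cong refl) (simp only: gc lessThan_iff complex_norm_square mult.commute)
    finally show ?thesis by simp
  qed
  have "(LINT \<zeta>|circle_measure. s \<zeta> * cnj \<zeta> ^ k) = ?c k" if "k < K" for k
  proof -
    have "(LINT \<zeta>|circle_measure. s \<zeta> * cnj \<zeta> ^ k) = (LINT \<zeta>|circle_measure. (\<Sum>j<K. ?c j * (\<zeta> ^ j * cnj \<zeta> ^ k)))"
      unfolding s_def sum_distrib_right by (simp only: mult_ac)
    also have "\<dots> = (\<Sum>j<K. ?c j * (LINT \<zeta>|circle_measure. \<zeta> ^ j * cnj \<zeta> ^ k))"
      by (subst Bochner_Integration.integral_sum) (auto intro!: integrable_circle_continuous continuous_intros)
    also have "\<dots> = ?c k"
      using that by (simp add: integral_circle_power_cnj_power if_distrib[of "(*) x" for x] cong: if_cong)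
    finally show ?thesis .
  qed
  then have ss: "(LINT \<zeta>|circle_measure. s \<zeta> * cnj (s \<zeta>)) = of_real ?S" by (rule pair[OF int_s])
  have vs: "(LINT \<zeta>|circle_measure. v \<zeta> * cnj (s \<zeta>)) = of_real ?S" by (rule pair[OF iv refl])
  have v2: "integrable circle_measure (\<lambda>\<zeta>. (norm (v \<zeta>))\<^sup>2)"
    by (rule integrable_circle_bounded[where B = "B\<^sup>2"])
       (use v B in \<open>auto elim!: eventually_mono intro: power_mono\<close>)
  have ivs: "integrable circle_measure (\<lambda>\<zeta>. v \<zeta> * cnj (s \<zeta>))" "integrable circle_measure (\<lambda>\<zeta>. s \<zeta> * cnj (s \<zeta>))"
    by (intro int iv int_s continuous_intros cs)+
  define p q where "p = (\<lambda>\<zeta>. Re (v \<zeta> * cnj (s \<zeta>)))" and "q = (\<lambda>\<zeta>. Re (s \<zeta> * cnj (s \<zeta>)))"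
  have ipq: "integrable circle_measure p" "integrable circle_measure q"
    unfolding p_def q_def by (intro integrable_Re ivs)+
  have pq: "integral\<^sup>L circle_measure p = ?S" "integral\<^sup>L circle_measure q = ?S"
    unfolding p_def q_def integral_Re[OF ivs(1)] integral_Re[OF ivs(2)] vs ss by (rule Re_complex_of_real)+
  have pt: "(norm (v \<zeta> - s \<zeta>))\<^sup>2 = (norm (v \<zeta>))\<^sup>2 - 2 * p \<zeta> + q \<zeta>" for \<zeta>
    unfolding cmod_power2 p_def q_def by (simp add: power2_eq_square algebra_simps)
  have "0 \<le> (LINT \<zeta>|circle_measure. (norm (v \<zeta> - s \<zeta>))\<^sup>2)" by simp
  also have "\<dots> = (LINT \<zeta>|circle_measure. (norm (v \<zeta>))\<^sup>2) - 2 * ?S + ?S"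
    unfolding pt using v2 ipq by (simp add: pq)
  finally show ?thesis by simp
qed

text \<open>
  The functions \<open>u n\<close> play the role of a bounded function on the circle whose projection is \<open>f\<close>. Letting
  them vary with the radius covers bounded analytic \<open>f\<close> through their dilates, without
  boundary values. The sum on the left consists of Fourier coefficients of \<open>u * cnj P\<close>, up to
  the dilation.
\<close>

lemma hankel_form_bound:
  assumes u: "\<And>n::nat. u n \<in> borel_measurable circle_measure" "\<And>n. AE \<zeta> in circle_measure. norm (u n \<zeta>) \<le> B"
    and lim: "\<And>Q. Q \<in> H2 \<Longrightarrow> (\<lambda>n. LINT \<zeta>|circle_measure. u n \<zeta> * cnj (Q (of_real (radius n) * \<zeta>))) \<longlonglongrightarrow> hip f Q"
    and P: "P \<in> H2"
  shows "(\<Sum>k<K. (norm (hip f (\<lambda>z. z ^ k * P z)))\<^sup>2) \<le> B\<^sup>2 * hnsq P"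
proof (rule LIMSEQ_le_const2)
  let ?z = "\<lambda>n \<zeta>. of_real (radius n) * \<zeta> :: complex"
  let ?I = "\<lambda>k n. LINT \<zeta>|circle_measure. u n \<zeta> * cnj (?z n \<zeta> ^ k * P (?z n \<zeta>))"
  show "(\<lambda>n. \<Sum>k<K. (norm (?I k n))\<^sup>2) \<longlonglongrightarrow> (\<Sum>k<K. (norm (hip f (\<lambda>z. z ^ k * P z)))\<^sup>2)"
    by (intro tendsto_intros lim[OF power_mult_in_H2[OF P]])
  have "(\<Sum>k<K. (norm (?I k n))\<^sup>2) \<le> B\<^sup>2 * hnsq P" for n
  proof -
    let ?v = "\<lambda>\<zeta>. u n \<zeta> * cnj (P (?z n \<zeta>))"
    have cP: "continuous_on (sphere 0 1) (\<lambda>\<zeta>. P (?z n \<zeta>))"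
      by (rule continuous_on_circle_dilate[OF H2_holomorphic[OF P] radius(1,2)])
    have "compact ((\<lambda>\<zeta>. P (?z n \<zeta>)) ` sphere 0 1)" using cP by (intro compact_continuous_image) auto
    then obtain D where D: "\<And>\<zeta>. \<zeta> \<in> sphere 0 1 \<Longrightarrow> norm (P (?z n \<zeta>)) \<le> D"
      using compact_imp_bounded[of "(\<lambda>\<zeta>. P (?z n \<zeta>)) ` sphere 0 1"] unfolding bounded_iff by blast
    have meas: "?v \<in> borel_measurable circle_measure"
      using u(1)[of n] borel_measurable_circle_continuous[OF continuous_on_cnj[OF cP]] by (rule borel_measurable_times)
    have bd: "AE \<zeta> in circle_measure. norm (?v \<zeta>) \<le> B * D"
      using u(2)[of n] AE_space
    proof eventually_elim
      case (elim \<zeta>)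
      then show ?case using D[of \<zeta>] norm_ge_zero[of "u n \<zeta>"]
        by (simp add: norm_mult mult_mono')
    qed
    have I: "?I k n = of_real (radius n ^ k) * (LINT \<zeta>|circle_measure. ?v \<zeta> * cnj \<zeta> ^ k)" for k
      by (subst integral_mult_right_zero[symmetric])
         (auto intro!: Bochner_Integration.integral_cong simp: power_mult_distrib mult_ac)
    have "(norm (?I k n))\<^sup>2 \<le> (norm (LINT \<zeta>|circle_measure. ?v \<zeta> * cnj \<zeta> ^ k))\<^sup>2" for k
      unfolding I norm_mult norm_of_real using radius(1,2)[of n]
      by (intro power_mono) (auto simp: mult_left_le_one_le power_le_one)
    then have "(\<Sum>k<K. (norm (?I k n))\<^sup>2) \<le> (\<Sum>k<K. (norm (LINT \<zeta>|circle_measure. ?v \<zeta> * cnj \<zeta> ^ k))\<^sup>2)"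
      by (intro sum_mono)
    also have "\<dots> \<le> (LINT \<zeta>|circle_measure. (norm (?v \<zeta>))\<^sup>2)" by (rule bessel_circle[OF meas bd])
    also have "\<dots> \<le> (LINT \<zeta>|circle_measure. B\<^sup>2 * (norm (P (?z n \<zeta>)))\<^sup>2)"
    proof (rule integral_mono_AE)
      show "integrable circle_measure (\<lambda>\<zeta>. (norm (?v \<zeta>))\<^sup>2)"
        by (rule integrable_circle_bounded[where B = "(B * D)\<^sup>2"])
           (use meas bd in \<open>auto elim!: eventually_mono intro: power_mono\<close>)
      show "integrable circle_measure (\<lambda>\<zeta>. B\<^sup>2 * (norm (P (?z n \<zeta>)))\<^sup>2)"
        by (intro integrable_circle_continuous continuous_intros cP)
      show "AE \<zeta> in circle_measure. (norm (?v \<zeta>))\<^sup>2 \<le> B\<^sup>2 * (norm (P (?z n \<zeta>)))\<^sup>2"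
        using u(2)[of n] by eventually_elim (auto simp: norm_mult power_mult_distrib intro!: mult_right_mono power_mono)
    qed
    also have "\<dots> \<le> B\<^sup>2 * hnsq P"
      using integral_norm_square_le[OF P radius(1,2)[of n]] by (simp add: mult_left_mono)
    finally show ?thesis .
  qed
  then show "\<exists>N. \<forall>n\<ge>N. (\<Sum>k<K. (norm (?I k n))\<^sup>2) \<le> B\<^sup>2 * hnsq P" by blast
qed

lemma hardy_inf_hankel_bound:
  assumes "f \<in> hardy_inf"
  shows "f \<in> H2 \<and> (\<exists>C. \<forall>P\<in>H2. \<forall>K. (\<Sum>k<K. (norm (hip f (\<lambda>z. z ^ k * P z)))\<^sup>2) \<le> C * hnsq P)"
proof -
  obtain B where f: "f holomorphic_on unit_disk" and B: "\<And>z. z \<in> unit_disk \<Longrightarrow> norm (f z) \<le> B"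
    using assms unfolding hardy_inf_def bounded_iff by blast
  note fH = bounded_holomorphic_in_H2(1)[OF f B]
  have "(\<Sum>k<K. (norm (hip f (\<lambda>z. z ^ k * P z)))\<^sup>2) \<le> B\<^sup>2 * hnsq P" if "P \<in> H2" for P K
  proof (rule hankel_form_bound[where u = "\<lambda>n \<zeta>. f (of_real (radius n) * \<zeta>)", OF _ _ hip_eq_lim_integral[OF fH] that])
    show "(\<lambda>\<zeta>. f (of_real (radius n) * \<zeta>)) \<in> borel_measurable circle_measure" for n
      by (intro borel_measurable_circle_continuous continuous_on_circle_dilate f radius)
    show "AE \<zeta> in circle_measure. norm (f (of_real (radius n) * \<zeta>)) \<le> B" for n
      using radius(1,2)[of n] by (intro AE_I2 B) (simp add: norm_mult)
  qed
  with fH show ?thesis by blast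
qed

lemma fourier_coeff_cnj_power:
  "fourier_coeff u (int n) = (LINT \<zeta>|circle_measure. u \<zeta> * cnj \<zeta> ^ n)"
  unfolding fourier_coeff_def
  by (intro Bochner_Integration.integral_cong refl) (simp add: cnj_power_on_circle)

lemma power_in_hardy2_circle: "(\<lambda>\<zeta>. \<zeta> ^ n) \<in> hardy2_circle"
proof -
  have "fourier_coeff (\<lambda>\<zeta>. \<zeta> ^ n) m = 0" if "m < 0" for m
  proof -
    have "fourier_coeff (\<lambda>\<zeta>. \<zeta> ^ n) m = (LINT \<zeta>|circle_measure. \<zeta> powi (int n - m))"
      unfolding fourier_coeff_def
    proof (rule Bochner_Integration.integral_cong[OF refl])
      fix \<zeta> :: complex assume "\<zeta> \<in> space circle_measure"
      then have "\<zeta> \<noteq> 0" by auto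
      then show "\<zeta> ^ n * \<zeta> powi (- m) = \<zeta> powi (int n - m)"
        using power_int_add[of \<zeta> "int n" "- m"] by simp
    qed
    then show ?thesis using that by (simp add: integral_circle_powi)
  qed
  then show ?thesis
    by (auto simp: hardy2_circle_def L2_circle_def intro!: borel_measurable_circle_continuous
        integrable_circle_continuous continuous_intros)
qed

lemma BMOA_hankel_bound:
  assumes "f \<in> BMOA"
  shows "f \<in> H2 \<and> (\<exists>C. \<forall>P\<in>H2. \<forall>K. (\<Sum>k<K. (norm (hip f (\<lambda>z. z ^ k * P z)))\<^sup>2) \<le> C * hnsq P)"
proof -
  obtain u v B where u: "u \<in> borel_measurable circle_measure" "AE \<zeta> in circle_measure. norm (u \<zeta>) \<le> B"
    and v: "v \<in> hardy2_circle"
    and orth: "\<And>g. g \<in> hardy2_circle \<Longrightarrow> (LINT \<zeta>|circle_measure. (u \<zeta> - v \<zeta>) * cnj (g \<zeta>)) = 0"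
    and f: "\<And>z. z \<in> unit_disk \<Longrightarrow> (\<lambda>n. fourier_coeff v (int n) * z ^ n) sums f z"
    using assms unfolding BMOA_def is_P_plus_def Linf_circle_def by auto
  have iu: "integrable circle_measure u" by (rule integrable_circle_bounded[OF u])
  have iv: "integrable circle_measure v"
  proof (rule Bochner_Integration.integrable_bound[where f = "\<lambda>\<zeta>. 1 + (norm (v \<zeta>))\<^sup>2"])
    show "AE \<zeta> in circle_measure. norm (v \<zeta>) \<le> norm (1 + (norm (v \<zeta>))\<^sup>2)"
    proof (rule AE_I2)
      fix \<zeta> show "norm (v \<zeta>) \<le> norm (1 + (norm (v \<zeta>))\<^sup>2)"
        using sum_squares_bound[of 1 "norm (v \<zeta>)"] norm_ge_zero[of "v \<zeta>"] by (simp del: norm_ge_zero)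
    qed
  qed (use v in \<open>auto simp: hardy2_circle_def L2_circle_def\<close>)
  have coeff: "taylor_coeff f n = (LINT \<zeta>|circle_measure. u \<zeta> * cnj \<zeta> ^ n)" for n
  proof -
    have i: "integrable circle_measure (\<lambda>\<zeta>. w \<zeta> * cnj \<zeta> ^ n)" if "integrable circle_measure w" for w
      using integrable_circle_continuous_mult[OF _ that, of "\<lambda>\<zeta>. cnj \<zeta> ^ n"]
      by (simp add: mult.commute continuous_intros)
    have "(LINT \<zeta>|circle_measure. u \<zeta> * cnj \<zeta> ^ n - v \<zeta> * cnj \<zeta> ^ n) = 0"
      using orth[OF power_in_hardy2_circle[of n]] by (simp add: left_diff_distrib)
    then have "(LINT \<zeta>|circle_measure. u \<zeta> * cnj \<zeta> ^ n) = (LINT \<zeta>|circle_measure. v \<zeta> * cnj \<zeta> ^ n)"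
      using i[OF iu] i[OF iv] by simp
    then show ?thesis
      using taylor_coeff_eqI[OF f, of n] by (simp add: fourier_coeff_cnj_power)
  qed
  have fH: "f \<in> H2"
    by (rule H2_boundI(1)[OF holomorphic_power_series_on_disk[OF f] bessel_circle[OF u, folded coeff]])
  have lim: "(\<lambda>n. LINT \<zeta>|circle_measure. u \<zeta> * cnj (Q (of_real (radius n) * \<zeta>))) \<longlonglongrightarrow> hip f Q" if Q: "Q \<in> H2" for Q
  proof -
    have "(LINT \<zeta>|circle_measure. u \<zeta> * cnj (Q (of_real (radius n) * \<zeta>)))
        = (\<Sum>j. taylor_coeff f j * cnj (taylor_coeff Q j) * of_real (radius n ^ j))" for n
    proof -
      let ?y = "\<lambda>j \<zeta>. cnj (taylor_coeff Q j * (of_real (radius n) * \<zeta>) ^ j)"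
      have "(\<lambda>j. LINT \<zeta>|circle_measure. u \<zeta> * ?y j \<zeta>) sums (LINT \<zeta>|circle_measure. u \<zeta> * (\<Sum>j. ?y j \<zeta>))"
        by (intro integral_circle_series[OF iu _ _ taylor_summable[OF H2_holomorphic[OF Q] radius(1,2)[of n]]] continuous_intros)
           (use radius(1)[of n] in \<open>auto simp: norm_mult norm_power\<close>)
      also have "(LINT \<zeta>|circle_measure. u \<zeta> * (\<Sum>j. ?y j \<zeta>)) = (LINT \<zeta>|circle_measure. u \<zeta> * cnj (Q (of_real (radius n) * \<zeta>)))"
      proof (rule Bochner_Integration.integral_cong[OF refl])
        fix \<zeta> :: complex assume "\<zeta> \<in> space circle_measure"
        then have "of_real (radius n) * \<zeta> \<in> unit_disk" using radius(1,2)[of n] by (simp add: norm_mult)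
        from taylor_sums[OF H2_holomorphic[OF Q] this]
        have "(\<lambda>j. ?y j \<zeta>) sums cnj (Q (of_real (radius n) * \<zeta>))" by (simp only: sums_cnj)
        then show "u \<zeta> * (\<Sum>j. ?y j \<zeta>) = u \<zeta> * cnj (Q (of_real (radius n) * \<zeta>))" by (simp only: sums_iff)
      qed
      also have "(\<lambda>j. LINT \<zeta>|circle_measure. u \<zeta> * ?y j \<zeta>)
          = (\<lambda>j. taylor_coeff f j * cnj (taylor_coeff Q j) * of_real (radius n ^ j))"
      proof
        fix j
        have "(LINT \<zeta>|circle_measure. u \<zeta> * ?y j \<zeta>)
           = (LINT \<zeta>|circle_measure. (cnj (taylor_coeff Q j) * of_real (radius n ^ j)) * (u \<zeta> * cnj \<zeta> ^ j))"
          by (simp add: power_mult_distrib mult_ac)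
        also have "\<dots> = (cnj (taylor_coeff Q j) * of_real (radius n ^ j)) * taylor_coeff f j"
          unfolding coeff by (rule integral_mult_right_zero)
        finally show "(LINT \<zeta>|circle_measure. u \<zeta> * ?y j \<zeta>) = taylor_coeff f j * cnj (taylor_coeff Q j) * of_real (radius n ^ j)"
          by (simp add: mult_ac)
      qed
      finally show ?thesis by (simp only: sums_iff)
    qed
    then show ?thesis using hip_abel_limit[OF fH Q, of "\<lambda>j. j"] by simp
  qed
  have "(\<Sum>k<K. (norm (hip f (\<lambda>z. z ^ k * P z)))\<^sup>2) \<le> B\<^sup>2 * hnsq P" if "P \<in> H2" for P K
    by (rule hankel_form_bound[where u = "\<lambda>_. u", OF u lim that])
  with fH show ?thesis by blast
qed

lemma hip_cong_left: "(\<And>n. taylor_coeff f n = taylor_coeff f' n) \<Longrightarrow> hip f g = hip f' g"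
  by (simp add: hip_def)

context mates
begin

lemma quotient_holomorphic: "(\<lambda>z. b z / a z) holomorphic_on unit_disk"
  by (intro holomorphic_intros a_holomorphic b_holomorphic a_nonzero)

text \<open>
  For \<open>P\<close> in \<open>H2\<close> the function \<open>T P\<close> in the proof is, formally, the projection of \<open>cnj P * f\<close>, so that
  \<open>T (b / a)\<close> is the expected partner. The bound on the Hankel form makes \<open>T\<close> continuous, which
  is what justifies moving the unbounded factor \<open>b / a\<close> across the inner product.
\<close>

lemma dBR_if_hankel_bounded:
  assumes \<phi>: "(\<lambda>z. b z / a z) \<in> H2" and f: "f \<in> H2"
    and bound: "\<And>P K. P \<in> H2 \<Longrightarrow> (\<Sum>k<K. (norm (hip f (\<lambda>z. z ^ k * P z)))\<^sup>2) \<le> C * hnsq P"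
  shows "f \<in> dBR"
proof -
  define T where "T = (\<lambda>P z. \<Sum>k. hip f (\<lambda>z. z ^ k * P z) * z ^ k)"
  have T: "T P holomorphic_on unit_disk" "taylor_coeff (T P) k = hip f (\<lambda>z. z ^ k * P z)" if P: "P \<in> H2" for P k
  proof -
    have "norm (hip f (\<lambda>z. z ^ k * P z)) \<le> sqrt (C * hnsq P)" for k
    proof (rule real_le_rsqrt)
      have "(norm (hip f (\<lambda>z. z ^ k * P z)))\<^sup>2 \<le> (\<Sum>j<Suc k. (norm (hip f (\<lambda>z. z ^ j * P z)))\<^sup>2)"
        by (simp add: sum_nonneg)
      then show "(norm (hip f (\<lambda>z. z ^ k * P z)))\<^sup>2 \<le> C * hnsq P" using bound[OF P, of "Suc k"] by linarith
    qed
    note s = bounded_power_series[OF this]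
    show "T P holomorphic_on unit_disk" "taylor_coeff (T P) k = hip f (\<lambda>z. z ^ k * P z)"
      unfolding T_def using holomorphic_power_series_on_disk[OF s] taylor_coeff_eqI[OF s] by auto
  qed
  have TH: "T P \<in> H2" "hnsq (T P) \<le> C * hnsq P" if "P \<in> H2" for P
    using H2_boundI[OF T(1)[OF that]] bound[OF that] by (auto simp: T(2)[OF that])
  note zP = power_mult_in_H2
  have T_add: "taylor_coeff (T (\<lambda>z. P z + Q z)) k = taylor_coeff (T P) k + taylor_coeff (T Q) k"
    if "P \<in> H2" "Q \<in> H2" for P Q k
    using hardy.ip_add_right[OF zP[OF that(1)] zP[OF that(2)] f, of k k]
    by (simp add: T(2) that H2_add ring_distribs)
  have T_diff: "taylor_coeff (T (\<lambda>z. P z - Q z)) k = taylor_coeff (T P) k - taylor_coeff (T Q) k"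
    if "P \<in> H2" "Q \<in> H2" for P Q k
    using hardy.ip_diff_right[OF zP[OF that(1)] zP[OF that(2)] f, of k k]
    by (simp add: T(2) that H2_diff ring_distribs)
  have T_scale: "taylor_coeff (T (\<lambda>z. c * P z)) k = cnj c * taylor_coeff (T P) k"
    if "P \<in> H2" for P c k
    using hardy.ip_scale_right[OF zP[OF that] f, of c k]
    by (simp add: T(2) that H2_scale mult.left_commute)
  (* The adjoint identity is reached in two steps, since a product of two functions in H2 is
     controlled in H2 only if one factor is bounded: first P is a monomial and h arbitrary, then h is
     bounded and P arbitrary. *)
  have T_power: "hip (T (\<lambda>z. z ^ j)) h = hip f (\<lambda>z. z ^ j * h z)" if "h \<in> H2" for h j
  proof -
    let ?L = "\<lambda>h. hip (T (\<lambda>z. z ^ j)) h - hip f (\<lambda>z. z ^ j * h z)"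
    note Tj = TH(1)[OF power_in_H2[of j]]
    have "?L h = 0"
    proof (rule H2_functional_eq_0[OF _ _ _ _ that, of ?L])
      show "?L (\<lambda>z. P z + Q z) = ?L P + ?L Q" if "P \<in> H2" "Q \<in> H2" for P Q
        unfolding ring_distribs hardy.ip_add_right[OF that Tj] hardy.ip_add_right[OF zP[OF that(1)] zP[OF that(2)] f] by simp
      show "?L (\<lambda>z. c * P z) = cnj c * ?L P" if "P \<in> H2" for c P
        unfolding mult.left_commute[of _ c] hardy.ip_scale_right[OF that Tj] hardy.ip_scale_right[OF zP[OF that] f]
        by (simp add: right_diff_distrib)
      show "(\<lambda>n. ?L (F n)) \<longlonglongrightarrow> ?L P"
        if F: "\<And>n::nat. F n \<in> H2" "P \<in> H2" "(\<lambda>n. hnsq (\<lambda>z. F n z - P z)) \<longlonglongrightarrow> 0" for F P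
      proof (intro tendsto_diff)
        show "(\<lambda>n. hip (T (\<lambda>z. z ^ j)) (F n)) \<longlonglongrightarrow> hip (T (\<lambda>z. z ^ j)) P"
          by (rule hardy.ip_tendsto_right[OF F(1,2) Tj F(3)])
        have "(\<lambda>n. hnsq (\<lambda>z. z ^ j * F n z - z ^ j * P z)) \<longlonglongrightarrow> 0"
          by (rule multiplier_tendsto[where M = 1, OF _ _ F])
             (auto intro!: holomorphic_intros simp: norm_power power_le_one)
        then show "(\<lambda>n. hip f (\<lambda>z. z ^ j * F n z)) \<longlonglongrightarrow> hip f (\<lambda>z. z ^ j * P z)"
          by (rule hardy.ip_tendsto_right[OF zP[OF F(1)] zP[OF F(2)] f])
      qed
      show "?L (\<lambda>z. z ^ k) = 0" for k
        by (simp add: hip_power T(2) power_in_H2 mult.commute)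
    qed
    then show ?thesis by simp
  qed
  have T_adj: "hip (T P) h = hip f (\<lambda>z. h z * P z)"
    if P: "P \<in> H2" and h: "h holomorphic_on unit_disk" "\<And>z. z \<in> unit_disk \<Longrightarrow> norm (h z) \<le> 1" for P h
  proof -
    have hH: "h \<in> H2" by (rule bounded_holomorphic_in_H2(1)[OF h])
    have hP: "(\<lambda>z. h z * P z) \<in> H2" if "P \<in> H2" for P
      using H2_multiplier(1)[OF h that] .
    let ?L = "\<lambda>P. hip (T P) h - hip f (\<lambda>z. h z * P z)"
    have "?L P = 0"
    proof (rule H2_functional_eq_0[OF _ _ _ _ P, of ?L])
      show "?L (\<lambda>z. P z + Q z) = ?L P + ?L Q" if PQ: "P \<in> H2" "Q \<in> H2" for P Q
      proof -
        have "hip (T (\<lambda>z. P z + Q z)) h = hip (\<lambda>z. T P z + T Q z) h"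
          by (rule hip_cong_left) (simp add: T_add PQ taylor_coeff_add T(1))
        then show ?thesis
          using hardy.ip_add_right[OF hP[OF PQ(1)] hP[OF PQ(2)] f]
            hardy.ip_add[OF TH(1)[OF PQ(1)] TH(1)[OF PQ(2)] hH]
          by (simp add: ring_distribs)
      qed
      show "?L (\<lambda>z. c * P z) = cnj c * ?L P" if P: "P \<in> H2" for c P
      proof -
        have "hip (T (\<lambda>z. c * P z)) h = hip (\<lambda>z. cnj c * T P z) h"
          by (rule hip_cong_left) (simp add: T_scale P taylor_coeff_cmult T(1))
        then show ?thesis
          using hardy.ip_scale_right[OF hP[OF P] f, of c]
            hardy.ip_scale[OF TH(1)[OF P] hH, of "cnj c"]
          by (simp add: ring_distribs mult.left_commute)
      qed
      show "(\<lambda>n. ?L (F n)) \<longlonglongrightarrow> ?L P"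
        if F: "\<And>n::nat. F n \<in> H2" "P \<in> H2" "(\<lambda>n. hnsq (\<lambda>z. F n z - P z)) \<longlonglongrightarrow> 0" for F P
      proof (intro tendsto_diff)
        show "(\<lambda>n. hip f (\<lambda>z. h z * F n z)) \<longlonglongrightarrow> hip f (\<lambda>z. h z * P z)"
          by (rule hardy.ip_tendsto_right[OF hP[OF F(1)] hP[OF F(2)] f multiplier_tendsto[OF h F]])
        have "hnsq (\<lambda>z. T (F n) z - T P z) = hnsq (T (\<lambda>z. F n z - P z))" for n
        proof -
          have "taylor_coeff (\<lambda>z. T (F n) z - T P z) k = taylor_coeff (T (\<lambda>z. F n z - P z)) k" for k
            using F by (simp add: taylor_coeff_diff T(1) T_diff)
          then show ?thesis by (simp add: hip_def)
        qed
        then have le: "hnsq (\<lambda>z. T (F n) z - T P z) \<le> C * hnsq (\<lambda>z. F n z - P z)" for n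
          using TH(2)[OF H2_diff[OF F(1,2)]] by simp
        have "(\<lambda>n. hnsq (\<lambda>z. T (F n) z - T P z)) \<longlonglongrightarrow> 0"
        proof (rule tendsto_sandwich[OF _ _ tendsto_const])
          show "(\<lambda>n. C * hnsq (\<lambda>z. F n z - P z)) \<longlonglongrightarrow> 0" using tendsto_mult_right_zero[OF F(3)] .
          show "\<forall>\<^sub>F n in sequentially. 0 \<le> hnsq (\<lambda>z. T (F n) z - T P z)"
            by (intro always_eventually allI hardy.ip_nonneg H2_diff TH F)
          show "\<forall>\<^sub>F n in sequentially. hnsq (\<lambda>z. T (F n) z - T P z) \<le> C * hnsq (\<lambda>z. F n z - P z)"
            using le by (intro always_eventually allI)
        qed
        then show "(\<lambda>n. hip (T (F n)) h) \<longlonglongrightarrow> hip (T P) h"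
          by (rule hardy.ip_tendsto[where F = "\<lambda>n. T (F n)", OF TH(1)[OF F(1)] TH(1)[OF F(2)] hH])
      qed
      show "?L (\<lambda>z. z ^ k) = 0" for k
        using T_power[OF hH, of k] by (simp add: mult.commute)
    qed
    then show ?thesis by simp
  qed
  let ?\<phi> = "\<lambda>z. b z / a z"
  have "partner f (T ?\<phi>)"
  proof (rule partnerI_powers[OF f TH(1)[OF \<phi>]])
    fix k
    have az: "(\<lambda>z. a z * z ^ k) holomorphic_on unit_disk" "\<And>z. z \<in> unit_disk \<Longrightarrow> norm (a z * z ^ k) \<le> 1"
      using a_le_1 by (auto intro!: holomorphic_intros a_holomorphic mult_le_one simp: norm_mult norm_power power_le_one)
    have "hip f (\<lambda>z. b z * z ^ k) = hip f (\<lambda>z. (a z * z ^ k) * (b z / a z))"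
      by (rule hip_cong) (auto intro!: holomorphic_intros b_holomorphic H2_holomorphic[OF f] simp: a_nonzero)
    then show "hip f (\<lambda>z. b z * z ^ k) = hip (T ?\<phi>) (\<lambda>z. a z * z ^ k)"
      using T_adj[OF \<phi> az] by simp
  qed
  then show ?thesis by (auto simp: dBR_def)
qed

end


section \<open>Absolutely convergent Taylor series and uniform boundedness\<close>

text \<open>
  Absolutely convergent Taylor series: a Banach space inside both the bounded analytic functions and
  BMOA, whose unit ball contains the monomials and whose continuous linear functionals are the
  bounded sequences.
\<close>

lemma l1_power_series:
  fixes c :: "nat \<Rightarrow> complex"
  assumes c: "summable (\<lambda>n. norm (c n))"
  defines "f \<equiv> \<lambda>z. \<Sum>n. c n * z ^ n"
  shows l1_power_series_sums: "norm z \<le> 1 \<Longrightarrow> (\<lambda>n. c n * z ^ n) sums f z"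
    and l1_power_series_bound: "norm z \<le> 1 \<Longrightarrow> norm (f z) \<le> (\<Sum>n. norm (c n))"
    and l1_power_series_continuous: "continuous_on (sphere 0 1) f"
proof -
  have le: "norm (c n * z ^ n) \<le> norm (c n)" if "norm z \<le> 1" for n z
    using that by (simp add: norm_mult norm_power mult_left_le power_le_one)
  have s: "summable (\<lambda>n. norm (c n * z ^ n))" if "norm z \<le> 1" for z
    by (rule summable_comparison_test'[OF c, of 0]) (use le[OF that] in simp)
  show "(\<lambda>n. c n * z ^ n) sums f z" if "norm z \<le> 1"
    unfolding f_def by (rule summable_sums, rule summable_norm_cancel, rule s[OF that])
  show "norm (f z) \<le> (\<Sum>n. norm (c n))" if "norm z \<le> 1"
    unfolding f_def
    using summable_norm[OF s[OF that]] suminf_le[OF le[OF that] s[OF that] c] by linarith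
  have "uniform_limit (sphere 0 1) (\<lambda>n z. \<Sum>k<n. c k * z ^ k) f sequentially"
    unfolding f_def by (rule Weierstrass_m_test[OF _ c]) (simp add: le)
  then show "continuous_on (sphere 0 1) f"
    by (rule uniform_limit_theorem[rotated]) (auto intro!: always_eventually continuous_intros)
qed

lemma l1_power_series_in_hardy_inf:
  fixes c :: "nat \<Rightarrow> complex"
  assumes c: "summable (\<lambda>n. norm (c n))"
  shows "(\<lambda>z. \<Sum>n. c n * z ^ n) \<in> hardy_inf"
proof -
  have "(\<lambda>z. \<Sum>n. c n * z ^ n) holomorphic_on unit_disk"
    by (rule holomorphic_power_series_on_disk) (rule l1_power_series_sums[OF c], simp)
  then show ?thesis
    using l1_power_series_bound[OF c] unfolding hardy_inf_def bounded_iff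
    by (auto intro!: exI[of _ "\<Sum>n. norm (c n)"])
qed

lemma l1_power_series_in_BMOA:
  fixes c :: "nat \<Rightarrow> complex"
  assumes c: "summable (\<lambda>n. norm (c n))"
  shows "(\<lambda>z. \<Sum>n. c n * z ^ n) \<in> BMOA"
proof -
  let ?f = "\<lambda>z. \<Sum>n. c n * z ^ n"
  note cont = l1_power_series_continuous[OF c]
  have Linf: "?f \<in> Linf_circle"
    unfolding Linf_circle_def using l1_power_series_bound[OF c]
    by (auto intro!: borel_measurable_circle_continuous cont AE_I2 exI[of _ "\<Sum>n. norm (c n)"])
  have L2: "?f \<in> L2_circle"
    unfolding L2_circle_def
    by (auto intro!: borel_measurable_circle_continuous integrable_circle_continuous continuous_intros cont)
  have coeff: "(\<lambda>n. if int n = m then c n else 0) sums fourier_coeff ?f m" for m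
  proof -
    have nz: "continuous_on (sphere 0 1) (\<lambda>\<zeta>::complex. \<zeta> powi (- m))" by (intro continuous_intros) auto
    have "(\<lambda>n. LINT \<zeta>|circle_measure. \<zeta> powi (- m) * (c n * \<zeta> ^ n)) sums
       (LINT \<zeta>|circle_measure. \<zeta> powi (- m) * (\<Sum>n. c n * \<zeta> ^ n))"
      by (rule integral_circle_series[OF integrable_circle_continuous[OF nz] _ _ c])
         (auto intro!: continuous_intros simp: norm_mult norm_power)
    also have "(\<lambda>n. LINT \<zeta>|circle_measure. \<zeta> powi (- m) * (c n * \<zeta> ^ n)) = (\<lambda>n. if int n = m then c n else 0)"
    proof
      fix n
      have "(LINT \<zeta>|circle_measure. \<zeta> powi (- m) * (c n * \<zeta> ^ n)) = (LINT \<zeta>|circle_measure. c n * \<zeta> powi (int n - m))"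
      proof (rule Bochner_Integration.integral_cong[OF refl])
        fix \<zeta> :: complex assume "\<zeta> \<in> space circle_measure"
        then have "\<zeta> \<noteq> 0" by auto
        then show "\<zeta> powi (- m) * (c n * \<zeta> ^ n) = c n * \<zeta> powi (int n - m)"
          using power_int_add[of \<zeta> "int n" "- m"] by simp
      qed
      then show "(LINT \<zeta>|circle_measure. \<zeta> powi (- m) * (c n * \<zeta> ^ n)) = (if int n = m then c n else 0)"
        by (simp add: integral_circle_powi)
    qed
    finally show ?thesis by (simp add: fourier_coeff_def mult.commute)
  qed
  have "fourier_coeff ?f m = 0" if "m < 0" for m
    using sums_unique2[OF coeff[of m], of 0] that by simp
  then have H: "?f \<in> hardy2_circle" using L2 by (simp add: hardy2_circle_def)
  have "fourier_coeff ?f (int n) = c n" for n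
    using sums_unique2[OF coeff[of "int n", unfolded of_nat_eq_iff] sums_single[of n c]] .
  then have "is_P_plus ?f ?f"
    unfolding is_P_plus_def using H l1_power_series_sums[OF c] by (intro bexI[of _ ?f]) auto
  then show ?thesis using Linf unfolding BMOA_def by blast
qed

text \<open>
  A gliding hump argument: the vectors \<open>X k\<close> differ, up to sign, by \<open>(1/3) ^ k\<close> times a unit vector at a coordinate
  where the \<open>k\<close>-th functional nearly attains its norm \<open>S k\<close>, with the sign chosen so that the functional
  does not lose this contribution.  All later steps together are half as large as the \<open>k\<close>-th one, so
  they cannot cancel the two thirds of \<open>S k / 3 ^ k\<close> gained there.
\<close>

lemma l1_uniform_boundedness:
  fixes \<Lambda> :: "(nat \<Rightarrow> complex) set"
  assumes each: "\<And>l. l \<in> \<Lambda> \<Longrightarrow> \<exists>B. \<forall>n. norm (l n) \<le> B"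
    and pointwise: "\<And>x. summable (\<lambda>n. norm (x n)) \<Longrightarrow> \<exists>M. \<forall>l\<in>\<Lambda>. norm (\<Sum>n. x n * l n) \<le> M"
  shows "\<exists>C. \<forall>l\<in>\<Lambda>. \<forall>n. norm (l n) \<le> C"
proof (rule ccontr)
  assume unbounded: "\<not> ?thesis"
  have "\<exists>l S m. l \<in> \<Lambda> \<and> 4 ^ k \<le> S \<and> (\<forall>n. norm (l n) \<le> S) \<and> 2/3 * S \<le> norm (l m)" for k :: nat
  proof -
    obtain l n where l: "l \<in> \<Lambda>" and n: "4 ^ k < norm (l n)" using unbounded by (meson not_le)
    have bdd: "bdd_above (range (\<lambda>n. norm (l n)))" using each[OF l] by (auto simp: bdd_above_def)
    define S where "S = (SUP n. norm (l n))"
    have le: "norm (l j) \<le> S" for j unfolding S_def by (rule cSUP_upper[OF _ bdd]) simp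
    have "4 ^ k \<le> S" using le[of n] n by simp
    moreover from this have "0 < S" by (rule less_le_trans[rotated]) simp
    then have "2/3 * S < S" by simp
    then obtain m where "2/3 * S < norm (l m)"
      using less_cSUP_iff[OF _ bdd, of "2/3 * S"] unfolding S_def by blast
    ultimately show ?thesis using l le by (meson less_imp_le)
  qed
  then obtain l S m where l: "\<And>k::nat. l k \<in> \<Lambda>" and S: "\<And>k. 4 ^ k \<le> S k"
    and lS: "\<And>k n. norm (l k n) \<le> S k" and m: "\<And>k. 2/3 * S k \<le> norm (l k (m k))"
    by metis
  let ?e = "\<lambda>k. complex_of_real ((1/3) ^ k)"
  let ?step = "\<lambda>k X s. X(m k := X (m k) + s * ?e k)"
  let ?A = "\<lambda>k X. \<Sum>n. X n * l k n"
  define X where "X = rec_nat (\<lambda>_. 0) (\<lambda>k X. if (1/3) ^ k * norm (l k (m k)) \<le> norm (?A k (?step k X 1)) then ?step k X 1 else ?step k X (-1))"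
  have X0: "X 0 = (\<lambda>_. 0)" by (simp add: X_def)
  have XS: "X (Suc k) = (if (1/3) ^ k * norm (l k (m k)) \<le> norm (?A k (?step k (X k) 1)) then ?step k (X k) 1 else ?step k (X k) (-1))" for k
    by (simp add: X_def)
  have fin: "finite {n. X k n \<noteq> 0}" for k
  proof (induction k)
    case (Suc k)
    have "{n. X (Suc k) n \<noteq> 0} \<subseteq> insert (m k) {n. X k n \<noteq> 0}" by (auto simp: XS split: if_splits)
    with Suc show ?case by (rule finite_subset[rotated, OF finite.insertI])
  qed (simp add: X0)
  have A_sum: "(\<lambda>n. X k n * h n) sums (\<Sum>n. X k n * h n)" for k h
    by (rule summable_sums, rule summable_finite[OF fin[of k]]) auto
  have A_step: "(\<Sum>n. ?step k (X k) s n * h n) = (\<Sum>n. X k n * h n) + s * ?e k * h (m k)" for k s h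
  proof -
    have "(\<lambda>n. X k n * h n + (if n = m k then s * ?e k * h n else 0)) sums ((\<Sum>n. X k n * h n) + s * ?e k * h (m k))"
      by (intro sums_add A_sum sums_single)
    moreover have "(\<lambda>n. X k n * h n + (if n = m k then s * ?e k * h n else 0)) = (\<lambda>n. ?step k (X k) s n * h n)"
      by (auto simp: algebra_simps)
    ultimately show ?thesis by (simp only: sums_iff)
  qed
  have gain: "(1/3) ^ k * norm (l k (m k)) \<le> norm (?A k (X (Suc k)))" for k
  proof (cases "(1/3) ^ k * norm (l k (m k)) \<le> norm (?A k (?step k (X k) 1))")
    case False
    (* The difference of ?a + ?b and ?a - ?b is 2 * ?b, so one of the two is at least as large as ?b. *)
    let ?a = "?A k (X k)" and ?b = "?e k * l k (m k)"
    have b: "norm ?b = (1/3) ^ k * norm (l k (m k))" by (simp add: norm_mult norm_power norm_divide)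
    have "norm (?a + ?b) < norm ?b" using False unfolding A_step b by simp
    moreover have "2 * norm ?b \<le> norm (?a + ?b) + norm (?a - ?b)"
      using norm_triangle_ineq4[of "?a + ?b" "?a - ?b"] norm_mult[of 2 ?b] by (simp add: algebra_simps)
    ultimately have "norm ?b \<le> norm (?a - ?b)" by simp
    moreover have "?A k (X (Suc k)) = ?a - ?b" using False A_step[of k "-1" "l k"] by (simp add: XS)
    ultimately show ?thesis unfolding b by simp
  qed (simp add: XS)
  have diff1: "(\<Sum>n<N. norm (X (Suc k) n - X k n)) \<le> (1/3) ^ k" for k N
  proof -
    have "norm (X (Suc k) n - X k n) = (if n = m k then (1/3) ^ k else 0)" for n
      by (auto simp: XS norm_power norm_divide)
    then show ?thesis by (simp add: sum.delta)
  qed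
  have diff: "(\<Sum>n<N. norm (X j n - X k n)) \<le> 3/2 * ((1/3) ^ k - (1/3) ^ j)" if "k \<le> j" for j k N
    using that
  proof (induction j rule: dec_induct)
    case (step j)
    have "(\<Sum>n<N. norm (X (Suc j) n - X k n)) \<le> (\<Sum>n<N. norm (X (Suc j) n - X j n) + norm (X j n - X k n))"
      by (intro sum_mono) (metis diff_add_cancel add_diff_eq norm_triangle_ineq)
    also have "\<dots> \<le> (1/3) ^ j + 3/2 * ((1/3) ^ k - (1/3) ^ j)"
      unfolding sum.distrib using diff1[where N=N and k=j] step.IH by (intro add_mono)
    finally show ?case by (simp add: field_simps)
  qed simp
  have "Cauchy (\<lambda>j. X j n)" for n
  proof (rule metric_CauchyI)
    fix e :: real assume e: "e > 0"
    obtain K where K: "(1/3) ^ K < e / 3" using real_arch_pow_inv[of "e / 3" "1/3::real"] e by auto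
    have near: "norm (X j n - X K n) < e / 2" if "j \<ge> K" for j
    proof -
      have "norm (X j n - X K n) \<le> (\<Sum>i<Suc n. norm (X j i - X K i))" by (simp add: sum_nonneg)
      also have "\<dots> \<le> 3/2 * ((1/3) ^ K - (1/3) ^ j)" by (rule diff[OF that])
      also have "\<dots> \<le> 3/2 * (1/3) ^ K" by simp
      finally show ?thesis using K by linarith
    qed
    show "\<exists>K. \<forall>i\<ge>K. \<forall>j\<ge>K. dist (X i n) (X j n) < e"
      using near by (metis dist_commute dist_norm dist_triangle_half_r)
  qed
  then have "\<forall>n. \<exists>x. (\<lambda>j. X j n) \<longlonglongrightarrow> x" using Cauchy_convergent unfolding convergent_def by blast
  from choice[OF this] obtain x where "\<forall>n. (\<lambda>j. X j n) \<longlonglongrightarrow> x n" by (rule exE)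
  then have x: "\<And>n. (\<lambda>j. X j n) \<longlonglongrightarrow> x n" by (rule spec)
  have tail: "(\<Sum>n<N. norm (x n - X k n)) \<le> 3/2 * (1/3) ^ k" for k N
  proof (rule LIMSEQ_le_const2)
    show "(\<lambda>j. \<Sum>n<N. norm (X j n - X k n)) \<longlonglongrightarrow> (\<Sum>n<N. norm (x n - X k n))"
      by (intro tendsto_intros x)
    have "(\<Sum>n<N. norm (X j n - X k n)) \<le> 3/2 * (1/3) ^ k" if "j \<ge> k" for j
      by (rule order_trans[OF diff[OF that]]) simp
    then show "\<exists>M. \<forall>j\<ge>M. (\<Sum>n<N. norm (X j n - X k n)) \<le> 3/2 * (1/3) ^ k" by blast
  qed
  have tail_summable: "summable (\<lambda>n. norm (x n - X k n))" for k
    by (rule summableI_nonneg_bounded[OF _ tail]) simp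
  have xsum: "summable (\<lambda>n. norm (x n))" using tail_summable[of 0] by (simp add: X0)
  obtain M where M: "\<And>k. norm (?A k x) \<le> M" using pointwise[OF xsum] l by blast
  have growth: "(4/3) ^ k / 6 \<le> M" for k
  proof -
    have bd: "norm ((x n - X (Suc k) n) * l k n) \<le> norm (x n - X (Suc k) n) * S k" for n
      unfolding norm_mult by (intro mult_left_mono lS) simp
    have s: "summable (\<lambda>n. norm (x n - X (Suc k) n) * S k)" by (rule summable_mult2[OF tail_summable])
    have s': "summable (\<lambda>n. norm ((x n - X (Suc k) n) * l k n))"
      by (rule summable_comparison_test'[OF s, of 0]) (use bd in simp)
    have S0: "0 \<le> S k" using lS[of k 0] norm_ge_zero order_trans by blast
    have "norm (\<Sum>n. (x n - X (Suc k) n) * l k n) \<le> (\<Sum>n. norm (x n - X (Suc k) n) * S k)"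
      using summable_norm[OF s'] suminf_le[OF bd s' s] by linarith
    also have "\<dots> = (\<Sum>n. norm (x n - X (Suc k) n)) * S k" by (rule suminf_mult2[OF tail_summable, symmetric])
    also have "\<dots> \<le> 3/2 * (1/3) ^ Suc k * S k"
      by (intro mult_right_mono suminf_le_const tail_summable tail S0)
    finally have small: "norm (\<Sum>n. (x n - X (Suc k) n) * l k n) \<le> 1/2 * (1/3) ^ k * S k" by simp
    have "(\<lambda>n. (x n - X (Suc k) n) * l k n + X (Suc k) n * l k n) sums ((\<Sum>n. (x n - X (Suc k) n) * l k n) + ?A k (X (Suc k)))"
      by (intro sums_add A_sum summable_sums summable_norm_cancel[OF s'])
    then have "?A k x = (\<Sum>n. (x n - X (Suc k) n) * l k n) + ?A k (X (Suc k))"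
      by (simp add: sums_iff algebra_simps)
    then have "norm (?A k (X (Suc k))) - norm (\<Sum>n. (x n - X (Suc k) n) * l k n) \<le> norm (?A k x)"
      using norm_triangle_ineq2[of "?A k (X (Suc k))" "- (\<Sum>n. (x n - X (Suc k) n) * l k n)"] by (simp add: add.commute)
    moreover have "(1/3) ^ k * (2/3 * S k) \<le> norm (?A k (X (Suc k)))"
      by (rule order_trans[OF mult_left_mono[OF m] gain]) simp
    ultimately have "(1/3) ^ k * (2/3 * S k) - 1/2 * (1/3) ^ k * S k \<le> M"
      using small M[of k] by linarith
    moreover have "(1/3) ^ k * (2/3 * S k) - 1/2 * (1/3) ^ k * S k = (1/3) ^ k * S k / 6" by simp
    moreover have "(1/3) ^ k * 4 ^ k \<le> (1/3) ^ k * S k" by (intro mult_left_mono S) simp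
    moreover have "(1/3::real) ^ k * 4 ^ k = (4/3) ^ k" by (simp flip: power_mult_distrib)
    ultimately show ?thesis by linarith
  qed
  obtain k where "6 * M < (4/3) ^ k" using real_arch_pow[of "4/3::real"] by auto
  with growth[of k] show False by simp
qed

section \<open>Inclusions and the quotient of the mates\<close>

context mates
begin

text \<open>
  Testing against the polynomial with the reversed conjugate coefficients of \<open>b / a\<close> extracts the
  \<open>N\<close>-th Taylor coefficient of \<open>b * p\<close> from \<open>a * p\<close>.  This polynomial is the partner of \<open>z ^ N\<close>.
\<close>

lemma hip_reversed_quotient:
  fixes N :: nat
  assumes "p \<in> H2"
  defines "q \<equiv> \<lambda>z. \<Sum>k\<in>{..N}. cnj (taylor_coeff (\<lambda>z. b z / a z) (N - k)) * z ^ k"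
  shows "hip q (\<lambda>z. a z * p z) = cnj (taylor_coeff (\<lambda>z. b z * p z) N)"
proof -
  let ?\<phi> = "taylor_coeff (\<lambda>z. b z / a z)" and ?ap = "taylor_coeff (\<lambda>z. a z * p z)"
  have "taylor_coeff (\<lambda>z. b z * p z) = taylor_coeff (\<lambda>z. (b z / a z) * (a z * p z))"
    by (rule taylor_coeff_cong) (auto intro!: holomorphic_intros b_holomorphic H2_holomorphic[OF assms(1)] simp: a_nonzero)
  then have "taylor_coeff (\<lambda>z. b z * p z) N = (\<Sum>k\<le>N. ?\<phi> k * ?ap (N - k))"
    using taylor_coeff_mult[OF quotient_holomorphic H2_holomorphic[OF a_mult_in_H2[OF assms(1)]], of N] by simp
  also have "\<dots> = (\<Sum>k\<le>N. ?\<phi> (N - k) * ?ap k)"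
    by (subst sum.nat_diff_reindex[symmetric, where n = "Suc N", simplified lessThan_Suc_atMost]) simp
  finally have 1: "cnj (taylor_coeff (\<lambda>z. b z * p z) N) = (\<Sum>k\<le>N. cnj (?\<phi> (N - k)) * cnj (?ap k))"
    by simp
  have "hip q (\<lambda>z. a z * p z) = (\<Sum>k. if k \<in> {..N} then cnj (?\<phi> (N - k)) * cnj (?ap k) else 0)"
    unfolding hip_def q_def by (intro suminf_cong) (simp add: taylor_coeff_polynomial)
  also have "\<dots> = (\<Sum>k\<le>N. cnj (?\<phi> (N - k)) * cnj (?ap k))"
    by (rule sums_unique[symmetric, OF sums_If_finite_set]) simp
  finally show ?thesis unfolding 1 .
qed

text \<open>
  The functionals \<open>f \<mapsto> hip f (b * p)\<close> with \<open>hnsq (a * p) \<le> 1\<close> are bounded at each \<open>f\<close> by the norm of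
  the partner of \<open>f\<close>, so they are uniformly bounded. At \<open>f = z ^ N\<close> they are the inner products of the
  partner with \<open>a * p\<close>, and the multiples of \<open>a\<close> are dense: this bounds the norm of the partner
  independently of \<open>N\<close>.
\<close>

lemma quotient_in_H2_if_l1_subset:
  assumes incl: "\<And>c. summable (\<lambda>n. norm (c n)) \<Longrightarrow> (\<lambda>z. \<Sum>n. c n * z ^ n) \<in> dBR"
  shows "(\<lambda>z. b z / a z) \<in> H2"
proof -
  let ?\<phi> = "taylor_coeff (\<lambda>z. b z / a z)"
  let ?l = "\<lambda>p n. cnj (taylor_coeff (\<lambda>z. b z * p z) n)"
  let ?\<Lambda> = "?l ` {p \<in> H2. hnsq (\<lambda>z. a z * p z) \<le> 1}"
  have "\<exists>C. \<forall>l\<in>?\<Lambda>. \<forall>n. norm (l n) \<le> C"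
  proof (rule l1_uniform_boundedness)
    fix l assume "l \<in> ?\<Lambda>"
    then obtain p where p: "p \<in> H2" "l = ?l p" by auto
    have "norm (l n) \<le> sqrt (hnsq (\<lambda>z. b z * p z))" for n
    proof (rule real_le_rsqrt)
      note s = hnsq_sums[OF b_mult_in_H2[OF p(1)]]
      show "(norm (l n))\<^sup>2 \<le> hnsq (\<lambda>z. b z * p z)"
        using sum_le_suminf[OF sums_summable[OF s], of "{n}"] sums_unique[OF s] p(2) by simp
    qed
    then show "\<exists>B. \<forall>n. norm (l n) \<le> B" by blast
  next
    fix c :: "nat \<Rightarrow> complex" assume c: "summable (\<lambda>n. norm (c n))"
    let ?f = "\<lambda>z. \<Sum>n. c n * z ^ n"
    obtain g where g: "partner ?f g" using incl[OF c] by (auto simp: dBR_def)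
    then have gH: "g \<in> H2" by (simp add: partner_def)
    have tc: "taylor_coeff ?f n = c n" for n
      by (rule taylor_coeff_eqI) (rule l1_power_series_sums[OF c], simp)
    have "norm (\<Sum>n. c n * ?l p n) \<le> sqrt (hnsq g)" if p: "p \<in> H2" "hnsq (\<lambda>z. a z * p z) \<le> 1" for p
    proof (rule real_le_rsqrt)
      have "(\<Sum>n. c n * ?l p n) = hip ?f (\<lambda>z. b z * p z)" by (simp add: hip_def tc)
      also have "\<dots> = hip g (\<lambda>z. a z * p z)" using g p(1) by (simp add: partner_def)
      finally have "(norm (\<Sum>n. c n * ?l p n))\<^sup>2 \<le> hnsq g * hnsq (\<lambda>z. a z * p z)"
        using hardy.Cauchy_Schwarz[OF gH a_mult_in_H2[OF p(1)]] by simp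
      also have "\<dots> \<le> hnsq g * 1" by (rule mult_left_mono[OF p(2) hardy.ip_nonneg[OF gH]])
      finally show "(norm (\<Sum>n. c n * ?l p n))\<^sup>2 \<le> hnsq g" by simp
    qed
    then show "\<exists>M. \<forall>l\<in>?\<Lambda>. norm (\<Sum>n. c n * l n) \<le> M" by blast
  qed
  then obtain C where C: "\<And>p n. p \<in> H2 \<Longrightarrow> hnsq (\<lambda>z. a z * p z) \<le> 1 \<Longrightarrow> norm (taylor_coeff (\<lambda>z. b z * p z) n) \<le> C"
    by force
  have "(\<Sum>n<N. (norm (?\<phi> n))\<^sup>2) \<le> C\<^sup>2" for N
  proof (cases N)
    case (Suc N')
    define q where "q = (\<lambda>z. \<Sum>k\<in>{..N'}. cnj (?\<phi> (N' - k)) * z ^ k)"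
    have qH: "q \<in> H2" unfolding q_def by (rule polynomial_in_H2) simp
    have "(\<lambda>k. if k \<in> {..N'} then (norm (?\<phi> (N' - k)))\<^sup>2 else 0) sums hnsq q"
      using hnsq_sums[OF qH]
      by (rule sums_cong[THEN iffD1, rotated]) (simp add: q_def taylor_coeff_polynomial)
    from sums_unique2[OF this sums_If_finite_set]
    have "hnsq q = (\<Sum>k\<le>N'. (norm (?\<phi> (N' - k)))\<^sup>2)" by simp
    also have "\<dots> = (\<Sum>n<N. (norm (?\<phi> n))\<^sup>2)"
      unfolding Suc lessThan_Suc_atMost
      by (subst sum.nat_diff_reindex[symmetric, where n = "Suc N'", simplified lessThan_Suc_atMost]) simp
    finally have sum: "(\<Sum>n<N. (norm (?\<phi> n))\<^sup>2) = hnsq q" by simp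
    show ?thesis
    proof (cases "hnsq q = 0")
      case False
      define s where "s = sqrt (hnsq q)"
      have s: "s > 0" "s\<^sup>2 = hnsq q" using False hardy.ip_nonneg[OF qH] by (auto simp: s_def)
      (* Normalized so that the approximating multiples of a fall under the bound C. *)
      let ?Q = "\<lambda>z. of_real (1 / s) * q z"
      have QH: "?Q \<in> H2" by (rule H2_scale[OF qH])
      have Q1: "hnsq ?Q = 1"
        unfolding hardy.nsq_scale[OF qH] norm_of_real using s False by (simp add: power_divide)
      have Qh: "?Q holomorphic_on unit_disk" by (rule H2_holomorphic[OF QH])
      have Qb: "norm (?Q z) \<le> norm (complex_of_real (1/s)) * (\<Sum>k\<le>N'. norm (?\<phi> (N' - k)))" if "z \<in> unit_disk" for z
        unfolding norm_mult q_def
        using that by (intro mult_left_mono order_trans[OF norm_sum] sum_mono)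
           (auto simp: norm_mult norm_power mult_left_le power_le_one)
      obtain c F where c: "norm c = 1" and F: "\<And>n::nat. F n \<in> H2" "\<And>n. hnsq (\<lambda>z. a z * F n z) \<le> hnsq ?Q"
        and lim: "(\<lambda>n. hnsq (\<lambda>z. a z * F n z - c * ?Q z)) \<longlonglongrightarrow> 0"
        using bounded_multiple_approximation[OF Qh Qb] by blast
      have "norm (hip q (\<lambda>z. c * ?Q z)) \<le> C"
      proof (rule LIMSEQ_le_const2)
        show "(\<lambda>n. norm (hip q (\<lambda>z. a z * F n z))) \<longlonglongrightarrow> norm (hip q (\<lambda>z. c * ?Q z))"
          by (intro tendsto_norm hardy.ip_tendsto_right[OF a_mult_in_H2[OF F(1)] H2_scale[OF QH] qH lim])
        have "norm (hip q (\<lambda>z. a z * F n z)) \<le> C" for n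
          using hip_reversed_quotient[OF F(1), of N' n] C[OF F(1), of n N'] F(2)[of n] Q1
          by (simp add: q_def)
        then show "\<exists>M. \<forall>n\<ge>M. norm (hip q (\<lambda>z. a z * F n z)) \<le> C" by blast
      qed
      moreover have "norm (hip q (\<lambda>z. c * ?Q z)) = s"
      proof -
        have "hip q (\<lambda>z. c * ?Q z) = cnj c * (of_real (1 / s) * hip q q)"
          unfolding hardy.ip_scale_right[OF QH qH] hardy.ip_scale_right[OF qH qH] by simp
        also have "hip q q = of_real (s\<^sup>2)" using hardy.ip_self[OF qH] s(2) by simp
        finally show ?thesis using c s(1) by (simp add: norm_mult norm_divide power2_eq_square)
      qed
      ultimately have "s\<^sup>2 \<le> C\<^sup>2" using s(1) by (intro power_mono) auto
      then show ?thesis using s(2) sum by simp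
    qed (simp add: sum)
  qed simp
  from H2_boundI(1)[OF quotient_holomorphic this] show ?thesis .
qed

end

theorem theorem2:
  fixes a b :: "complex \<Rightarrow> complex"
  assumes "b holomorphic_on unit_disk"
    and "b ` unit_disk \<subseteq> unit_disk"
    and "\<not> extreme_point_hardy_inf b"
    and "pythagorean_mate b a"
  shows "(hardy_inf \<subseteq> dBR_space b \<longleftrightarrow> BMOA \<subseteq> dBR_space b) \<and>
         (BMOA \<subseteq> dBR_space b \<longleftrightarrow> (\<lambda>z. b z / a z) \<in> hardy 2)"
proof -
  interpret mates a b by (rule mates_if_pythagorean_mate) fact+
  have "(\<lambda>z. b z / a z) \<in> H2" if "hardy_inf \<subseteq> dBR \<or> BMOA \<subseteq> dBR"
    using that l1_power_series_in_hardy_inf l1_power_series_in_BMOA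
    by (intro quotient_in_H2_if_l1_subset) blast
  moreover have "hardy_inf \<subseteq> dBR \<and> BMOA \<subseteq> dBR" if "(\<lambda>z. b z / a z) \<in> H2"
    using dBR_if_hankel_bounded[OF that] hardy_inf_hankel_bound BMOA_hankel_bound by blast
  ultimately show ?thesis
    unfolding dBR_space_eq hardy_2_eq_H2 by blast
qed

end
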